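(* Let $d\ge2$ and let $(\mathcal H,\mathsf S)$, $\mathsf S=(S_1,\dots,S_{d-1},P)$, be an isometric Hilbert module. (1) There exists a unitary module $(\mathcal K,\mathsf R)$, $\mathsf R=(R_1,\dots,R_{d-1},U)$, containing $(\mathcal H,\mathsf S)$ as an isometrically embedded submodule such that $\mathsf R$ is the minimal extension of $\mathsf S$ (no proper closed subspace of $\mathcal K$ contains $\mathcal H$ and reduces $\mathsf R$). In fact, $\mathcal K=\overline{\operatorname{span}}\{U^mh:h\in\mathcal H,\ m\in\mathbb Z\}$. Moreover, any bounded operator $X$ acting on $\mathcal H$ commutes with $\mathsf S$ if and only if $X$ has a unique norm preserving extension $Y$ acting on $\mathcal K$ commuting with $\mathsf R$ (i.e. a unique bounded $Y$ on $\mathcal K$ commuting with every entry of $\mathsf R$ with $Y|_{\mathcal H}=X$ and $\|Y\|=\|X\|$). (2) With $(\mathcal K,\mathsf R)$ as in (1), a bounded operator $X$ on $\mathcal H$ is in $\mathcal T(\mathsf S)$ if and only if there exists a unique operator $Y$ in the commutant of the von Neumann algebra generated by $\{R_1,\dots,R_{d-1},U\}$ such that $\|X\|=\|Y\|$ and $X=P_{\mathcal H}Y|_{\mathcal H}$. (3) With $(\mathcal K,\mathsf R)$ as in (1), let $C^*(\mathsf S)$ and $C^*(\mathsf R)$ denote the unital $C^*$-algebras generated by $\mathsf S$ and $\mathsf R$ respectively, and let $\mathcal I(\mathsf S)$ denote the closed ideal of $C^*(\mathsf S)$ generated by all the commutators $XY-YX$ for $X,Y\in C^*(\mathsf S)\cap\mathcal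 T(\mathsf S)$. Then there exists a short exact sequence $$0\rightarrow\mathcal I(\mathsf S)\hookrightarrow C^*(\mathsf S)\xrightarrow{\ \pi_0\ }C^*(\mathsf R)\rightarrow0$$ with a completely isometric cross section, where $\pi_0:C^*(\mathsf S)\to C^*(\mathsf R)$ is the canonical unital $*$-homomorphism which sends the generating set $\mathsf S$ to the corresponding generating set $\mathsf R$, i.e. $\pi_0(P)=U$ and $\pi_0(S_i)=R_i$ for all $1\le i\le d-1$.
   Context: Fix $d\ge2$. All Hilbert spaces are complex and all operators are bounded and linear. Let $e_k(z_1,\dots,z_d)=\sum_{1\le j_1<\cdots<j_k\le d}z_{j_1}\cdots z_{j_k}$. The closed symmetrized polydisc is $\Gamma_d=\{(e_1(\boldsymbol z),\dots,e_d(\boldsymbol z)):\boldsymbol z\in\overline{\mathbb D}^d\}\subset\mathbb C^d$, with points written $(s_1,\dots,s_{d-1},p)$; its distinguished boundary is $b\Gamma_d=\{(s_1,\dots,s_{d-1},p)\in\Gamma_d:|p|=1\}$. For a commuting $d$-tuple $\mathsf S=(S_1,\dots,S_{d-1},P)$ of bounded operators on $\mathcal H$, regard $\mathcal H$ as a module over $\mathcal A=\mathbb C[z_1,\dots,z_d]$ by $f\cdot h=f(S_1,\dots,S_{d-1},P)h$; denote it $(\mathcal H,\mathsf S)$. It is a contractive Hilbert module if $\|f(\mathsf S)h\|\le\big(\sup_{\Gamma_d}|f|\big)\|h\|$ for all $f\in\mathcal A$, $h\in\mathcal H$. A submodule is a closed subspace invariant under the tuple, with the restricted tuple. A contractive Hilbert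 module $(\mathcal K,\mathsf R)$, $\mathsf R=(R_1,\dots,R_{d-1},U)$, is a unitary module if all entries of $\mathsf R$ are normal and the Taylor joint spectrum of $\mathsf R$ is contained in $b\Gamma_d$. An isometric Hilbert module is a submodule of a unitary module. "Isometrically embedded submodule" means that there is an isometry $\mathcal H\to\mathcal K$ intertwining $\mathsf S$ and $\mathsf R$ entrywise; $\mathcal H$ is identified with its image in $\mathcal K$, and $P_{\mathcal H}$ is the orthogonal projection of $\mathcal K$ onto $\mathcal H$. A bounded operator $A$ on $\mathcal H$ is an $\mathsf S$-Toeplitz operator if $S_i^*AP=AS_{d-i}$ for each $1\le i\le d-1$ and $P^*AP=A$; $\mathcal T(\mathsf S)$ is the set of all $\mathsf S$-Toeplitz operators. A completely isometric cross section of the exact sequence is a completely isometric linear map $C^*(\mathsf R)\to C^*(\mathsf S)$ that is a right inverse of $\pi_0$. *)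

theory Defs
  imports "HOL-Analysis.Analysis" "HOL-Library.Poly_Mapping"
begin

text \<open>Complex Hilbert spaces; the inner product is linear in its first argument.\<close>

class chilbert_space = banach +
  fixes scaleC :: "complex \<Rightarrow> 'a \<Rightarrow> 'a"  (infixr "*\<^sub>C" 75)
    and cinner :: "'a \<Rightarrow> 'a \<Rightarrow> complex"
  assumes scaleC_add_right: "c *\<^sub>C (x + y) = c *\<^sub>C x + c *\<^sub>C y"
    and scaleC_add_left: "(b + c) *\<^sub>C x = b *\<^sub>C x + c *\<^sub>C x"
    and scaleC_scaleC: "b *\<^sub>C c *\<^sub>C x = (b * c) *\<^sub>C x"
    and scaleC_one: "1 *\<^sub>C x = x"
    and scaleR_scaleC: "r *\<^sub>R x = complex_of_real r *\<^sub>C x"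
    and cinner_commute: "cinner x y = cnj (cinner y x)"
    and cinner_add_left: "cinner (x + y) z = cinner x z + cinner y z"
    and cinner_scaleC_left: "cinner (c *\<^sub>C x) y = c * cinner x y"
    and cinner_self: "cinner x x = complex_of_real ((norm x)\<^sup>2)"

global_interpretation cvs: vector_space "scaleC :: complex \<Rightarrow> 'a \<Rightarrow> 'a :: chilbert_space"
  defines csubspace = cvs.subspace and cspan = cvs.span
  by unfold_locales
    (simp_all add: scaleC_add_right scaleC_add_left scaleC_scaleC scaleC_one)

instantiation complex :: chilbert_space
begin

definition scaleC_complex :: "complex \<Rightarrow> complex \<Rightarrow> complex"
  where "scaleC_complex c x = c * x"

definition cinner_complex :: "complex \<Rightarrow> complex \<Rightarrow> complex"
  where "cinner_complex x y = x * cnj y"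

instance
  by standard
    (simp_all add: scaleC_complex_def cinner_complex_def algebra_simps scaleR_conv_of_real
      complex_norm_square[symmetric])

end


text \<open>
  A Hilbert space is given as a closed complex subspace \<open>M\<close> of a type of class
  \<open>chilbert_space\<close> (\<open>M = UNIV\<close> being allowed).  A bounded operator on \<open>M\<close> is represented by the
  unique function that agrees with it on \<open>M\<close> and vanishes off \<open>M\<close>, so that operators are equal iff
  they are equal as functions.  Sums, scalar multiples and products are then the pointwise ones
  resp. \<open>\<circ>\<close>, and \<open>onorm\<close> is the operator norm on \<open>M\<close>; only the identity needs its own name.
\<close>

definition hilbert_subspace :: "'a::chilbert_space set \<Rightarrow> bool"
  where "hilbert_subspace M \<longleftrightarrow> csubspace M \<and> closed M"

definition clinear_on :: "'a::chilbert_space set \<Rightarrow> ('a \<Rightarrow> 'b::chilbert_space) \<Rightarrow> bool"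
  where "clinear_on M A \<longleftrightarrow>
    (\<forall>x\<in>M. \<forall>y\<in>M. A (x + y) = A x + A y) \<and> (\<forall>c. \<forall>x\<in>M. A (c *\<^sub>C x) = c *\<^sub>C A x)"

definition bops :: "'a::chilbert_space set \<Rightarrow> ('a \<Rightarrow> 'a) set"
  where "bops M = {A. clinear_on M A \<and> A ` M \<subseteq> M \<and> (\<exists>B. \<forall>x\<in>M. norm (A x) \<le> B * norm x) \<and>
    (\<forall>x. x \<notin> M \<longrightarrow> A x = 0)}"

definition restrict_op :: "'a::chilbert_space set \<Rightarrow> ('a \<Rightarrow> 'a) \<Rightarrow> 'a \<Rightarrow> 'a"
  where "restrict_op M A = (\<lambda>x. if x \<in> M then A x else 0)"

definition id_op :: "'a::chilbert_space set \<Rightarrow> 'a \<Rightarrow> 'a"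
  where "id_op M = restrict_op M (\<lambda>x. x)"

definition adj :: "'a::chilbert_space set \<Rightarrow> ('a \<Rightarrow> 'a) \<Rightarrow> 'a \<Rightarrow> 'a"
  where "adj M A = (THE B. B \<in> bops M \<and> (\<forall>x\<in>M. \<forall>y\<in>M. cinner (A x) y = cinner x (B y)))"

definition normal_op :: "'a::chilbert_space set \<Rightarrow> ('a \<Rightarrow> 'a) \<Rightarrow> bool"
  where "normal_op M A \<longleftrightarrow> A \<in> bops M \<and> adj M A \<circ> A = A \<circ> adj M A"

definition orth_proj :: "'a::chilbert_space set \<Rightarrow> 'a \<Rightarrow> 'a"
  where "orth_proj N x = (THE y. y \<in> N \<and> (\<forall>z\<in>N. cinner (x - y) z = 0))"

text \<open>Integer powers of an operator that is bijective on \<open>M\<close>.\<close>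

definition zpow_op :: "'a set \<Rightarrow> ('a \<Rightarrow> 'a) \<Rightarrow> int \<Rightarrow> 'a \<Rightarrow> 'a"
  where "zpow_op M A m = (if m \<ge> 0 then A ^^ nat m else inv_into M A ^^ nat (- m))"


text \<open>
  Points of \<open>\<complex>\<^sup>d\<close> are extensional functions on \<open>{1..d}\<close>, and \<open>d\<close>-tuples of operators are indexed by
  \<open>1, \<dots>, d\<close>, so that \<open>s d\<close>, \<open>S d\<close>, \<open>R d\<close> are the last entries \<open>p\<close>, \<open>P\<close>, \<open>U\<close>.
\<close>

definition elem_sym :: "nat \<Rightarrow> nat \<Rightarrow> (nat \<Rightarrow> complex) \<Rightarrow> complex"
  where "elem_sym d k z = (\<Sum>J \<in> {J. J \<subseteq> {1..d} \<and> card J = k}. \<Prod>j\<in>J. z j)"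

definition sym_polydisc :: "nat \<Rightarrow> (nat \<Rightarrow> complex) set"
  where "sym_polydisc d = (\<lambda>z. \<lambda>k\<in>{1..d}. elem_sym d k z) ` ({1..d} \<rightarrow>\<^sub>E cball 0 1)"

definition dist_boundary :: "nat \<Rightarrow> (nat \<Rightarrow> complex) set"
  where "dist_boundary d = {s \<in> sym_polydisc d. cmod (s d) = 1}"

text \<open>Polynomials in \<open>z\<^sub>1, \<dots>, z\<^sub>d\<close>: finitely supported coefficient families over monomials.\<close>

type_synonym cpoly = "(nat \<Rightarrow>\<^sub>0 nat) \<Rightarrow>\<^sub>0 complex"

definition cpolys :: "nat \<Rightarrow> cpoly set"
  where "cpolys d = {f. \<forall>\<alpha> \<in> Poly_Mapping.keys f. Poly_Mapping.keys \<alpha> \<subseteq> {1..d}}"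

definition eval_cpoly :: "nat \<Rightarrow> cpoly \<Rightarrow> (nat \<Rightarrow> complex) \<Rightarrow> complex"
  where "eval_cpoly d f z = (\<Sum>\<alpha> \<in> Poly_Mapping.keys f.
    Poly_Mapping.lookup f \<alpha> * (\<Prod>i\<in>{1..d}. z i ^ Poly_Mapping.lookup \<alpha> i))"

definition op_monomial :: "nat \<Rightarrow> (nat \<Rightarrow>\<^sub>0 nat) \<Rightarrow> (nat \<Rightarrow> 'a \<Rightarrow> 'a) \<Rightarrow> 'a \<Rightarrow> 'a"
  where "op_monomial d \<alpha> S = foldr (\<lambda>i A. (S i ^^ Poly_Mapping.lookup \<alpha> i) \<circ> A) [1..<Suc d] id"

definition op_cpoly ::
  "nat \<Rightarrow> cpoly \<Rightarrow> (nat \<Rightarrow> 'a \<Rightarrow> 'a) \<Rightarrow> 'a \<Rightarrow> 'a::chilbert_space"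
  where "op_cpoly d f S h = (\<Sum>\<alpha> \<in> Poly_Mapping.keys f.
    Poly_Mapping.lookup f \<alpha> *\<^sub>C op_monomial d \<alpha> S h)"


text \<open>
  The Koszul complex \<open>M \<otimes> \<Lambda>\<complex>\<^sup>d\<close>: a form \<open>\<omega>\<close> is given by its coefficients \<open>\<omega> I\<close> at
  \<open>e\<^sub>I = e\<^bsub>i1\<^esub> \<and> \<dots> \<and> e\<^bsub>ik\<^esub>\<close> for \<open>I = {i1 < \<dots> < ik}\<close>, and the differential is
  \<open>x e\<^sub>I \<mapsto> (\<Sum>i. T\<^sub>i x e\<^sub>i \<and> e\<^sub>I)\<close>.  All degrees are treated simultaneously; the differential being
  homogeneous of degree 1, exactness in every degree is equality of its kernel and its range.
\<close>

definition koszul_forms :: "nat \<Rightarrow> 'a::chilbert_space set \<Rightarrow> (nat set \<Rightarrow> 'a) set"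
  where "koszul_forms d M = {\<omega>. \<forall>I. if I \<subseteq> {1..d} then \<omega> I \<in> M else \<omega> I = 0}"

definition koszul_diff ::
  "nat \<Rightarrow> (nat \<Rightarrow> 'a \<Rightarrow> 'a) \<Rightarrow> (nat set \<Rightarrow> 'a) \<Rightarrow> nat set \<Rightarrow> 'a::chilbert_space"
  where "koszul_diff d T \<omega> I =
    (if I \<subseteq> {1..d} then \<Sum>i\<in>I. (- 1) ^ card {j \<in> I. j < i} *\<^sub>R T i (\<omega> (I - {i})) else 0)"

definition koszul_exact :: "nat \<Rightarrow> 'a::chilbert_space set \<Rightarrow> (nat \<Rightarrow> 'a \<Rightarrow> 'a) \<Rightarrow> bool"
  where "koszul_exact d M T \<longleftrightarrow>
    {\<omega> \<in> koszul_forms d M. koszul_diff d T \<omega> = (\<lambda>_. 0)} = koszul_diff d T ` koszul_forms d M"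

definition taylor_spectrum ::
  "nat \<Rightarrow> 'a::chilbert_space set \<Rightarrow> (nat \<Rightarrow> 'a \<Rightarrow> 'a) \<Rightarrow> (nat \<Rightarrow> complex) set"
  where "taylor_spectrum d M T =
    {z \<in> {1..d} \<rightarrow>\<^sub>E UNIV. \<not> koszul_exact d M (\<lambda>i. restrict_op M (\<lambda>x. T i x - z i *\<^sub>C x))}"


definition hilbert_module :: "nat \<Rightarrow> 'a::chilbert_space set \<Rightarrow> (nat \<Rightarrow> 'a \<Rightarrow> 'a) \<Rightarrow> bool"
  where "hilbert_module d M T \<longleftrightarrow> hilbert_subspace M \<and> (\<forall>i\<in>{1..d}. T i \<in> bops M) \<and>
    (\<forall>i\<in>{1..d}. \<forall>j\<in>{1..d}. T i \<circ> T j = T j \<circ> T i)"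

definition contractive_module :: "nat \<Rightarrow> 'a::chilbert_space set \<Rightarrow> (nat \<Rightarrow> 'a \<Rightarrow> 'a) \<Rightarrow> bool"
  where "contractive_module d M T \<longleftrightarrow> hilbert_module d M T \<and>
    (\<forall>f\<in>cpolys d. \<forall>h\<in>M. norm (op_cpoly d f T h) \<le>
      (SUP z\<in>sym_polydisc d. cmod (eval_cpoly d f z)) * norm h)"

definition submodule :: "nat \<Rightarrow> 'a::chilbert_space set \<Rightarrow> (nat \<Rightarrow> 'a \<Rightarrow> 'a) \<Rightarrow>
    'a set \<Rightarrow> (nat \<Rightarrow> 'a \<Rightarrow> 'a) \<Rightarrow> bool"
  where "submodule d N S M T \<longleftrightarrow> hilbert_subspace N \<and> N \<subseteq> M \<and>
    (\<forall>i\<in>{1..d}. T i ` N \<subseteq> N \<and> S i = restrict_op N (T i))"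

definition unitary_module :: "nat \<Rightarrow> 'a::chilbert_space set \<Rightarrow> (nat \<Rightarrow> 'a \<Rightarrow> 'a) \<Rightarrow> bool"
  where "unitary_module d K R \<longleftrightarrow> contractive_module d K R \<and> (\<forall>i\<in>{1..d}. normal_op K (R i)) \<and>
    taylor_spectrum d K R \<subseteq> dist_boundary d"

definition isometric_module :: "nat \<Rightarrow> 'a::chilbert_space set \<Rightarrow> (nat \<Rightarrow> 'a \<Rightarrow> 'a) \<Rightarrow> bool"
  where "isometric_module d H S \<longleftrightarrow> (\<exists>K R. unitary_module d K R \<and> submodule d H S K R)"

definition isometric_embedding :: "nat \<Rightarrow> 'a::chilbert_space set \<Rightarrow> (nat \<Rightarrow> 'a \<Rightarrow> 'a) \<Rightarrow>
    'b::chilbert_space set \<Rightarrow> (nat \<Rightarrow> 'b \<Rightarrow> 'b) \<Rightarrow> ('a \<Rightarrow> 'b) \<Rightarrow> bool"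
  where "isometric_embedding d H S K R V \<longleftrightarrow> clinear_on H V \<and> V ` H \<subseteq> K \<and>
    (\<forall>h\<in>H. norm (V h) = norm h) \<and> (\<forall>i\<in>{1..d}. \<forall>h\<in>H. V (S i h) = R i (V h))"

definition reducing :: "nat \<Rightarrow> 'a::chilbert_space set \<Rightarrow> 'a set \<Rightarrow> (nat \<Rightarrow> 'a \<Rightarrow> 'a) \<Rightarrow> bool"
  where "reducing d N K R \<longleftrightarrow> hilbert_subspace N \<and> N \<subseteq> K \<and>
    (\<forall>i\<in>{1..d}. R i ` N \<subseteq> N \<and> adj K (R i) ` N \<subseteq> N)"

definition minimal_unitary_extension :: "nat \<Rightarrow> 'a::chilbert_space set \<Rightarrow> (nat \<Rightarrow> 'a \<Rightarrow> 'a) \<Rightarrow>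
    'b::chilbert_space set \<Rightarrow> (nat \<Rightarrow> 'b \<Rightarrow> 'b) \<Rightarrow> ('a \<Rightarrow> 'b) \<Rightarrow> bool"
  where "minimal_unitary_extension d H S K R V \<longleftrightarrow>
    unitary_module d K R \<and> isometric_embedding d H S K R V \<and>
    (\<forall>N. reducing d N K R \<and> V ` H \<subseteq> N \<longrightarrow> N = K)"

definition toeplitz_ops :: "nat \<Rightarrow> 'a::chilbert_space set \<Rightarrow> (nat \<Rightarrow> 'a \<Rightarrow> 'a) \<Rightarrow> ('a \<Rightarrow> 'a) set"
  where "toeplitz_ops d H S = {A \<in> bops H.
    (\<forall>i\<in>{1..d - 1}. adj H (S i) \<circ> A \<circ> S d = A \<circ> S (d - i)) \<and> adj H (S d) \<circ> A \<circ> S d = A}"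


definition commutant :: "'a::chilbert_space set \<Rightarrow> ('a \<Rightarrow> 'a) set \<Rightarrow> ('a \<Rightarrow> 'a) set"
  where "commutant M \<A> = {B \<in> bops M. \<forall>A\<in>\<A>. A \<circ> B = B \<circ> A}"

definition star_subalgebra :: "'a::chilbert_space set \<Rightarrow> ('a \<Rightarrow> 'a) set \<Rightarrow> bool"
  where "star_subalgebra M \<A> \<longleftrightarrow> \<A> \<subseteq> bops M \<and> id_op M \<in> \<A> \<and>
    (\<forall>A\<in>\<A>. \<forall>B\<in>\<A>. (\<lambda>x. A x + B x) \<in> \<A> \<and> A \<circ> B \<in> \<A>) \<and>
    (\<forall>c. \<forall>A\<in>\<A>. (\<lambda>x. c *\<^sub>C A x) \<in> \<A>) \<and> (\<forall>A\<in>\<A>. adj M A \<in> \<A>)"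

definition norm_closed :: "'a::chilbert_space set \<Rightarrow> ('a \<Rightarrow> 'a) set \<Rightarrow> bool"
  where "norm_closed M \<A> \<longleftrightarrow> (\<forall>F. \<forall>A\<in>bops M.
    (\<forall>n::nat. F n \<in> \<A>) \<and> (\<lambda>n. onorm (\<lambda>x. F n x - A x)) \<longlonglongrightarrow> 0 \<longrightarrow> A \<in> \<A>)"

text \<open>The initial topology for the maps \<open>A \<mapsto> \<langle>A x, y\<rangle>\<close>.\<close>

definition weak_operator_topology :: "'a::chilbert_space set \<Rightarrow> ('a \<Rightarrow> 'a) topology"
  where "weak_operator_topology M =
    pullback_topology (bops M) (\<lambda>A (x, y). cinner (A x) y) euclidean"

definition cstar_subalgebra :: "'a::chilbert_space set \<Rightarrow> ('a \<Rightarrow> 'a) set \<Rightarrow> bool"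
  where "cstar_subalgebra M \<A> \<longleftrightarrow> star_subalgebra M \<A> \<and> norm_closed M \<A>"

definition von_neumann_algebra :: "'a::chilbert_space set \<Rightarrow> ('a \<Rightarrow> 'a) set \<Rightarrow> bool"
  where "von_neumann_algebra M \<A> \<longleftrightarrow>
    star_subalgebra M \<A> \<and> closedin (weak_operator_topology M) \<A>"

definition cstar_gen :: "'a::chilbert_space set \<Rightarrow> ('a \<Rightarrow> 'a) set \<Rightarrow> ('a \<Rightarrow> 'a) set"
  where "cstar_gen M G = cstar_subalgebra M hull G"

definition von_neumann_gen :: "'a::chilbert_space set \<Rightarrow> ('a \<Rightarrow> 'a) set \<Rightarrow> ('a \<Rightarrow> 'a) set"
  where "von_neumann_gen M G = von_neumann_algebra M hull G"

definition closed_ideal ::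
  "'a::chilbert_space set \<Rightarrow> ('a \<Rightarrow> 'a) set \<Rightarrow> ('a \<Rightarrow> 'a) set \<Rightarrow> bool"
  where "closed_ideal M \<A> \<J> \<longleftrightarrow> \<J> \<subseteq> \<A> \<and> norm_closed M \<J> \<and> (\<lambda>_. 0) \<in> \<J> \<and>
    (\<forall>A\<in>\<J>. \<forall>B\<in>\<J>. (\<lambda>x. A x + B x) \<in> \<J>) \<and> (\<forall>c. \<forall>A\<in>\<J>. (\<lambda>x. c *\<^sub>C A x) \<in> \<J>) \<and>
    (\<forall>A\<in>\<A>. \<forall>B\<in>\<J>. A \<circ> B \<in> \<J> \<and> B \<circ> A \<in> \<J>)"

definition commutator_ideal ::
  "nat \<Rightarrow> 'a::chilbert_space set \<Rightarrow> (nat \<Rightarrow> 'a \<Rightarrow> 'a) \<Rightarrow> ('a \<Rightarrow> 'a) set"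
  where "commutator_ideal d H S =
    closed_ideal H (cstar_gen H (S ` {1..d})) hull
      {(\<lambda>x. X (Y x) - Y (X x)) | X Y.
        X \<in> cstar_gen H (S ` {1..d}) \<inter> toeplitz_ops d H S \<and>
        Y \<in> cstar_gen H (S ` {1..d}) \<inter> toeplitz_ops d H S}"

definition op_linear_on ::
  "('a \<Rightarrow> 'a::chilbert_space) set \<Rightarrow> (('a \<Rightarrow> 'a) \<Rightarrow> ('b \<Rightarrow> 'b::chilbert_space)) \<Rightarrow> bool"
  where "op_linear_on \<A> \<phi> \<longleftrightarrow>
    (\<forall>A\<in>\<A>. \<forall>B\<in>\<A>. \<phi> (\<lambda>x. A x + B x) = (\<lambda>y. \<phi> A y + \<phi> B y)) \<and>
    (\<forall>c. \<forall>A\<in>\<A>. \<phi> (\<lambda>x. c *\<^sub>C A x) = (\<lambda>y. c *\<^sub>C \<phi> A y))"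

definition unital_star_hom :: "'a::chilbert_space set \<Rightarrow> ('a \<Rightarrow> 'a) set \<Rightarrow>
    'b::chilbert_space set \<Rightarrow> ('b \<Rightarrow> 'b) set \<Rightarrow> (('a \<Rightarrow> 'a) \<Rightarrow> ('b \<Rightarrow> 'b)) \<Rightarrow> bool"
  where "unital_star_hom M \<A> N \<B> \<phi> \<longleftrightarrow> \<phi> ` \<A> \<subseteq> \<B> \<and> op_linear_on \<A> \<phi> \<and>
    (\<forall>A\<in>\<A>. \<forall>B\<in>\<A>. \<phi> (A \<circ> B) = \<phi> A \<circ> \<phi> B) \<and>
    (\<forall>A\<in>\<A>. \<phi> (adj M A) = adj N (\<phi> A)) \<and> \<phi> (id_op M) = id_op N"

text \<open>The norm of an \<open>n \<times> n\<close> matrix of operators on \<open>M\<close>, acting on the Hilbert sum \<open>M\<^sup>n\<close>.\<close>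

definition matrix_onorm ::
  "nat \<Rightarrow> 'a::chilbert_space set \<Rightarrow> (nat \<Rightarrow> nat \<Rightarrow> 'a \<Rightarrow> 'a) \<Rightarrow> real"
  where "matrix_onorm n M A =
    (SUP x \<in> {x. (\<forall>j<n. x j \<in> M) \<and> L2_set (\<lambda>j. norm (x j)) {..<n} \<le> 1}.
      L2_set (\<lambda>i. norm (\<Sum>j<n. A i j (x j))) {..<n})"

definition completely_isometric :: "'a::chilbert_space set \<Rightarrow> ('a \<Rightarrow> 'a) set \<Rightarrow>
    'b::chilbert_space set \<Rightarrow> (('a \<Rightarrow> 'a) \<Rightarrow> ('b \<Rightarrow> 'b)) \<Rightarrow> bool"
  where "completely_isometric M \<A> N \<phi> \<longleftrightarrow>
    (\<forall>n A. (\<forall>i<n. \<forall>j<n. A i j \<in> \<A>) \<longrightarrow>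
      matrix_onorm n N (\<lambda>i j. \<phi> (A i j)) = matrix_onorm n M A)"

definition ci_cross_section :: "'a::chilbert_space set \<Rightarrow> ('a \<Rightarrow> 'a) set \<Rightarrow>
    'b::chilbert_space set \<Rightarrow> ('b \<Rightarrow> 'b) set \<Rightarrow> (('a \<Rightarrow> 'a) \<Rightarrow> ('b \<Rightarrow> 'b)) \<Rightarrow>
    (('b \<Rightarrow> 'b) \<Rightarrow> ('a \<Rightarrow> 'a)) \<Rightarrow> bool"
  where "ci_cross_section M \<A> N \<B> \<pi> \<rho> \<longleftrightarrow> \<rho> ` \<B> \<subseteq> \<A> \<and> op_linear_on \<B> \<rho> \<and>
    completely_isometric N \<B> M \<rho> \<and> (\<forall>B\<in>\<B>. \<pi> (\<rho> B) = B)"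

end

(*
For commuting normal operators the relations s_i = cnj(s_{d-i}) p, |p| = 1 that hold on the
distinguished boundary are inherited by the tuple R: if the normal operator R_i^* U - R_{d-i} or
U^* U - 1 were nonzero, Fuglede's theorem would give a joint approximate eigenvector of it (for a
nonzero eigenvalue) and of R, and the eigenvalues of R would form a point of the Taylor spectrum
outside the boundary.  Hence U is unitary, R_i^* = R_{d-i} U^*, and a subspace invariant under R and
U^* reduces R.  So the minimal extension is the closure of the increasing union of the spaces
U^{-m} V H.

A Toeplitz operator X satisfies P^* X P = X, so that U^{-m} V X V^* U^m converges weakly, and the
limit Y is the only candidate for the symbol of X.  Operators commuting with S are Toeplitz, with
a symbol that maps H to itself.  For X in C^*(S) the limit is strong and hence multiplicative: this
is the homomorphism pi_0.  C^*(R) is the closure of the fractions U^{-m} f(R), and compression maps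
these to P^{*m} f(S); thus compression is the cross section, and its multiplicativity defect is
made of commutators of Toeplitz operators, which identifies the kernel of pi_0.
*)
theory Submission
  imports Defs "HOL-Complex_Analysis.Cauchy_Integral_Formula"
begin

subsection \<open>Complex Hilbert spaces\<close>

text \<open>The spectral theorem is replaced by approximate eigenvectors. A joint one is built one
  operator at a time: for a normal N the numbers |z|, |z - 1|, |z - i| are fixed successively, each
  as an extremal value of a norm over unit vectors that are almost annihilated by everything fixed
  before. Fuglede's theorem keeps the operators N^* N commuting with the rest of the family, so that
  the construction can continue. To place the resulting point in the Taylor spectrum only the top
  end of the Koszul complex is used: exactness there would make the ranges of the shifted operators
  add up to the whole space, which a lacunary series refutes quantitatively.

  A weak limit would give a linear symbol map but not a multiplicative one. Strong convergence holds
  on C^*(S) because each S_i and each S_i^* is the compression of an operator that commutes with U,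
  and V V^* fixes U^m k for all large m when k belongs to the dense union of the spaces U^{-n} V
  H.\<close>

lemma csubspace_iff:
  "csubspace M \<longleftrightarrow> 0 \<in> M \<and> (\<forall>x\<in>M. \<forall>y\<in>M. x + y \<in> M) \<and> (\<forall>c. \<forall>x\<in>M. c *\<^sub>C x \<in> M)"
  by (simp add: cvs.subspace_def)

lemma scaleC_simps [simp]:
  fixes x :: "'a::chilbert_space"
  shows "0 *\<^sub>C x = 0" "1 *\<^sub>C x = x" "c *\<^sub>C (0::'a) = 0" "c *\<^sub>C (- x) = - (c *\<^sub>C x)"
    "(- c) *\<^sub>C x = - (c *\<^sub>C x)" "b *\<^sub>C c *\<^sub>C x = (b * c) *\<^sub>C x"
  by (simp_all add: scaleC_scaleC cvs.scale_minus_left cvs.scale_minus_right)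

lemma scaleC_diff_right: "c *\<^sub>C (x - y) = c *\<^sub>C x - c *\<^sub>C (y::'a::chilbert_space)"
  by (rule cvs.scale_right_diff_distrib)

lemma scaleC_diff_left: "(b - c) *\<^sub>C x = b *\<^sub>C x - c *\<^sub>C (x::'a::chilbert_space)"
  by (rule cvs.scale_left_diff_distrib)

lemma cinner_add_right: "cinner x (y + z) = cinner x y + cinner x (z::'a::chilbert_space)"
  by (metis cinner_add_left cinner_commute complex_cnj_add)

lemma cinner_scaleC_right: "cinner x (c *\<^sub>C y) = cnj c * cinner x (y::'a::chilbert_space)"
  by (metis cinner_scaleC_left cinner_commute complex_cnj_mult)

lemma cinner_zero [simp]: "cinner 0 x = 0" "cinner x 0 = (0::complex)" for x :: "'a::chilbert_space"
  using cinner_scaleC_left[of 0 x x] cinner_scaleC_right[of x 0 x] by simp_all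

lemma cinner_minus [simp]:
  fixes x y :: "'a::chilbert_space"
  shows "cinner (- x) y = - cinner x y" "cinner x (- y) = - cinner x y"
  using cinner_scaleC_left[of "-1" x y] cinner_scaleC_right[of x "-1" y]
  by simp_all

lemma cinner_diff_left: "cinner (x - y) z = cinner x z - cinner y (z::'a::chilbert_space)"
  using cinner_add_left[of x "-y" z] by simp

lemma cinner_diff_right: "cinner x (y - z) = cinner x y - cinner x (z::'a::chilbert_space)"
  using cinner_add_right[of x y "-z"] by simp

lemmas cinner_algebra = cinner_add_left cinner_add_right cinner_diff_left cinner_diff_right
  cinner_scaleC_left cinner_scaleC_right

lemma cinner_sum_right: "cinner x (sum f A) = (\<Sum>i\<in>A. cinner x (f i :: 'a::chilbert_space))"
  by (induction A rule: infinite_finite_induct) (simp_all add: cinner_add_right)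

lemma Re_cinner_commute: "Re (cinner y x) = Re (cinner x (y::'a::chilbert_space))"
  by (subst cinner_commute) simp

lemma norm_add_sq: "(norm (x + y))\<^sup>2 = (norm x)\<^sup>2 + (norm y)\<^sup>2 + 2 * Re (cinner x (y::'a::chilbert_space))"
proof -
  have "complex_of_real ((norm (x + y))\<^sup>2) = cinner (x + y) (x + y)" by (simp add: cinner_self)
  also have "\<dots> = cinner x x + cinner y y + (cinner x y + cinner y x)"
    by (simp add: cinner_algebra)
  finally have "Re (complex_of_real ((norm (x + y))\<^sup>2)) = Re (cinner x x + cinner y y + (cinner x y + cinner y x))"
    by simp
  then show ?thesis by (simp add: cinner_self Re_cinner_commute[of y x])
qed

lemma norm_diff_sq: "(norm (x - y))\<^sup>2 = (norm x)\<^sup>2 + (norm y)\<^sup>2 - 2 * Re (cinner x (y::'a::chilbert_space))"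
  using norm_add_sq[of x "-y"] by simp

lemma parallelogram:
  "(norm (x + y))\<^sup>2 + (norm (x - y))\<^sup>2 = 2 * (norm x)\<^sup>2 + 2 * (norm (y::'a::chilbert_space))\<^sup>2"
  by (simp add: norm_add_sq norm_diff_sq)

lemma mult_cnj_self: "z * cnj z = (complex_of_real (cmod z))\<^sup>2"
  by (metis complex_norm_square of_real_power)

lemma norm_scaleC [simp]: "norm (c *\<^sub>C x) = cmod c * norm (x::'a::chilbert_space)"
proof -
  have "complex_of_real ((norm (c *\<^sub>C x))\<^sup>2) = c * cnj c * complex_of_real ((norm x)\<^sup>2)"
    by (simp only: cinner_self[symmetric]) (simp add: cinner_algebra)
  also have "\<dots> = complex_of_real ((cmod c * norm x)\<^sup>2)"
    by (simp add: mult_cnj_self power_mult_distrib)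
  finally have "(norm (c *\<^sub>C x))\<^sup>2 = (cmod c * norm x)\<^sup>2"
    by (simp only: of_real_eq_iff)
  then show ?thesis by (simp add: power2_eq_iff_nonneg)
qed

lemma cinner_Cauchy_Schwarz: "cmod (cinner x y) \<le> norm x * norm (y::'a::chilbert_space)"
proof (cases "y = 0")
  case False
  \<comment> \<open>The coefficient of the orthogonal projection of \<open>x\<close> onto the line
    of \<open>y\<close>.\<close>
  define c where "c = cinner x y / complex_of_real ((norm y)\<^sup>2)"
  have cmod_c: "cmod c = cmod (cinner x y) / (norm y)\<^sup>2"
    by (simp add: c_def norm_divide norm_power)
  have "0 \<le> (norm (x - c *\<^sub>C y))\<^sup>2" by simp
  also have "\<dots> = (norm x)\<^sup>2 + (cmod c * norm y)\<^sup>2 - 2 * Re (cnj c * cinner x y)"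
    by (simp add: norm_diff_sq cinner_scaleC_right)
  also have "cnj c * cinner x y = complex_of_real ((cmod (cinner x y))\<^sup>2 / (norm y)\<^sup>2)"
    by (simp add: c_def mult_cnj_self mult.commute)
  also have "(cmod c * norm y)\<^sup>2 = (cmod (cinner x y))\<^sup>2 / (norm y)\<^sup>2"
    using False by (simp add: cmod_c power2_eq_square field_simps)
  finally have "(cmod (cinner x y))\<^sup>2 / (norm y)\<^sup>2 \<le> (norm x)\<^sup>2"
    by (simp del: power_divide of_real_divide of_real_power)
  then have "(cmod (cinner x y))\<^sup>2 \<le> (norm x * norm y)\<^sup>2"
    using False by (simp add: field_simps power_mult_distrib)
  then show ?thesis by (rule power2_le_imp_le) simp
qed simp

lemma bounded_bilinear_cinner:
  "bounded_bilinear (cinner :: 'a::chilbert_space \<Rightarrow> 'a \<Rightarrow> complex)"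
proof
  show "\<exists>K. \<forall>a b. cmod (cinner (a::'a) b) \<le> norm a * norm b * K"
    by (rule exI[of _ 1]) (simp add: cinner_Cauchy_Schwarz)
qed (simp_all add: cinner_algebra scaleR_scaleC[where 'a='a] scaleR_conv_of_real)

lemmas tendsto_cinner [tendsto_intros] = bounded_bilinear.tendsto[OF bounded_bilinear_cinner]

lemma bounded_linear_scaleC: "bounded_linear (\<lambda>x::'a::chilbert_space. c *\<^sub>C x)"
proof (rule bounded_linear_intro[where K = "cmod c"])
  show "c *\<^sub>C r *\<^sub>R x = r *\<^sub>R c *\<^sub>C x" for r and x :: 'a
    by (simp add: scaleR_scaleC mult.commute)
qed (simp_all add: scaleC_add_right mult.commute)

lemmas tendsto_scaleC [tendsto_intros] = bounded_linear.tendsto[OF bounded_linear_scaleC]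

lemma cinner_self_eq_0 [simp]: "cinner x x = 0 \<longleftrightarrow> x = (0::'a::chilbert_space)"
  by (simp add: cinner_self)

lemma Re_cinner_self: "Re (cinner x x) = (norm (x::'a::chilbert_space))\<^sup>2"
  by (simp add: cinner_self)

lemma cmod_cinner_self: "cmod (cinner x x) = norm x * norm (x::'a::chilbert_space)"
  by (simp add: cinner_self norm_mult power2_eq_square)

text \<open>All operator theory is relative to one closed subspace \<open>M\<close> of a type, so
  that it can be instantiated for \<open>H\<close>, for \<open>K\<close>, for the range of
  \<open>V\<close>, for kernels of functionals and for reducing subspaces.\<close>

locale closed_csubspace =
  fixes M :: "'a::chilbert_space set"
  assumes hilbert_subspace: "hilbert_subspace M"
begin

lemma closed: "closed M" and subspace: "csubspace M"
  using hilbert_subspace by (auto simp: hilbert_subspace_def)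

lemma zero_mem [simp, intro]: "0 \<in> M"
  and add_mem [intro]: "x \<in> M \<Longrightarrow> y \<in> M \<Longrightarrow> x + y \<in> M"
  and scale_mem [intro]: "x \<in> M \<Longrightarrow> c *\<^sub>C x \<in> M"
  using subspace by (auto simp: csubspace_iff)

lemma minus_mem [intro]: "x \<in> M \<Longrightarrow> - x \<in> M"
  using scale_mem[of x "-1"] by simp

lemma diff_mem [intro]: "x \<in> M \<Longrightarrow> y \<in> M \<Longrightarrow> x - y \<in> M"
  using add_mem[of x "-y"] minus_mem[of y] by simp

lemma scaleR_mem [intro]: "x \<in> M \<Longrightarrow> r *\<^sub>R x \<in> M"
  by (simp add: scaleR_scaleC scale_mem)

lemma sum_mem: "(\<And>i. i \<in> A \<Longrightarrow> f i \<in> M) \<Longrightarrow> sum f A \<in> M"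
  by (induction A rule: infinite_finite_induct) auto

lemma lim_mem: "(\<And>n. f n \<in> M) \<Longrightarrow> f \<longlonglongrightarrow> l \<Longrightarrow> l \<in> M"
  using closed_sequentially[OF closed] by blast

lemma Cauchy_lim: "(\<And>n. f n \<in> M) \<Longrightarrow> Cauchy f \<Longrightarrow> \<exists>l\<in>M. f \<longlonglongrightarrow> l"
  using lim_mem by (meson Cauchy_convergent convergent_def)

lemma eqI_cinner: "x \<in> M \<Longrightarrow> y \<in> M \<Longrightarrow> (\<And>z. z \<in> M \<Longrightarrow> cinner x z = cinner y z) \<Longrightarrow> x = y"
  using diff_mem[of x y] cinner_self_eq_0[of "x - y"] by (simp add: cinner_diff_left)

section \<open>Nearest points, orthogonal projections and the Riesz representation\<close>

lemma ex_nearest: "\<exists>y\<in>M. \<forall>z\<in>M. norm (x - y) \<le> norm (x - z)"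
proof -
  define D where "D = infdist x M"
  have D: "D \<le> norm (x - z)" if "z \<in> M" for z
    using infdist_le[OF that, of x] by (simp add: D_def dist_norm)
  have D0: "0 \<le> D" by (simp add: D_def infdist_nonneg)
  have "\<exists>y\<in>M. norm (x - y) < D + 1 / real (Suc n)" for n
  proof (rule ccontr)
    assume "\<not> ?thesis"
    then have "\<And>y. y \<in> M \<Longrightarrow> D + 1 / real (Suc n) \<le> dist x y" by (force simp: dist_norm)
    then have "D + 1 / real (Suc n) \<le> infdist x M"
      using zero_mem by (subst infdist_notempty) (auto intro!: cINF_greatest)
    then have "1 / real (Suc n) \<le> 0" by (simp only: D_def)
    then show False by (simp add: divide_le_0_iff)
  qed
  then obtain y where y: "\<And>n. y n \<in> M" "\<And>n. norm (x - y n) < D + 1 / real (Suc n)" by metis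
  have "Cauchy y"
  proof (rule metric_CauchyI)
    fix e :: real assume "0 < e"
    have "(\<lambda>n. 4 * ((D + 1 / real (Suc n))\<^sup>2 - D\<^sup>2)) \<longlonglongrightarrow> 4 * ((D + 0)\<^sup>2 - D\<^sup>2)"
      by (intro tendsto_intros LIMSEQ_Suc[OF lim_const_over_n])
    then have "eventually (\<lambda>n. 4 * ((D + 1 / real (Suc n))\<^sup>2 - D\<^sup>2) < e\<^sup>2) sequentially"
      by (rule order_tendstoD) (use \<open>0 < e\<close> in simp)
    then obtain N where N: "\<And>n. n \<ge> N \<Longrightarrow> 4 * ((D + 1 / real (Suc n))\<^sup>2 - D\<^sup>2) < e\<^sup>2"
      by (auto simp: eventually_sequentially)
    have "dist (y m) (y n) < e" if "m \<ge> N" "n \<ge> N" for m n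
    proof -
      let ?a = "x - y m" and ?b = "x - y n" and ?E = "D + 1 / real (Suc N)"
      have le: "norm (x - y k) \<le> ?E" if "k \<ge> N" for k
      proof -
        have "1 / real (Suc k) \<le> 1 / real (Suc N)" using that by (intro divide_left_mono) auto
        then show ?thesis using y(2)[of k] by simp
      qed
      have "(1/2) *\<^sub>R (y m + y n) \<in> M" by (simp add: y add_mem scaleR_mem)
      \<comment> \<open>The midpoint of two near minimizers is no closer to \<open>x\<close> than
        \<open>D\<close>; the parallelogram law then bounds their distance, so that minimizing
        sequences are Cauchy.\<close>
      from D[OF this] have "D \<le> norm ((1/2) *\<^sub>R (?a + ?b))"
        by (simp add: algebra_simps scaleR_add_left[symmetric])
      then have "2 * D \<le> norm (?a + ?b)" by simp
      then have "(2 * D)\<^sup>2 \<le> (norm (?a + ?b))\<^sup>2" using D0 by (intro power_mono) auto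
      moreover have "(norm ?a)\<^sup>2 \<le> ?E\<^sup>2" "(norm ?b)\<^sup>2 \<le> ?E\<^sup>2"
        using le that by (auto intro!: power_mono)
      ultimately have "(norm (?a - ?b))\<^sup>2 \<le> 4 * (?E\<^sup>2 - D\<^sup>2)"
        using parallelogram[of ?a ?b] by (simp add: power_mult_distrib)
      also have "\<dots> < e\<^sup>2" using N by simp
      finally have "norm (?a - ?b) < e" using \<open>0 < e\<close> by (simp add: power_less_imp_less_base)
      then show ?thesis by (simp add: dist_norm norm_minus_commute)
    qed
    then show "\<exists>N. \<forall>m\<ge>N. \<forall>n\<ge>N. dist (y m) (y n) < e" by blast
  qed
  then obtain l where l: "l \<in> M" "y \<longlonglongrightarrow> l" using Cauchy_lim y(1) by blast
  have "norm (x - l) \<le> D + 0"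
  proof (rule LIMSEQ_le)
    show "(\<lambda>n. norm (x - y n)) \<longlonglongrightarrow> norm (x - l)" by (intro tendsto_intros l)
    show "(\<lambda>n. D + 1 / real (Suc n)) \<longlonglongrightarrow> D + 0"
      by (intro tendsto_intros LIMSEQ_Suc[OF lim_const_over_n])
  qed (use y(2) less_imp_le in blast)
  with D l(1) show ?thesis by force
qed

text \<open>If the residual \<open>x - y\<close> had a component along \<open>z\<close>, adding that
  component to \<open>y\<close> would lower the squared distance by
  \<open>|cinner (x - y) z|^2 / |z|^2\<close>.\<close>

lemma nearest_orthogonal:
  assumes "y \<in> M" "\<And>z. z \<in> M \<Longrightarrow> norm (x - y) \<le> norm (x - z)" "z \<in> M"
  shows "cinner (x - y) z = 0"
proof (cases "z = 0")
  case False
  define c where "c = cinner (x - y) z / complex_of_real ((norm z)\<^sup>2)"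
  have cmod_c: "cmod c = cmod (cinner (x - y) z) / (norm z)\<^sup>2"
    by (simp add: c_def norm_divide norm_power)
  have cz: "cnj c * cinner (x - y) z = complex_of_real ((cmod (cinner (x - y) z))\<^sup>2 / (norm z)\<^sup>2)"
    by (simp add: c_def mult_cnj_self mult.commute)
  have "(norm (x - y))\<^sup>2 \<le> (norm (x - (y + c *\<^sub>C z)))\<^sup>2"
    using assms by (intro power_mono assms(2)) auto
  also have "x - (y + c *\<^sub>C z) = (x - y) - c *\<^sub>C z" by simp
  also have "(norm ((x - y) - c *\<^sub>C z))\<^sup>2
      = (norm (x - y))\<^sup>2 + (cmod c * norm z)\<^sup>2 - 2 * ((cmod (cinner (x - y) z))\<^sup>2 / (norm z)\<^sup>2)"
    by (simp add: norm_diff_sq[of "x - y"] cinner_scaleC_right cz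
        del: of_real_divide of_real_power)
  also have "(cmod c * norm z)\<^sup>2 = (cmod (cinner (x - y) z))\<^sup>2 / (norm z)\<^sup>2"
    using False by (simp add: cmod_c power2_eq_square field_simps)
  finally have "(cmod (cinner (x - y) z))\<^sup>2 / (norm z)\<^sup>2 \<le> 0" by simp
  then have "(cmod (cinner (x - y) z))\<^sup>2 \<le> 0" using False by (simp add: divide_le_0_iff)
  then show ?thesis by simp
qed simp

lemma orth_proj_ex1: "\<exists>!y. y \<in> M \<and> (\<forall>z\<in>M. cinner (x - y) z = 0)"
proof (rule ex_ex1I)
  show "\<exists>y. y \<in> M \<and> (\<forall>z\<in>M. cinner (x - y) z = 0)"
    using ex_nearest nearest_orthogonal by meson
  show "y = y'" if "y \<in> M \<and> (\<forall>z\<in>M. cinner (x - y) z = 0)"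
    "y' \<in> M \<and> (\<forall>z\<in>M. cinner (x - y') z = 0)" for y y'
    using that by (intro eqI_cinner) (auto simp: cinner_diff_left)
qed

lemma orth_proj_mem [intro, simp]: "orth_proj M x \<in> M"
  and orth_proj_orth: "z \<in> M \<Longrightarrow> cinner (x - orth_proj M x) z = 0"
  using theI'[OF orth_proj_ex1[of x]] by (auto simp: orth_proj_def)

lemma orth_proj_eqI: "y \<in> M \<Longrightarrow> (\<And>z. z \<in> M \<Longrightarrow> cinner x z = cinner y z) \<Longrightarrow> orth_proj M x = y"
  unfolding orth_proj_def
  by (rule the1_equality[OF orth_proj_ex1]) (auto simp: cinner_diff_left)

lemma orth_proj_ident [simp]: "x \<in> M \<Longrightarrow> orth_proj M x = x"
  by (rule orth_proj_eqI) auto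

lemma cinner_orth_proj_left: "z \<in> M \<Longrightarrow> cinner (orth_proj M x) z = cinner x z"
  using orth_proj_orth[of z x] by (simp add: cinner_diff_left)

lemma orth_proj_add: "orth_proj M (x + y) = orth_proj M x + orth_proj M y"
  by (rule orth_proj_eqI) (auto simp: cinner_algebra cinner_orth_proj_left)

lemma orth_proj_scale: "orth_proj M (c *\<^sub>C x) = c *\<^sub>C orth_proj M x"
  by (rule orth_proj_eqI) (auto simp: cinner_algebra cinner_orth_proj_left)

text \<open>The kernel of \<open>f\<close> is closed by the bound. A vector \<open>w\<close>
  orthogonal to it determines \<open>f\<close> up to a factor, since
  \<open>f w *\<^sub>C x - f x *\<^sub>C w\<close> always lies in the kernel.\<close>

lemma Riesz_representation:
  assumes add: "\<And>x y. x \<in> M \<Longrightarrow> y \<in> M \<Longrightarrow> f (x + y) = f x + f y"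
    and scale: "\<And>c x. x \<in> M \<Longrightarrow> f (c *\<^sub>C x) = c * f x"
    and bound: "\<And>x. x \<in> M \<Longrightarrow> cmod (f x) \<le> B * norm x"
  shows "\<exists>!y. y \<in> M \<and> (\<forall>x\<in>M. f x = cinner x y)"
proof (rule ex_ex1I)
  show "y = y'" if "y \<in> M \<and> (\<forall>x\<in>M. f x = cinner x y)" "y' \<in> M \<and> (\<forall>x\<in>M. f x = cinner x y')" for y y'
    using that by (intro eqI_cinner) (auto, metis cinner_commute)
  have f0: "f 0 = 0" using scale[of 0 0] by simp
  have fd: "f (x - y) = f x - f y" if "x \<in> M" "y \<in> M" for x y
    using add[of x "-y"] scale[of y "-1"] that minus_mem[of y] by simp
  show "\<exists>y. y \<in> M \<and> (\<forall>x\<in>M. f x = cinner x y)"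
  proof (cases "\<forall>x\<in>M. f x = 0")
    case True then show ?thesis by (intro exI[of _ 0]) auto
  next
    case False
    then obtain u where u: "u \<in> M" "f u \<noteq> 0" by blast
    define N where "N = {x \<in> M. f x = 0}"
    have "closed N"
      unfolding closed_sequential_limits
    proof clarify
      fix s l assume s: "\<forall>n. s n \<in> N" "s \<longlonglongrightarrow> l"
      then have l: "l \<in> M" using lim_mem by (auto simp: N_def)
      have "(\<lambda>n. cmod (f (s n - l))) \<longlonglongrightarrow> 0"
      proof (rule tendsto_sandwich)
        show "(\<lambda>n. 0) \<longlonglongrightarrow> (0::real)" by simp
        show "(\<lambda>n. B * norm (s n - l)) \<longlonglongrightarrow> 0"
          using s(2) by (auto intro!: tendsto_eq_intros simp: LIM_zero_iff tendsto_norm_zero_iff)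
      qed (use s(1) l bound[OF diff_mem] in \<open>auto simp: N_def\<close>)
      moreover have "f (s n - l) = - f l" for n using s(1) l fd[of "s n" l] by (simp add: N_def)
      ultimately have "f l = 0" by (simp add: LIMSEQ_const_iff)
      with l show "l \<in> N" by (simp add: N_def)
    qed
    then interpret N: closed_csubspace N
      by unfold_locales (auto simp: hilbert_subspace_def csubspace_iff N_def f0 add scale)
    define w where "w = u - orth_proj N u"
    have pN: "orth_proj N u \<in> M" "f (orth_proj N u) = 0" using N.orth_proj_mem[of u] by (auto simp: N_def)
    then have w: "w \<in> M" "f w = f u" by (auto simp: w_def fd u)
    have w0: "w \<noteq> 0" using w u f0 by auto
    have orth: "cinner w z = 0" if "z \<in> N" for z using N.orth_proj_orth[OF that] by (simp add: w_def)
    let ?y = "(cnj (f w) / complex_of_real ((norm w)\<^sup>2)) *\<^sub>C w"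
    have "f x = cinner x ?y" if x: "x \<in> M" for x
    proof -
      have "f w *\<^sub>C x - f x *\<^sub>C w \<in> N" using x w by (auto simp: N_def fd scale scale_mem diff_mem)
      then have "cinner (f w *\<^sub>C x - f x *\<^sub>C w) w = 0" using orth by (subst cinner_commute) simp
      then have "f x * complex_of_real ((norm w)\<^sup>2) = f w * cinner x w"
        by (simp add: cinner_algebra cinner_self)
      then show ?thesis using w0 by (simp add: cinner_scaleC_right field_simps)
    qed
    then show ?thesis using w by (intro exI[of _ ?y]) auto
  qed
qed

end

subsection \<open>Bounded operators on a closed subspace\<close>

context closed_csubspace
begin

lemma bopsI:
  assumes "\<And>x y. x \<in> M \<Longrightarrow> y \<in> M \<Longrightarrow> A (x + y) = A x + A y"
    and "\<And>c x. x \<in> M \<Longrightarrow> A (c *\<^sub>C x) = c *\<^sub>C A x"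
    and "\<And>x. x \<in> M \<Longrightarrow> A x \<in> M" and "\<And>x. x \<in> M \<Longrightarrow> norm (A x) \<le> B * norm x"
    and "\<And>x. x \<notin> M \<Longrightarrow> A x = 0"
  shows "A \<in> bops M"
  using assms unfolding bops_def clinear_on_def by (auto intro!: exI[of _ B])

lemma bops_add: "A \<in> bops M \<Longrightarrow> x \<in> M \<Longrightarrow> y \<in> M \<Longrightarrow> A (x + y) = A x + A y"
  and bops_scale: "A \<in> bops M \<Longrightarrow> x \<in> M \<Longrightarrow> A (c *\<^sub>C x) = c *\<^sub>C A x"
  and bops_off: "A \<in> bops M \<Longrightarrow> x \<notin> M \<Longrightarrow> A x = 0"
  by (auto simp: bops_def clinear_on_def)

lemma bops_mem: "A \<in> bops M \<Longrightarrow> A x \<in> M"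
  by (cases "x \<in> M") (auto simp: bops_def)

lemma bops_zero: "A \<in> bops M \<Longrightarrow> A 0 = 0"
  using bops_scale[of A 0 0] by simp

lemma bops_minus: "A \<in> bops M \<Longrightarrow> x \<in> M \<Longrightarrow> A (- x) = - A x"
  using bops_scale[of A x "-1"] by simp

lemma bops_diff: "A \<in> bops M \<Longrightarrow> x \<in> M \<Longrightarrow> y \<in> M \<Longrightarrow> A (x - y) = A x - A y"
  using bops_add[of A x "-y"] bops_minus[of A y] minus_mem[of y] by simp

lemma bops_scaleR: "A \<in> bops M \<Longrightarrow> x \<in> M \<Longrightarrow> A (r *\<^sub>R x) = r *\<^sub>R A x"
  by (simp add: scaleR_scaleC bops_scale)

lemma bops_eqI: "A \<in> bops M \<Longrightarrow> B \<in> bops M \<Longrightarrow> (\<And>x. x \<in> M \<Longrightarrow> A x = B x) \<Longrightarrow> A = B"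
  by (rule ext) (metis bops_off)

lemma bops_eqI_cinner:
  assumes "A \<in> bops M" "B \<in> bops M" "\<And>x y. x \<in> M \<Longrightarrow> y \<in> M \<Longrightarrow> cinner (A x) y = cinner (B x) y"
  shows "A = B"
  using assms by (intro bops_eqI eqI_cinner) (auto simp: bops_mem)

text \<open>\<open>onorm\<close> is a supremum over the whole type. A bound on \<open>M\<close>
  suffices because operators vanish off \<open>M\<close> and the quotient at 0 is 0 by the
  convention for division.\<close>

lemma bops_bdd_above: "A \<in> bops M \<Longrightarrow> bdd_above (range (\<lambda>x. norm (A x) / norm x))"
proof -
  assume A: "A \<in> bops M"
  then obtain B where B: "\<forall>x\<in>M. norm (A x) \<le> B * norm x" by (auto simp: bops_def)
  have "norm (A x) / norm x \<le> \<bar>B\<bar>" for x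
  proof (cases "x \<in> M \<and> x \<noteq> 0")
    case True
    then have "norm (A x) \<le> B * norm x" using B by auto
    also have "\<dots> \<le> \<bar>B\<bar> * norm x" by (intro mult_right_mono) auto
    finally show ?thesis using True by (simp add: field_simps)
  next
    case False then show ?thesis using A by (auto simp: bops_off bops_zero)
  qed
  then show ?thesis by (rule bdd_aboveI2)
qed

lemma norm_le_onorm: "A \<in> bops M \<Longrightarrow> norm (A x) \<le> onorm A * norm x"
  using cSUP_upper[OF UNIV_I bops_bdd_above, of A x]
  by (cases "x = 0") (simp_all add: onorm_def field_simps bops_zero)

lemma onorm_nonneg: "A \<in> bops M \<Longrightarrow> 0 \<le> onorm A"
  using cSUP_upper[OF UNIV_I bops_bdd_above, of A 0] by (simp add: onorm_def bops_zero)

lemma onorm_leI: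
  assumes "A \<in> bops M" "0 \<le> b" "\<And>x. x \<in> M \<Longrightarrow> norm (A x) \<le> b * norm x"
  shows "onorm A \<le> b"
  unfolding onorm_def
proof (rule cSUP_least)
  show "norm (A x) / norm x \<le> b" for x
  proof (cases "x \<in> M \<and> x \<noteq> 0")
    case True with assms show ?thesis by (simp add: field_simps)
  next
    case False with assms show ?thesis by (auto simp: bops_off bops_zero)
  qed
qed simp

lemma cinner_le_onorm: "A \<in> bops M \<Longrightarrow> cmod (cinner (A x) y) \<le> onorm A * norm x * norm y"
  by (rule order_trans[OF cinner_Cauchy_Schwarz]) (auto intro!: mult_right_mono norm_le_onorm)

lemma bops_tendsto:
  assumes "A \<in> bops M" "\<And>n. f n \<in> M" "f \<longlonglongrightarrow> l"
  shows "(\<lambda>n. A (f n)) \<longlonglongrightarrow> A l"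
proof -
  have l: "l \<in> M" using assms lim_mem by blast
  have "(\<lambda>n. A (f n) - A l) \<longlonglongrightarrow> 0"
  proof (rule Lim_null_comparison)
    show "\<forall>\<^sub>F n in sequentially. norm (A (f n) - A l) \<le> onorm A * norm (f n - l)"
      using norm_le_onorm[OF assms(1)] assms l by (simp add: bops_diff[symmetric])
    show "(\<lambda>n. onorm A * norm (f n - l)) \<longlonglongrightarrow> 0"
      using assms(3) by (auto intro!: tendsto_eq_intros simp: LIM_zero_iff tendsto_norm_zero_iff)
  qed
  then show ?thesis by (simp add: LIM_zero_iff)
qed

lemma zero_bops [simp, intro]: "(\<lambda>_. 0) \<in> bops M"
  by (rule bopsI[where B = 0]) auto

lemma id_bops [simp, intro]: "id_op M \<in> bops M"
  by (rule bopsI[where B = 1]) (auto simp: id_op_def restrict_op_def)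

lemma id_op_apply [simp]: "x \<in> M \<Longrightarrow> id_op M x = x"
  by (simp add: id_op_def restrict_op_def)

lemma add_bops [intro]: "A \<in> bops M \<Longrightarrow> B \<in> bops M \<Longrightarrow> (\<lambda>x. A x + B x) \<in> bops M"
proof (rule bopsI[where B = "onorm A + onorm B"])
  assume AB: "A \<in> bops M" "B \<in> bops M"
  show "norm (A x + B x) \<le> (onorm A + onorm B) * norm x" for x
    using norm_triangle_mono[OF norm_le_onorm[OF AB(1)] norm_le_onorm[OF AB(2)]]
    by (simp add: distrib_right)
qed (simp_all add: bops_add bops_scale scaleC_add_right bops_off bops_mem add_mem)

lemma scale_bops [intro]: "A \<in> bops M \<Longrightarrow> (\<lambda>x. c *\<^sub>C A x) \<in> bops M"
proof (rule bopsI[where B = "cmod c * onorm A"])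
  assume A: "A \<in> bops M"
  show "norm (c *\<^sub>C A x) \<le> cmod c * onorm A * norm x" for x
    using mult_left_mono[OF norm_le_onorm[OF A], of "cmod c" x] by (simp add: mult.assoc)
qed (simp_all add: bops_add bops_scale scaleC_add_right bops_off bops_mem scale_mem mult.commute)

lemma comp_bops [intro]: "A \<in> bops M \<Longrightarrow> B \<in> bops M \<Longrightarrow> A \<circ> B \<in> bops M"
proof (rule bopsI[where B = "onorm A * onorm B"])
  assume AB: "A \<in> bops M" "B \<in> bops M"
  show "norm ((A \<circ> B) x) \<le> onorm A * onorm B * norm x" for x
    using order_trans[OF norm_le_onorm[OF AB(1)] mult_left_mono[OF norm_le_onorm[OF AB(2)] onorm_nonneg[OF AB(1)]]]
    by (simp add: mult.assoc)
qed (simp_all add: bops_add bops_scale bops_off bops_zero bops_mem)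

lemma minus_bops [intro]: "A \<in> bops M \<Longrightarrow> (\<lambda>x. - A x) \<in> bops M"
  using scale_bops[of A "-1"] by simp

lemma diff_bops [intro]: "A \<in> bops M \<Longrightarrow> B \<in> bops M \<Longrightarrow> (\<lambda>x. A x - B x) \<in> bops M"
  using add_bops[OF _ minus_bops, of A B] by simp

lemma scale_id_bops [intro]: "restrict_op M (\<lambda>x. c *\<^sub>C x) \<in> bops M"
  by (rule bopsI[where B = "cmod c"]) (auto simp: restrict_op_def scaleC_add_right mult.commute)

lemma onorm_comp_le: "A \<in> bops M \<Longrightarrow> B \<in> bops M \<Longrightarrow> onorm (A \<circ> B) \<le> onorm A * onorm B"
proof (rule onorm_leI)
  fix x assume "A \<in> bops M" "B \<in> bops M"
  then have "norm (A (B x)) \<le> onorm A * norm (B x)" "onorm A * norm (B x) \<le> onorm A * (onorm B * norm x)"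
    by (auto intro!: mult_left_mono norm_le_onorm onorm_nonneg)
  then show "norm ((A \<circ> B) x) \<le> onorm A * onorm B * norm x" by (simp add: mult.assoc)
qed (auto simp: onorm_nonneg)

lemma onorm_add_le: "A \<in> bops M \<Longrightarrow> B \<in> bops M \<Longrightarrow> onorm (\<lambda>x. A x + B x) \<le> onorm A + onorm B"
  by (rule onorm_leI) (auto simp: onorm_nonneg distrib_right
      intro!: norm_triangle_mono norm_le_onorm)

lemma onorm_scale_le: "A \<in> bops M \<Longrightarrow> onorm (\<lambda>x. c *\<^sub>C A x) \<le> cmod c * onorm A"
  by (rule onorm_leI) (auto simp: onorm_nonneg mult.assoc intro!: mult_left_mono norm_le_onorm)

text \<open>For fixed \<open>x\<close> the functional that sends \<open>z\<close> to
  \<open>cnj (b x z)\<close> is linear and hence represented by a vector. Both the adjoint and the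
  symbol of a Toeplitz operator are obtained this way.\<close>

lemma sesquilinear_representation:
  assumes "\<And>x y z. x \<in> M \<Longrightarrow> y \<in> M \<Longrightarrow> z \<in> M \<Longrightarrow> b (x + y) z = b x z + b y z"
    and "\<And>c x y. x \<in> M \<Longrightarrow> y \<in> M \<Longrightarrow> b (c *\<^sub>C x) y = c * b x y"
    and "\<And>x y z. x \<in> M \<Longrightarrow> y \<in> M \<Longrightarrow> z \<in> M \<Longrightarrow> b x (y + z) = b x y + b x z"
    and "\<And>c x y. x \<in> M \<Longrightarrow> y \<in> M \<Longrightarrow> b x (c *\<^sub>C y) = cnj c * b x y"
    and bound: "\<And>x y. x \<in> M \<Longrightarrow> y \<in> M \<Longrightarrow> cmod (b x y) \<le> C * norm x * norm y"
  obtains Y where "Y \<in> bops M" "\<And>x y. x \<in> M \<Longrightarrow> y \<in> M \<Longrightarrow> cinner (Y x) y = b x y"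
    "\<And>x. x \<in> M \<Longrightarrow> norm (Y x) \<le> C * norm x"
proof -
  have "\<exists>!y. y \<in> M \<and> (\<forall>z\<in>M. cnj (b x z) = cinner z y)" if "x \<in> M" for x
    by (rule Riesz_representation[where B = "C * norm x"]) (use that assms in auto)
  then have "\<forall>x. \<exists>y. x \<in> M \<longrightarrow> y \<in> M \<and> (\<forall>z\<in>M. cnj (b x z) = cinner z y)" by meson
  then obtain Y0 where Y0: "\<And>x. x \<in> M \<Longrightarrow> Y0 x \<in> M"
    "\<And>x z. x \<in> M \<Longrightarrow> z \<in> M \<Longrightarrow> cnj (b x z) = cinner z (Y0 x)" by metis
  define Y where "Y = restrict_op M Y0"
  have Y: "Y x \<in> M" "cinner (Y x) z = b x z" if "x \<in> M" "z \<in> M" for x z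
    using Y0 that by (auto simp: Y_def restrict_op_def) (metis cinner_commute complex_cnj_cnj)
  have nY: "norm (Y x) \<le> C * norm x" if x: "x \<in> M" for x
  proof (cases "Y x = 0")
    \<comment> \<open>The sign of \<open>C\<close> is unknown; the bound at the pair
      \<open>x\<close>, \<open>x\<close> shows that \<open>C * norm x\<close> is
      nonnegative.\<close>
    case True
    with bound[OF x x] show ?thesis
      by (metis (no_types, opaque_lifting) mult_cancel_right2 mult_zero_left norm_ge_zero norm_zero
          order_trans zero_le_mult_iff linorder_not_le mult_less_0_iff)
  next
    case False
    have "norm (Y x) * norm (Y x) = cmod (cinner (Y x) (Y x))"
      by (simp add: cmod_cinner_self)
    also have "\<dots> \<le> C * norm x * norm (Y x)" using Y(2)[OF x Y(1)[OF x x]] bound[OF x Y(1)[OF x x]] by simp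
    finally show ?thesis using False by simp
  qed
  have "Y \<in> bops M"
  proof (rule bopsI[where B = C])
    show "Y (x + y) = Y x + Y y" if "x \<in> M" "y \<in> M" for x y
      using that by (intro eqI_cinner) (auto simp: Y add_mem cinner_algebra assms)
    show "Y (c *\<^sub>C x) = c *\<^sub>C Y x" if "x \<in> M" for c x
      using that by (intro eqI_cinner) (auto simp: Y scale_mem cinner_algebra assms)
  qed (use Y nY in \<open>auto simp: Y_def restrict_op_def\<close>)
  with Y(2) nY that show thesis by blast
qed

section \<open>Adjoints and normal operators\<close>

lemma adj_ex1:
  assumes A: "A \<in> bops M"
  shows "\<exists>!B. B \<in> bops M \<and> (\<forall>x\<in>M. \<forall>y\<in>M. cinner (A x) y = cinner x (B y))"
proof (rule ex_ex1I)
  obtain Y where Y: "Y \<in> bops M" "\<And>x y. x \<in> M \<Longrightarrow> y \<in> M \<Longrightarrow> cinner (Y x) y = cinner x (A y)"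
  proof (rule sesquilinear_representation[of "\<lambda>x y. cinner x (A y)" "onorm A"])
    show "cmod (cinner x (A y)) \<le> onorm A * norm x * norm y" for x y
      using order_trans[OF cinner_Cauchy_Schwarz mult_left_mono[OF norm_le_onorm[OF A]]]
      by (simp add: mult.commute mult.left_commute)
  qed (auto simp: A bops_add bops_scale cinner_algebra)
  show "\<exists>B. B \<in> bops M \<and> (\<forall>x\<in>M. \<forall>y\<in>M. cinner (A x) y = cinner x (B y))"
    using Y by (intro exI[of _ Y]) (metis cinner_commute)
  fix B B' assume "B \<in> bops M \<and> (\<forall>x\<in>M. \<forall>y\<in>M. cinner (A x) y = cinner x (B y))"
    "B' \<in> bops M \<and> (\<forall>x\<in>M. \<forall>y\<in>M. cinner (A x) y = cinner x (B' y))"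
  then show "B = B'" by (intro bops_eqI_cinner) (auto, metis cinner_commute)
qed

lemma adj_bops [intro]: "A \<in> bops M \<Longrightarrow> adj M A \<in> bops M"
  and cinner_adj_right: "A \<in> bops M \<Longrightarrow> x \<in> M \<Longrightarrow> y \<in> M \<Longrightarrow> cinner x (adj M A y) = cinner (A x) y"
  using theI'[OF adj_ex1[of A]] by (auto simp: adj_def)

lemma cinner_adj_left: "A \<in> bops M \<Longrightarrow> x \<in> M \<Longrightarrow> y \<in> M \<Longrightarrow> cinner (adj M A x) y = cinner x (A y)"
  by (metis cinner_adj_right cinner_commute)

lemma adj_eqI:
  assumes "A \<in> bops M" "B \<in> bops M" "\<And>x y. x \<in> M \<Longrightarrow> y \<in> M \<Longrightarrow> cinner (A x) y = cinner x (B y)"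
  shows "adj M A = B"
  unfolding adj_def by (rule the1_equality[OF adj_ex1]) (use assms in auto)

lemma adj_adj [simp]: "A \<in> bops M \<Longrightarrow> adj M (adj M A) = A"
  by (rule adj_eqI) (auto simp: cinner_adj_left)

lemma adj_comp: "A \<in> bops M \<Longrightarrow> B \<in> bops M \<Longrightarrow> adj M (A \<circ> B) = adj M B \<circ> adj M A"
  by (rule adj_eqI) (auto simp: cinner_adj_right bops_mem adj_bops)

lemma adj_add: "A \<in> bops M \<Longrightarrow> B \<in> bops M \<Longrightarrow> adj M (\<lambda>x. A x + B x) = (\<lambda>x. adj M A x + adj M B x)"
  by (rule adj_eqI) (auto simp: cinner_adj_right cinner_algebra bops_mem adj_bops)

lemma adj_diff: "A \<in> bops M \<Longrightarrow> B \<in> bops M \<Longrightarrow> adj M (\<lambda>x. A x - B x) = (\<lambda>x. adj M A x - adj M B x)"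
  by (rule adj_eqI) (auto simp: cinner_adj_right cinner_algebra bops_mem adj_bops)

lemma adj_scale: "A \<in> bops M \<Longrightarrow> adj M (\<lambda>x. c *\<^sub>C A x) = (\<lambda>x. cnj c *\<^sub>C adj M A x)"
  by (rule adj_eqI) (auto simp: cinner_adj_right cinner_algebra bops_mem adj_bops)

lemma adj_id [simp]: "adj M (id_op M) = id_op M"
  by (rule adj_eqI) auto

lemma adj_scale_id: "adj M (restrict_op M (\<lambda>x. c *\<^sub>C x)) = restrict_op M (\<lambda>x. cnj c *\<^sub>C x)"
  by (rule adj_eqI) (use scale_id_bops in \<open>auto simp: cinner_algebra restrict_op_def\<close>)

lemma onorm_adj [simp]: "A \<in> bops M \<Longrightarrow> onorm (adj M A) = onorm A"
proof -
  have le: "onorm (adj M A) \<le> onorm A" if A: "A \<in> bops M" for A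
  proof (rule onorm_leI)
    fix x assume x: "x \<in> M"
    have Ax: "adj M A x \<in> M" using A by (blast intro: bops_mem)
    have "norm (adj M A x) * norm (adj M A x) = cmod (cinner (adj M A x) (adj M A x))"
      by (simp add: cmod_cinner_self)
    also have "\<dots> = cmod (cinner (A (adj M A x)) x)"
      using cinner_adj_right[OF A Ax x] by simp
    also have "\<dots> \<le> onorm A * norm (adj M A x) * norm x"
      by (rule cinner_le_onorm[OF A])
    finally show "norm (adj M A x) \<le> onorm A * norm x"
      using onorm_nonneg[OF A] by (cases "adj M A x = 0") (auto simp: mult.commute mult.left_commute)
  qed (use A onorm_nonneg in auto)
  assume "A \<in> bops M"
  with le[of A] le[of "adj M A"] show ?thesis by (simp add: adj_bops)
qed

lemma comp_id [simp]: "A \<in> bops M \<Longrightarrow> A \<circ> id_op M = A" "A \<in> bops M \<Longrightarrow> id_op M \<circ> A = A"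
  by (rule bops_eqI; auto simp: bops_mem)+

lemma normal_commute: "normal_op M A \<Longrightarrow> x \<in> M \<Longrightarrow> adj M A (A x) = A (adj M A x)"
  unfolding normal_op_def by (metis comp_apply)

lemma norm_normal_adj: "normal_op M A \<Longrightarrow> x \<in> M \<Longrightarrow> norm (adj M A x) = norm (A x)"
proof -
  assume A: "normal_op M A" and x: "x \<in> M"
  then have B: "A \<in> bops M" by (simp add: normal_op_def)
  have "cinner (A x) (A x) = cinner (adj M A (A x)) x"
    using B x by (simp add: cinner_adj_left bops_mem)
  also have "\<dots> = cinner (A (adj M A x)) x"
    by (simp add: normal_commute[OF A x])
  also have "\<dots> = cinner (adj M A x) (adj M A x)"
    using B x by (simp add: cinner_adj_right adj_bops bops_mem)
  finally have "(norm (A x))\<^sup>2 = (norm (adj M A x))\<^sup>2"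
    by (metis cinner_self of_real_eq_iff)
  then show ?thesis by (simp add: power2_eq_iff_nonneg)
qed

lemma normal_diff_scalar:
  assumes A: "normal_op M A"
  shows "normal_op M (restrict_op M (\<lambda>x. A x - c *\<^sub>C x))"
    and "x \<in> M \<Longrightarrow> adj M (restrict_op M (\<lambda>x. A x - c *\<^sub>C x)) x = adj M A x - cnj c *\<^sub>C x"
proof -
  have AB: "A \<in> bops M" using A by (simp add: normal_op_def)
  let ?N = "restrict_op M (\<lambda>x. A x - c *\<^sub>C x)"
  have eq: "?N = (\<lambda>x. A x - restrict_op M (\<lambda>x. c *\<^sub>C x) x)"
    using AB by (auto simp: restrict_op_def bops_off bops_zero)
  have N: "?N \<in> bops M" unfolding eq using AB by blast
  have adjN: "adj M ?N = (\<lambda>x. adj M A x - restrict_op M (\<lambda>x. cnj c *\<^sub>C x) x)"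
    unfolding eq using AB by (subst adj_diff) (auto simp: adj_scale_id)
  then show "x \<in> M \<Longrightarrow> adj M ?N x = adj M A x - cnj c *\<^sub>C x"
    by (simp add: restrict_op_def)
  have "adj M ?N \<circ> ?N = ?N \<circ> adj M ?N"
  proof (rule bops_eqI)
    fix x assume x: "x \<in> M"
    have m: "A x \<in> M" "adj M A x \<in> M" "\<And>c. c *\<^sub>C x \<in> M" using AB x by (auto simp: bops_mem adj_bops)
    show "(adj M ?N \<circ> ?N) x = (?N \<circ> adj M ?N) x"
      unfolding adjN using m x AB
      by (simp add: restrict_op_def diff_mem bops_diff bops_scale adj_bops scaleC_diff_right
          normal_commute[OF A] mult.commute)
  qed (use N in auto)
  with N show "normal_op M ?N" by (simp add: normal_op_def)
qed

end

subsection \<open>Fuglede's theorem\<close>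

context closed_csubspace
begin

definition comm_adj :: "('a \<Rightarrow> 'a) \<Rightarrow> ('a \<Rightarrow> 'a) \<Rightarrow> 'a \<Rightarrow> 'a"
  where "comm_adj N X = (\<lambda>x. adj M N (X x) - X (adj M N x))"

definition flow_step :: "('a \<Rightarrow> 'a) \<Rightarrow> complex \<Rightarrow> ('a \<Rightarrow> 'a) \<Rightarrow> 'a \<Rightarrow> 'a"
  where "flow_step N c X = (\<lambda>x. X x + c *\<^sub>C comm_adj N X x)"

text \<open>
  \<open>flow_step N (\<lambda>/n)\<close> iterated \<open>n\<close> times approximates \<open>X \<mapsto> exp (\<lambda>N\<^sup>*) X exp (- \<lambda>N\<^sup>*)\<close>, the entire
  function of Rosenblum's proof; working with the polynomial approximants avoids operator
  exponentials.
\<close>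

lemma comm_adj_bops: "N \<in> bops M \<Longrightarrow> X \<in> bops M \<Longrightarrow> comm_adj N X \<in> bops M"
  unfolding comm_adj_def
  using diff_bops[OF comp_bops[of "adj M N" X] comp_bops[of X "adj M N"]] by (simp add: adj_bops comp_def)

lemma flow_step_bops: "N \<in> bops M \<Longrightarrow> X \<in> bops M \<Longrightarrow> flow_step N c X \<in> bops M"
  unfolding flow_step_def by (intro add_bops scale_bops comm_adj_bops)

lemma flow_power_bops: "N \<in> bops M \<Longrightarrow> X \<in> bops M \<Longrightarrow> (flow_step N c ^^ m) X \<in> bops M"
  by (induction m) (auto simp: flow_step_bops)

text \<open>Normality lets commutation with \<open>N\<close> survive a step. The norm estimate for a
  single step presupposes this commutation, so without it the estimate could not be
  iterated.\<close>

lemma flow_step_commute: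
  assumes N: "normal_op M N" and X: "X \<in> bops M" and XN: "\<And>x. x \<in> M \<Longrightarrow> X (N x) = N (X x)" and x: "x \<in> M"
  shows "flow_step N c X (N x) = N (flow_step N c X x)"
proof -
  have NB: "N \<in> bops M" using N by (simp add: normal_op_def)
  have m: "\<And>z. X z \<in> M" "\<And>z. N z \<in> M" "\<And>z. adj M N z \<in> M"
    using NB X by (auto simp: bops_mem adj_bops)
  show ?thesis
    by (simp add: flow_step_def comm_adj_def XN x m bops_add[OF NB] bops_scale[OF NB] bops_diff[OF NB]
        diff_mem scale_mem normal_commute[OF N])
qed

text \<open>
  If \<open>X\<close> commutes with \<open>N\<close>, the step is \<open>(1 + K) X (1 - K) + K X K\<close> for the skew-adjoint
  \<open>K = cN\<^sup>* - (cnj c)N\<close>, so its norm grows only quadratically in \<open>c\<close>.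
\<close>

lemma flow_step_norm:
  assumes N: "normal_op M N" and X: "X \<in> bops M" and XN: "\<And>x. x \<in> M \<Longrightarrow> X (N x) = N (X x)"
  shows "onorm (flow_step N c X) \<le> (1 + 2 * (2 * cmod c * onorm N)\<^sup>2) * onorm X"
proof -
  have NB: "N \<in> bops M" using N by (simp add: normal_op_def)
  define \<kappa> where "\<kappa> = 2 * cmod c * onorm N"
  have \<kappa>0: "0 \<le> \<kappa>" using onorm_nonneg[OF NB] by (simp add: \<kappa>_def)
  have X0: "0 \<le> onorm X" using onorm_nonneg[OF X] .
  define K where "K = (\<lambda>y. c *\<^sub>C adj M N y - cnj c *\<^sub>C N y)"
  have K: "K \<in> bops M" unfolding K_def using NB by (intro diff_bops scale_bops adj_bops)
  have Kn: "norm (K y) \<le> \<kappa> * norm y" for y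
  proof -
    have "norm (K y) \<le> cmod c * norm (adj M N y) + cmod c * norm (N y)"
      unfolding K_def by (rule order_trans[OF norm_triangle_ineq4]) simp
    also have "\<dots> \<le> cmod c * (onorm N * norm y) + cmod c * (onorm N * norm y)"
      using norm_le_onorm[OF NB, of y] norm_le_onorm[OF adj_bops[OF NB], of y] NB
      by (intro add_mono mult_left_mono) auto
    finally show ?thesis by (simp add: \<kappa>_def algebra_simps)
  qed
  have skew: "Re (cinner y (K y)) = 0" if "y \<in> M" for y
    by (simp add: K_def cinner_algebra cinner_adj_right[OF NB that that])
      (subst (1 2) cinner_commute[of "N y"], simp)
  \<comment> \<open>The cross terms vanish because \<open>K\<close> is skew-adjoint, so only the
    square of \<open>K y\<close> is added.\<close>
  have isom: "(norm (y + K y))\<^sup>2 \<le> (1 + \<kappa>\<^sup>2) * (norm y)\<^sup>2" "(norm (y - K y))\<^sup>2 \<le> (1 + \<kappa>\<^sup>2) * (norm y)\<^sup>2"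
    if "y \<in> M" for y
    using power_mono[OF Kn[of y], of 2]
    by (simp_all add: norm_add_sq norm_diff_sq skew[OF that] power_mult_distrib algebra_simps)
  define r where "r = sqrt (1 + \<kappa>\<^sup>2)"
  have r: "0 \<le> r" "r * r = 1 + \<kappa>\<^sup>2" by (simp_all add: r_def)
  have isom': "norm (y + K y) \<le> r * norm y" "norm (y - K y) \<le> r * norm y" if "y \<in> M" for y
    using real_le_rsqrt[OF isom(1)[OF that]] real_le_rsqrt[OF isom(2)[OF that]]
    by (simp_all add: r_def real_sqrt_mult)
  have m: "\<And>z. X z \<in> M" "\<And>z. N z \<in> M" "\<And>z. adj M N z \<in> M" "\<And>z. K z \<in> M"
    using NB X K by (auto simp: bops_mem adj_bops)
  have "norm (flow_step N c X x) \<le> (1 + 2 * \<kappa>\<^sup>2) * onorm X * norm x" if x: "x \<in> M" for x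
  proof -
    let ?u = "X (x - K x)"
    have Kx: "X (K x) = c *\<^sub>C X (adj M N x) - cnj c *\<^sub>C X (N x)"
      by (simp add: K_def bops_diff[OF X] bops_scale[OF X] m scale_mem)
    have KX: "K (X x) = c *\<^sub>C adj M N (X x) - cnj c *\<^sub>C N (X x)" by (simp add: K_def)
    \<comment> \<open>Passing from the commutator with the adjoint of \<open>N\<close> to the
      commutator with \<open>K\<close> costs nothing: the added part is a multiple of the commutator
      of \<open>X\<close> with \<open>N\<close>.\<close>
    have "flow_step N c X x = X x + (K (X x) - X (K x))"
      by (simp add: flow_step_def comm_adj_def Kx KX XN[OF x] scaleC_diff_right)
    also have "\<dots> = (?u + K ?u) + K (X (K x))"
      by (simp add: bops_diff[OF X] bops_diff[OF K] x m)
    finally have "norm (flow_step N c X x) \<le> norm (?u + K ?u) + norm (K (X (K x)))"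
      by (simp add: norm_triangle_ineq)
    also have "norm (?u + K ?u) \<le> r * norm ?u" by (rule isom') (rule m)
    also have "r * norm ?u \<le> r * (onorm X * norm (x - K x))"
      using r(1) by (intro mult_left_mono norm_le_onorm X)
    also have "r * (onorm X * norm (x - K x)) \<le> r * (onorm X * (r * norm x))"
      using r(1) X0 by (intro mult_left_mono isom' x)
    also have "r * (onorm X * (r * norm x)) = (1 + \<kappa>\<^sup>2) * onorm X * norm x"
      by (simp add: r(2)[symmetric])
    also have "norm (K (X (K x))) \<le> \<kappa> * norm (X (K x))" by (rule Kn)
    also have "\<kappa> * norm (X (K x)) \<le> \<kappa> * (onorm X * norm (K x))"
      using \<kappa>0 by (intro mult_left_mono norm_le_onorm X)
    also have "\<kappa> * (onorm X * norm (K x)) \<le> \<kappa> * (onorm X * (\<kappa> * norm x))"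
      using \<kappa>0 X0 by (intro mult_left_mono Kn)
    finally show ?thesis by (simp add: algebra_simps power2_eq_square)
  qed
  then show ?thesis unfolding \<kappa>_def
    using X0 by (intro onorm_leI flow_step_bops NB X) auto
qed

lemma flow_power_norm:
  assumes N: "normal_op M N" and X: "X \<in> bops M" and XN: "\<And>x. x \<in> M \<Longrightarrow> X (N x) = N (X x)"
  shows "onorm ((flow_step N c ^^ m) X) \<le> (1 + 2 * (2 * cmod c * onorm N)\<^sup>2) ^ m * onorm X"
proof -
  have NB: "N \<in> bops M" using N by (simp add: normal_op_def)
  have "onorm ((flow_step N c ^^ m) X) \<le> (1 + 2 * (2 * cmod c * onorm N)\<^sup>2) ^ m * onorm X \<and>
    (\<forall>x\<in>M. (flow_step N c ^^ m) X (N x) = N ((flow_step N c ^^ m) X x))"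
  proof (induction m)
    case 0 then show ?case using XN by simp
  next
    case (Suc m)
    let ?Y = "(flow_step N c ^^ m) X"
    have Y: "?Y \<in> bops M" using flow_power_bops[OF NB X] .
    have YN: "\<And>x. x \<in> M \<Longrightarrow> ?Y (N x) = N (?Y x)" using Suc.IH by blast
    have "onorm (flow_step N c ?Y) \<le> (1 + 2 * (2 * cmod c * onorm N)\<^sup>2) * onorm ?Y"
      by (rule flow_step_norm[OF N Y YN])
    also have "\<dots> \<le> (1 + 2 * (2 * cmod c * onorm N)\<^sup>2) *
        ((1 + 2 * (2 * cmod c * onorm N)\<^sup>2) ^ m * onorm X)"
      using Suc.IH by (intro mult_left_mono) auto
    finally show ?case using flow_step_commute[OF N Y YN] by (simp add: mult.assoc)
  qed
  then show ?thesis by blast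
qed

lemma flow_power_linear:
  assumes N: "N \<in> bops M" and X: "X \<in> bops M" and Y: "Y \<in> bops M" and x: "x \<in> M"
  shows "(flow_step N c ^^ m) (\<lambda>x. X x + a *\<^sub>C Y x) x
    = (flow_step N c ^^ m) X x + a *\<^sub>C (flow_step N c ^^ m) Y x"
  using x
proof (induction m arbitrary: x)
  case (Suc m)
  let ?X = "(flow_step N c ^^ m) X" and ?Y = "(flow_step N c ^^ m) Y"
  have m: "\<And>z. ?X z \<in> M" "\<And>z. ?Y z \<in> M" "\<And>z. adj M N z \<in> M"
    using flow_power_bops[OF N X] flow_power_bops[OF N Y] N by (auto simp: bops_mem adj_bops)
  show ?case
    by (simp add: flow_step_def[of N c "(flow_step N c ^^ m) _"] comm_adj_def Suc m
        bops_add[OF adj_bops[OF N]] bops_scale[OF adj_bops[OF N]] scale_mem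
        scaleC_add_right scaleC_diff_right algebra_simps)
qed simp

text \<open>Unrolling the innermost step expresses the coefficient for \<open>X\<close> after m + 1
  steps as the one for \<open>X\<close> after m steps plus \<open>c\<close> times the one for
  \<open>comm_adj N X\<close>. So it is a polynomial in \<open>c\<close>, and every step contributes
  one commutator to the derivative at 0.\<close>

lemma flow_power_deriv:
  assumes N: "N \<in> bops M" and X: "X \<in> bops M" and x: "x \<in> M"
  shows "(\<lambda>c. cinner ((flow_step N c ^^ m) X x) y) holomorphic_on UNIV \<and>
    ((\<lambda>c. cinner ((flow_step N c ^^ m) X x) y) has_field_derivative of_nat m * cinner (comm_adj N X x) y) (at 0)"
  using X
proof (induction m arbitrary: X)
  case (Suc m)
  have D: "comm_adj N X \<in> bops M" by (rule comm_adj_bops[OF N Suc.prems])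
  have eq: "(\<lambda>c. cinner ((flow_step N c ^^ Suc m) X x) y)
    = (\<lambda>c. cinner ((flow_step N c ^^ m) X x) y + c * cinner ((flow_step N c ^^ m) (comm_adj N X) x) y)"
  proof
    fix c
    have "(flow_step N c ^^ Suc m) X x = (flow_step N c ^^ m) (\<lambda>x. X x + c *\<^sub>C comm_adj N X x) x"
      by (subst funpow_Suc_right) (simp add: flow_step_def[of N c X])
    also have "\<dots> = (flow_step N c ^^ m) X x + c *\<^sub>C (flow_step N c ^^ m) (comm_adj N X) x"
      by (rule flow_power_linear[OF N Suc.prems D x])
    finally show "cinner ((flow_step N c ^^ Suc m) X x) y
      = cinner ((flow_step N c ^^ m) X x) y + c * cinner ((flow_step N c ^^ m) (comm_adj N X) x) y"
      by (simp add: cinner_algebra)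
  qed
  have f0: "(flow_step N 0 ^^ m) Z = Z" for Z
    by (induction m) (simp_all add: flow_step_def)
  show ?case unfolding eq
  proof
    show "(\<lambda>c. cinner ((flow_step N c ^^ m) X x) y + c * cinner ((flow_step N c ^^ m) (comm_adj N X) x) y)
        holomorphic_on UNIV"
      using Suc.IH[OF Suc.prems] Suc.IH[OF D] by (intro holomorphic_intros) auto
    show "((\<lambda>c. cinner ((flow_step N c ^^ m) X x) y + c * cinner ((flow_step N c ^^ m) (comm_adj N X) x) y)
        has_field_derivative of_nat (Suc m) * cinner (comm_adj N X x) y) (at 0)"
      using Suc.IH[OF Suc.prems] Suc.IH[OF D]
      by (auto intro!: derivative_eq_intros simp: f0 algebra_simps)
  qed
qed simp

text \<open>A Liouville argument at finite level: on the circle of radius R/n the coefficient after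
  n steps is bounded by a constant \<open>C\<close> independent of R and n, while its derivative at
  0 is n times the coefficient of the commutator. Cauchy's estimate leaves R times that coefficient
  bounded by \<open>C\<close>, for every R.\<close>

theorem Fuglede:
  assumes N: "normal_op M N" and A: "A \<in> bops M" and comm: "A \<circ> N = N \<circ> A"
  shows "A \<circ> adj M N = adj M N \<circ> A"
proof -
  have NB: "N \<in> bops M" using N by (simp add: normal_op_def)
  have AN: "\<And>x. x \<in> M \<Longrightarrow> A (N x) = N (A x)" using comm by (metis comp_apply)
  have zero: "cinner (comm_adj N A x) y = 0" if x: "x \<in> M" for x y
  proof -
    define C where "C = exp 1 * (onorm A * norm x * norm y)"
    have C0: "0 \<le> C" by (simp add: C_def onorm_nonneg[OF A])
    have bound: "cmod (cinner (comm_adj N A x) y) * R \<le> C" if R: "0 < R" for R :: real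
    proof -
      \<comment> \<open>For \<open>|c| = R / n\<close> the total growth is at most
        \<open>(1 + 8 R^2 |N|^2 / n^2)^n\<close>; this \<open>n\<close> keeps it below
        \<open>exp 1\<close>.\<close>
      obtain n :: nat where n: "8 * R\<^sup>2 * (onorm N)\<^sup>2 < real n" using reals_Archimedean2 by blast
      have n0: "0 < real n" using n by (smt (verit) mult_nonneg_nonneg zero_le_power2)
      let ?f = "\<lambda>c. cinner ((flow_step N c ^^ n) A x) y"
      have f: "?f holomorphic_on UNIV" "(?f has_field_derivative of_nat n * cinner (comm_adj N A x) y) (at 0)"
        using flow_power_deriv[OF NB A x] by auto
      have "norm ((deriv ^^ 1) ?f 0) \<le> fact 1 * C / (R / n) ^ 1"
      proof (rule Cauchy_inequality)
        show "?f holomorphic_on ball 0 (R / n)" using f(1) holomorphic_on_subset by blast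
        show "continuous_on (cball 0 (R / n)) ?f"
          using f(1) holomorphic_on_imp_continuous_on continuous_on_subset by blast
        show "0 < R / n" using R n0 by simp
        fix c assume "cmod (0 - c) = R / n"
        then have c: "cmod c = R / n" by simp
        have "2 * (2 * cmod c * onorm N)\<^sup>2 * n = 8 * R\<^sup>2 * (onorm N)\<^sup>2 / n"
          using n0 by (simp add: c power2_eq_square field_simps)
        also have "\<dots> \<le> 1" using n n0 by simp
        finally have le1: "n * (2 * (2 * cmod c * onorm N)\<^sup>2) \<le> 1" by (simp add: mult.commute)
        have "(1 + 2 * (2 * cmod c * onorm N)\<^sup>2) ^ n \<le> exp (2 * (2 * cmod c * onorm N)\<^sup>2) ^ n"
          by (intro power_mono) (auto simp: exp_ge_add_one_self)
        also have "\<dots> = exp (n * (2 * (2 * cmod c * onorm N)\<^sup>2))" by (rule exp_of_nat_mult[symmetric])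
        also have "\<dots> \<le> exp 1" using le1 by simp
        finally have "onorm ((flow_step N c ^^ n) A) \<le> exp 1 * onorm A"
          using flow_power_norm[OF N A AN, where c=c and m=n] mult_right_mono[OF _ onorm_nonneg[OF A]] by force
        then have "onorm ((flow_step N c ^^ n) A) * norm x * norm y \<le> exp 1 * onorm A * norm x * norm y"
          by (intro mult_right_mono) auto
        then show "cmod (?f c) \<le> C"
          using cinner_le_onorm[OF flow_power_bops[OF NB A, where c=c and m=n], of x y] by (simp add: C_def mult.assoc)
      qed
      then have "n * cmod (cinner (comm_adj N A x) y) \<le> C / (R / n)"
        using DERIV_imp_deriv[OF f(2)] by (simp add: norm_mult)
      then show ?thesis using R n0 by (simp add: field_simps)
    qed
    show ?thesis
    proof (rule ccontr)
      assume "cinner (comm_adj N A x) y \<noteq> 0"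
      then have p: "0 < cmod (cinner (comm_adj N A x) y)" by simp
      from bound[of "(C + 1) / cmod (cinner (comm_adj N A x) y)"] p C0 show False by simp
    qed
  qed
  show ?thesis
  proof (rule bops_eqI)
    fix x assume x: "x \<in> M"
    have "comm_adj N A x = 0" using zero[OF x, of "comm_adj N A x"] by simp
    then show "(A \<circ> adj M N) x = (adj M N \<circ> A) x" by (simp add: comm_adj_def)
  qed (use A NB in \<open>auto intro: comp_bops adj_bops\<close>)
qed

end

subsection \<open>Joint approximate eigenvectors of commuting normal operators\<close>

context closed_csubspace
begin

text \<open>For empty \<open>F\<close> this says that \<open>M\<close> is not the zero space, which
  is where the search for eigenvectors starts.\<close>

definition approx_null :: "('a \<Rightarrow> 'a) set \<Rightarrow> bool"
  where "approx_null F \<longleftrightarrow> (\<forall>e>0. \<exists>x\<in>M. norm x = 1 \<and> (\<forall>T\<in>F. norm (T x) \<le> e))"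

definition shift :: "('a \<Rightarrow> 'a) \<Rightarrow> complex \<Rightarrow> 'a \<Rightarrow> 'a"
  where "shift N c = restrict_op M (\<lambda>x. N x - c *\<^sub>C x)"

text \<open>\<open>N^* N - s^2\<close>: on its approximate null vectors the modulus of
  \<open>N\<close> acts nearly as the scalar \<open>s\<close>.\<close>

definition square_shift :: "('a \<Rightarrow> 'a) \<Rightarrow> real \<Rightarrow> 'a \<Rightarrow> 'a"
  where "square_shift N s = shift (adj M N \<circ> N) (complex_of_real (s\<^sup>2))"

lemma shift_apply: "x \<in> M \<Longrightarrow> shift N c x = N x - c *\<^sub>C x"
  by (simp add: shift_def restrict_op_def)

lemma shift_bops: "N \<in> bops M \<Longrightarrow> shift N c \<in> bops M"
proof -
  assume N: "N \<in> bops M"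
  then have "shift N c = (\<lambda>x. N x - c *\<^sub>C id_op M x)"
    by (auto simp: shift_def restrict_op_def id_op_def bops_off)
  then show ?thesis using N by (simp add: diff_bops scale_bops)
qed

lemma square_shift_bops: "N \<in> bops M \<Longrightarrow> square_shift N s \<in> bops M"
  unfolding square_shift_def by (intro shift_bops comp_bops adj_bops)

lemma shift_commute:
  assumes "N \<in> bops M" "T \<in> bops M" "T \<circ> N = N \<circ> T"
  shows "T \<circ> shift N c = shift N c \<circ> T"
proof (rule bops_eqI)
  fix x assume "x \<in> M"
  moreover have "T (N x) = N (T x)" using assms(3) by (metis comp_apply)
  ultimately show "(T \<circ> shift N c) x = (shift N c \<circ> T) x"
    using assms by (simp add: shift_apply bops_mem bops_diff bops_scale scale_mem)
qed (use assms in \<open>auto intro: comp_bops shift_bops\<close>)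

lemma normal_shift: "normal_op M N \<Longrightarrow> normal_op M (shift N c)"
  and adj_shift: "normal_op M N \<Longrightarrow> x \<in> M \<Longrightarrow> adj M (shift N c) x = adj M N x - cnj c *\<^sub>C x"
  unfolding shift_def by (rule normal_diff_scalar; assumption)+

text \<open>
  A near maximizer \<open>x\<close> of \<open>\<parallel>N x\<parallel>\<close> among approximate null vectors stays one under \<open>N\<close>, and
  \<open>\<parallel>N x\<parallel>\<^sup>2 \<le> \<parallel>N\<^sup>2 x\<parallel> \<parallel>x\<parallel>\<close> for normal \<open>N\<close>; near equality forces \<open>N\<^sup>* N x \<approx> s\<^sup>2 x\<close>.
\<close>

lemma approx_null_square:
  assumes N: "normal_op M N" and F: "F \<subseteq> bops M" "\<And>T. T \<in> F \<Longrightarrow> T \<circ> N = N \<circ> T" and null: "approx_null F"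
  obtains s where "0 \<le> s" "approx_null (insert (square_shift N s) F)"
    "\<And>x. x \<in> M \<Longrightarrow> norm x = 1 \<Longrightarrow> (\<And>T. T \<in> F \<Longrightarrow> T x = 0) \<Longrightarrow> norm (N x) \<le> s"
proof -
  have NB: "N \<in> bops M" using N by (simp add: normal_op_def)
  define G where "G e = {x\<in>M. norm x = 1 \<and> (\<forall>T\<in>F. norm (T x) \<le> e)}" for e
  define \<sigma> where "\<sigma> e = (SUP x\<in>G e. norm (N x))" for e
  \<comment> \<open>\<open>\<sigma>\<close> is monotone, so \<open>s\<close> is its limit as the
    tolerance tends to 0: the largest asymptotic value of \<open>norm (N x)\<close> on approximate
    null vectors.\<close>
  define s where "s = (INF e\<in>{0<..}. \<sigma> e)"
  have G: "G e \<noteq> {}" if "0 < e" for e using null that by (auto simp: approx_null_def G_def)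
  have bdd: "bdd_above ((\<lambda>x. norm (N x)) ` G e)" for e
  proof (rule bdd_aboveI2)
    show "norm (N x) \<le> onorm N" if "x \<in> G e" for x
      using norm_le_onorm[OF NB, of x] that by (simp add: G_def)
  qed
  have up: "norm (N x) \<le> \<sigma> e" if "x \<in> G e" for e x
    unfolding \<sigma>_def by (rule cSUP_upper[OF that bdd])
  have \<sigma>0: "0 \<le> \<sigma> e" if "0 < e" for e
    using G[OF that] up by (metis all_not_in_conv norm_ge_zero order_trans)
  have bddb: "bdd_below (\<sigma> ` {0<..})" using \<sigma>0 by (intro bdd_belowI2[of _ 0]) auto
  have s0: "0 \<le> s" unfolding s_def by (rule cINF_greatest) (use \<sigma>0 in auto)
  have sle: "s \<le> \<sigma> e" if "0 < e" for e unfolding s_def using that by (intro cINF_lower bddb) auto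
  have small: "\<exists>\<delta>>0. \<sigma> \<delta> < s + \<eta>" if "0 < \<eta>" for \<eta>
    using cINF_less_iff[OF _ bddb, of "s + \<eta>"] that by (auto simp: s_def)
  have large: "\<exists>x\<in>G e. s - \<eta> < norm (N x)" if "0 < e" "0 < \<eta>" for e \<eta>
    using less_cSUP_iff[OF G[OF that(1)] bdd, of "s - \<eta>"] sle[OF that(1)] that(2) by (auto simp: \<sigma>_def)
  have "\<exists>x\<in>G e. norm (square_shift N s x) \<le> e" if e: "0 < e" for e
  proof (cases "s = 0")
    \<comment> \<open>A vector \<open>N x\<close> cannot be renormalized when its norm may tend to
      0, but then \<open>N^* N x\<close> is small for the simple reason that \<open>N x\<close>
      is.\<close>
    case True
    define \<eta> where "\<eta> = e / (onorm N + 1)"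
    have \<nu>: "0 < onorm N + 1" using onorm_nonneg[OF NB] by simp
    then have "0 < \<eta>" using e by (simp add: \<eta>_def)
    then obtain \<delta> where \<delta>: "0 < \<delta>" "\<sigma> \<delta> < \<eta>" using small True by auto
    obtain x where x: "x \<in> G (min \<delta> e)" using G[of "min \<delta> e"] \<delta> e by auto
    then have x': "x \<in> G \<delta>" "x \<in> G e" "x \<in> M" by (auto simp: G_def)
    have "norm (adj M N (N x)) \<le> onorm N * norm (N x)"
      using norm_le_onorm[OF adj_bops[OF NB], of "N x"] NB by simp
    also have "\<dots> \<le> (onorm N + 1) * \<eta>"
      using up[OF x'(1)] \<delta>(2) onorm_nonneg[OF NB] by (intro mult_mono) auto
    also have "\<dots> = e" using \<nu> by (simp add: \<eta>_def)
    finally show ?thesis using x' True by (intro bexI[of _ x]) (auto simp: square_shift_def shift_apply)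
  next
    case False
    then have s: "0 < s" using s0 by simp
    \<comment> \<open>This expression will bound the square of
      \<open>norm (square_shift N s x)\<close> for a maximizer up to \<open>\<eta>\<close>. Its
      value at 0 is \<open>s^4 - 2 s^4 + s^4 = 0\<close>.\<close>
    have "((\<lambda>\<eta>. (s + \<eta>) ^ 4 - 2 * s\<^sup>2 * (s - \<eta>)\<^sup>2 + s ^ 4) \<longlongrightarrow> (s + 0) ^ 4 - 2 * s\<^sup>2 * (s - 0)\<^sup>2 + s ^ 4) (at_right 0)"
      by (intro tendsto_intros)
    then have "((\<lambda>\<eta>. (s + \<eta>) ^ 4 - 2 * s\<^sup>2 * (s - \<eta>)\<^sup>2 + s ^ 4) \<longlongrightarrow> 0) (at_right 0)"
      by (simp add: power2_eq_square power4_eq_xxxx)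
    then have "\<forall>\<^sub>F \<eta> in at_right 0. (s + \<eta>) ^ 4 - 2 * s\<^sup>2 * (s - \<eta>)\<^sup>2 + s ^ 4 < e\<^sup>2"
      by (rule order_tendstoD) (use e in simp)
    then obtain b where b: "0 < b" "\<And>\<eta>. 0 < \<eta> \<Longrightarrow> \<eta> < b \<Longrightarrow> (s + \<eta>) ^ 4 - 2 * s\<^sup>2 * (s - \<eta>)\<^sup>2 + s ^ 4 < e\<^sup>2"
      by (auto simp: eventually_at_right_field)
    define \<eta> where "\<eta> = min (s / 2) (b / 2)"
    have \<eta>: "0 < \<eta>" "\<eta> \<le> s / 2" "(s + \<eta>) ^ 4 - 2 * s\<^sup>2 * (s - \<eta>)\<^sup>2 + s ^ 4 < e\<^sup>2"
      using s b by (auto simp: \<eta>_def)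
    obtain \<delta> where \<delta>: "0 < \<delta>" "\<sigma> \<delta> < s + \<eta>" using small \<eta> by blast
    have \<nu>: "0 < onorm N + 1" using onorm_nonneg[OF NB] by simp
    \<comment> \<open>Small enough that the normalized vector \<open>N x / |N x|\<close>, where
      \<open>|N x| > s / 2\<close>, is still almost null with tolerance
      \<open>\<delta>\<close>.\<close>
    define \<delta>' where "\<delta>' = min (min \<delta> e) (\<delta> * (s / 2) / (onorm N + 1))"
    have \<delta>': "0 < \<delta>'" "\<delta>' \<le> \<delta>" "\<delta>' \<le> e" "\<delta>' \<le> \<delta> * (s / 2) / (onorm N + 1)"
      using \<delta> e s \<nu> by (auto simp: \<delta>'_def)
    obtain x where x: "x \<in> G \<delta>'" "s - \<eta> < norm (N x)" using large \<delta>'(1) \<eta>(1) by blast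
    have x': "x \<in> G \<delta>" "x \<in> G e" "x \<in> M" "norm x = 1" using x \<delta>' by (force simp: G_def)+
    let ?n = "norm (N x)"
    have n: "s / 2 < ?n" "0 < ?n" using x(2) \<eta>(2) s by auto
    define y where "y = (1 / ?n) *\<^sub>R N x"
    have "y \<in> G \<delta>" unfolding G_def
    proof safe
      show "y \<in> M" by (simp add: y_def bops_mem[OF NB] scaleR_mem)
      show "norm y = 1" using n by (simp add: y_def)
      fix T assume T: "T \<in> F"
      then have TB: "T \<in> bops M" using F by blast
      have "T (N x) = N (T x)" using F(2)[OF T] by (metis comp_apply)
      then have "norm (T y) = norm (N (T x)) / ?n"
        by (simp add: y_def bops_scaleR[OF TB] bops_mem[OF NB])
      also have "\<dots> \<le> (onorm N * norm (T x)) / ?n"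
        using n by (intro divide_right_mono norm_le_onorm[OF NB]) auto
      also have "\<dots> \<le> ((onorm N + 1) * \<delta>') / (s / 2)"
        using n s T x(1) \<delta>'(1) onorm_nonneg[OF NB] by (intro frac_le mult_mono) (auto simp: G_def)
      also have "\<dots> \<le> ((onorm N + 1) * (\<delta> * (s / 2) / (onorm N + 1))) / (s / 2)"
        using \<delta>'(4) s \<nu> by (intro divide_right_mono mult_left_mono) auto
      also have "\<dots> = \<delta>"
      proof -
        have "(a * (\<delta> * (s / 2) / a)) / (s / 2) = \<delta>" if "0 < a" for a using that s by simp
        from this[OF \<nu>] show ?thesis .
      qed
      finally show "norm (T y) \<le> \<delta>" .
    qed
    then have "norm (N y) \<le> s + \<eta>" using up[of y \<delta>] \<delta>(2) by simp
    then have "norm (N (N x)) \<le> (s + \<eta>) * ?n"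
      using n by (simp add: y_def bops_scaleR[OF NB] bops_mem[OF NB] field_simps)
    also have "\<dots> \<le> (s + \<eta>) * (s + \<eta>)"
      using up[OF x'(1)] \<delta>(2) s \<eta> by (intro mult_left_mono) auto
    finally have NNx: "norm (adj M N (N x)) \<le> (s + \<eta>)\<^sup>2"
      by (simp add: norm_normal_adj[OF N bops_mem[OF NB]] power2_eq_square)
    have "(norm (square_shift N s x))\<^sup>2
        = (norm (adj M N (N x)))\<^sup>2 + (s\<^sup>2)\<^sup>2 - 2 * (s\<^sup>2 * ?n\<^sup>2)"
      by (simp add: square_shift_def shift_apply[OF x'(3)] norm_diff_sq x'(4) cinner_scaleC_right
          cinner_adj_left[OF NB bops_mem[OF NB] x'(3)] cinner_self norm_power flip: of_real_power of_real_mult)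
    also have "\<dots> \<le> ((s + \<eta>)\<^sup>2)\<^sup>2 + (s\<^sup>2)\<^sup>2 - 2 * (s\<^sup>2 * (s - \<eta>)\<^sup>2)"
      using NNx x(2) \<eta> s by (intro diff_mono add_mono mult_left_mono power_mono) auto
    also have "\<dots> \<le> e\<^sup>2"
      using \<eta>(3) power_mult[of "s + \<eta>" 2 2] power_mult[of s 2 2] by simp
    finally have "norm (square_shift N s x) \<le> e" by (rule power2_le_imp_le) (use e in simp)
    with x'(2) show ?thesis by blast
  qed
  then have "approx_null (insert (square_shift N s) F)" by (auto simp: approx_null_def G_def)
  \<comment> \<open>An exact null vector belongs to every \<open>G e\<close>. For empty
    \<open>F\<close> this makes \<open>s\<close> a bound for \<open>N\<close>, so that
    \<open>s\<close> is nonzero whenever \<open>N\<close> is.\<close>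
  moreover have "norm (N x) \<le> s" if x: "x \<in> M" "norm x = 1" and 0: "\<And>T. T \<in> F \<Longrightarrow> T x = 0" for x
    unfolding s_def
  proof (rule cINF_greatest)
    fix e :: real assume e: "e \<in> {0<..}"
    have "\<forall>T\<in>F. norm (T x) \<le> e"
    proof
      fix T assume "T \<in> F"
      from 0[OF this] e show "norm (T x) \<le> e" by simp
    qed
    then show "norm (N x) \<le> \<sigma> e" using x by (intro up) (simp add: G_def)
  qed simp
  ultimately show thesis using that s0 by blast
qed

text \<open>The three numbers \<open>|z|\<close>, \<open>|z - 1|\<close>, \<open>|z - \<i>|\<close> determine \<open>z\<close>.\<close>

lemma approx_null_eigenvalue:
  assumes N: "normal_op M N" and F: "F \<subseteq> bops M" "\<And>T. T \<in> F \<Longrightarrow> T \<circ> N = N \<circ> T" and null: "approx_null F"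
  obtains z where "approx_null (insert (shift N z) F)"
proof -
  have NB: "N \<in> bops M" using N by (simp add: normal_op_def)
  have shN: "normal_op M (shift N c)" "shift N c \<in> bops M" for c
    using normal_shift[OF N] by (auto simp: normal_op_def)
  have T_comm: "T \<circ> shift N c = shift N c \<circ> T" if "T \<in> F" for T c
    using F that by (intro shift_commute NB) auto
  have shift_shift: "shift N c \<circ> shift N c' = shift N c' \<circ> shift N c" for c c'
    by (rule shift_commute[OF NB shN(2) shift_commute[OF NB NB refl, symmetric]])
  have sq_comm: "square_shift (shift N c) s \<circ> shift N c' = shift N c' \<circ> square_shift (shift N c) s" for c c' s
  proof -
    have "shift N c' \<circ> adj M (shift N c) = adj M (shift N c) \<circ> shift N c'"
      by (rule Fuglede[OF shN(1) shN(2) shift_shift])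
    then have "shift N c' \<circ> (adj M (shift N c) \<circ> shift N c) = (adj M (shift N c) \<circ> shift N c) \<circ> shift N c'"
      using shift_shift[of c' c] by (simp add: fun_eq_iff)
    then show ?thesis unfolding square_shift_def
      by (rule shift_commute[symmetric, rotated 2]) (intro comp_bops adj_bops shN)+
  qed
  obtain s0 where s0: "approx_null (insert (square_shift (shift N 0) s0) F)"
    using approx_null_square[OF shN(1) F(1) T_comm null] by metis
  obtain s1 where s1: "approx_null (insert (square_shift (shift N 1) s1) (insert (square_shift (shift N 0) s0) F))"
  proof (rule approx_null_square[OF shN(1)[of 1] _ _ s0])
    show "T \<circ> shift N 1 = shift N 1 \<circ> T" if "T \<in> insert (square_shift (shift N 0) s0) F" for T
      using that T_comm sq_comm by blast
  qed (use F(1) square_shift_bops[OF shN(2)] in auto)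
  obtain s2 where s2: "approx_null (insert (square_shift (shift N \<i>) s2)
      (insert (square_shift (shift N 1) s1) (insert (square_shift (shift N 0) s0) F)))"
  proof (rule approx_null_square[OF shN(1)[of \<i>] _ _ s1])
    show "T \<circ> shift N \<i> = shift N \<i> \<circ> T"
      if "T \<in> insert (square_shift (shift N 1) s1) (insert (square_shift (shift N 0) s0) F)" for T
      using that T_comm sq_comm by blast
  qed (use F(1) square_shift_bops[OF shN(2)] in auto)
  \<comment> \<open>Solves \<open>|z|^2 = s0^2\<close>, \<open>|z - 1|^2 = s1^2\<close>,
    \<open>|z - \<i>|^2 = s2^2\<close> for the real and the imaginary part: the differences of these
    equations are linear in them.\<close>
  define z where "z = (complex_of_real (1 - s1\<^sup>2 + s0\<^sup>2) + \<i> * complex_of_real (1 - s2\<^sup>2 + s0\<^sup>2)) / 2"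
  have sq: "square_shift (shift N c) s x = adj M N (N x) - c *\<^sub>C adj M N x - cnj c *\<^sub>C N x
      + (c * cnj c - complex_of_real (s\<^sup>2)) *\<^sub>C x" if "x \<in> M" for c s x
    using that
    by (simp add: square_shift_def shift_apply adj_shift[OF N] bops_mem[OF NB] bops_mem[OF adj_bops[OF NB]]
        diff_mem scale_mem bops_diff[OF adj_bops[OF NB]] bops_scale[OF adj_bops[OF NB]] scaleC_diff_right
        scaleC_diff_left algebra_simps)
  have "approx_null (insert (shift N z) F)"
    unfolding approx_null_def
  proof safe
    fix e :: real assume "0 < e"
    then obtain x where x: "x \<in> M" "norm x = 1" "\<forall>T\<in>insert (square_shift (shift N \<i>) s2)
      (insert (square_shift (shift N 1) s1) (insert (square_shift (shift N 0) s0) F)). norm (T x) \<le> e / 2"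
      using s2[unfolded approx_null_def, rule_format, of "e / 2"] by auto
    define D0 D1 D2 where "D0 = square_shift (shift N 0) s0 x" and "D1 = square_shift (shift N 1) s1 x"
      and "D2 = square_shift (shift N \<i>) s2 x"
    have n: "norm D0 \<le> e / 2" "norm D1 \<le> e / 2" "norm D2 \<le> e / 2"
      using x(3) by (auto simp: D0_def D1_def D2_def)
    \<comment> \<open>The factor \<open>\<i>\<close> on the second difference makes the terms with
      the adjoint of \<open>N\<close> cancel.\<close>
    have "D1 - D0 + \<i> *\<^sub>C (D2 - D0) = (- 2) *\<^sub>C (N x - z *\<^sub>C x)"
    proof -
      have two: "(2::complex) *\<^sub>C y = y + y" for y :: 'a
        using scaleC_add_left[of 1 1 y] by simp
      have "2 * z = complex_of_real (1 - s1\<^sup>2 + s0\<^sup>2) + \<i> * complex_of_real (1 - s2\<^sup>2 + s0\<^sup>2)"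
        by (simp add: z_def)
      moreover have "(- 2) *\<^sub>C (N x - z *\<^sub>C x) = - (N x + N x) + (2 * z) *\<^sub>C x"
        by (simp add: scaleC_diff_right two)
      ultimately have "(- 2) *\<^sub>C (N x - z *\<^sub>C x) = - (N x + N x) +
          (complex_of_real (1 - s1\<^sup>2 + s0\<^sup>2) + \<i> * complex_of_real (1 - s2\<^sup>2 + s0\<^sup>2)) *\<^sub>C x"
        by simp
      then show ?thesis
        by (simp add: D0_def D1_def D2_def sq[OF x(1)] scaleC_diff_right scaleC_add_right
            scaleC_add_left scaleC_diff_left algebra_simps)
    qed
    then have "2 * norm (N x - z *\<^sub>C x) = norm (D1 - D0 + \<i> *\<^sub>C (D2 - D0))"
      by (simp only: norm_scaleC) simp
    also have "\<dots> \<le> norm (D1 - D0) + norm (\<i> *\<^sub>C (D2 - D0))" by (rule norm_triangle_ineq)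
    also have "\<dots> \<le> (norm D1 + norm D0) + (norm D2 + norm D0)"
      using norm_triangle_ineq4[of D1 D0] norm_triangle_ineq4[of D2 D0] by simp
    finally have "norm (shift N z x) \<le> e" using n by (simp add: shift_apply x(1))
    moreover have "norm (T x) \<le> e" if "T \<in> F" for T using x(3) that \<open>0 < e\<close> by force
    ultimately show "\<exists>x\<in>M. norm x = 1 \<and> (\<forall>T\<in>insert (shift N z) F. norm (T x) \<le> e)"
      using x by blast
  qed
  then show thesis by (rule that)
qed

text \<open>The family grows by one shift per index. All its members commute with the operators
  still to be treated, which is what the step for a single operator asks for.\<close>

lemma joint_approx_eigenvalue:
  assumes "finite J" and N: "\<And>j. j \<in> J \<Longrightarrow> normal_op M (R j)"
    and comm: "\<And>i j. i \<in> J \<Longrightarrow> j \<in> J \<Longrightarrow> R i \<circ> R j = R j \<circ> R i"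
    and F: "F \<subseteq> bops M" "\<And>T j. T \<in> F \<Longrightarrow> j \<in> J \<Longrightarrow> T \<circ> R j = R j \<circ> T" and null: "approx_null F"
  shows "\<exists>z. approx_null (F \<union> (\<lambda>j. shift (R j) (z j)) ` J)"
  using assms
proof (induction J rule: finite_induct)
  case (insert k J)
  then obtain z where z: "approx_null (F \<union> (\<lambda>j. shift (R j) (z j)) ` J)" by auto
  have B: "R j \<in> bops M" if "j \<in> insert k J" for j
    using insert.prems(1)[OF that] by (simp add: normal_op_def)
  obtain w where w: "approx_null (insert (shift (R k) w) (F \<union> (\<lambda>j. shift (R j) (z j)) ` J))"
  proof (rule approx_null_eigenvalue[OF _ _ _ z])
    show "normal_op M (R k)" using insert.prems by simp
    show "F \<union> (\<lambda>j. shift (R j) (z j)) ` J \<subseteq> bops M"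
      using insert.prems B by (auto intro: shift_bops)
    fix T assume "T \<in> F \<union> (\<lambda>j. shift (R j) (z j)) ` J"
    then show "T \<circ> R k = R k \<circ> T"
    proof
      assume "T \<in> (\<lambda>j. shift (R j) (z j)) ` J"
      then obtain j where "j \<in> J" "T = shift (R j) (z j)" by blast
      moreover from this have "R k \<circ> R j = R j \<circ> R k" by (intro insert.prems) auto
      ultimately show ?thesis using shift_commute[of "R j" "R k" "z j"] B by auto
    next
      assume "T \<in> F"
      then show ?thesis by (rule insert.prems(4)) simp
    qed
  qed
  have "F \<union> (\<lambda>j. shift (R j) ((z(k := w)) j)) ` insert k J
      = insert (shift (R k) w) (F \<union> (\<lambda>j. shift (R j) (z j)) ` J)"
    using insert.hyps by (auto simp: image_iff)
  with w show ?case by metis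
qed auto

subsection \<open>Approximate eigenvalues lie in the Taylor spectrum\<close>

text \<open>A form supported on the full index set is closed because there is no higher degree. By
  exactness it is a differential, and this differential in top degree is the sum of the ranges with
  signs.\<close>

lemma koszul_exact_surj:
  assumes T: "\<And>i. i \<in> {1..d} \<Longrightarrow> T i \<in> bops M" and exact: "koszul_exact d M T" and y: "y \<in> M"
  shows "\<exists>v. (\<forall>i\<in>{1..d}. v i \<in> M) \<and> y = (\<Sum>i\<in>{1..d}. T i (v i))"
proof -
  define \<omega> where "\<omega> = (\<lambda>I. if I = {1..d} then y else 0)"
  have "\<omega> \<in> koszul_forms d M" using y by (auto simp: koszul_forms_def \<omega>_def)
  moreover have "koszul_diff d T \<omega> = (\<lambda>_. 0)"
  proof
    fix I
    have "T i (\<omega> (I - {i})) = 0" if "I \<subseteq> {1..d}" "i \<in> I" for i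
    proof -
      have "I - {i} \<noteq> {1..d}" using that by blast
      then show ?thesis using T[of i] that by (auto simp: \<omega>_def bops_zero)
    qed
    then show "koszul_diff d T \<omega> I = 0" by (auto simp: koszul_diff_def intro!: sum.neutral)
  qed
  ultimately have "\<omega> \<in> koszul_diff d T ` koszul_forms d M"
    using exact by (auto simp: koszul_exact_def)
  then obtain \<eta> where \<eta>: "\<eta> \<in> koszul_forms d M" "\<omega> = koszul_diff d T \<eta>" by blast
  have \<eta>M: "\<eta> ({1..d} - {i}) \<in> M" for i
    using \<eta>(1) by (auto simp: koszul_forms_def split: if_splits dest: spec[of _ "{1..d} - {i}"])
  have "y = koszul_diff d T \<eta> {1..d}" by (simp flip: \<eta>(2) add: \<omega>_def)
  also have "\<dots> = (\<Sum>i\<in>{1..d}. T i ((- 1) ^ card {j \<in> {1..d}. j < i} *\<^sub>R \<eta> ({1..d} - {i})))"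
    using T \<eta>M by (auto simp: koszul_diff_def bops_scaleR intro!: sum.cong)
  finally show ?thesis
    using \<eta>M by (intro exI[of _ "\<lambda>i. (- 1) ^ card {j \<in> {1..d}. j < i} *\<^sub>R \<eta> ({1..d} - {i})"])
      (auto intro: scaleR_mem)
qed

text \<open>
  Gliding hump: a vector \<open>y = \<Sum> \<plusminus> 4\<^sup>-\<^sup>k x\<^sub>k\<close> with \<open>|\<langle>y, x\<^sub>k\<rangle>| \<ge> (2/3) 4\<^sup>-\<^sup>k\<close> cannot lie in the
  sum of the ranges if \<open>\<parallel>T\<^sub>i x\<^sub>k\<parallel> \<le> 5\<^sup>-\<^sup>k\<close>.
\<close>

lemma gliding_hump:
  assumes x: "\<And>k::nat. x k \<in> M" "\<And>k. norm (x k) = 1"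
  shows "\<exists>y\<in>M. \<forall>k. (2/3) * (1/4) ^ k \<le> cmod (cinner y (x k))"
proof -
  \<comment> \<open>The sign of the k-th summand is chosen to make the coefficient against
    \<open>x k\<close> at least \<open>(1/4) ^ k\<close> in modulus. One of the signs works, since
    the two resulting values differ by twice that number.\<close>
  define p where "p = rec_nat 0 (\<lambda>k v. v + (if (1/4) ^ k \<le> cmod (cinner v (x k) + complex_of_real ((1/4) ^ k))
    then (1/4) ^ k else - ((1/4) ^ k)) *\<^sub>R x k)"
  define c :: "nat \<Rightarrow> real" where "c k = (if (1/4) ^ k \<le> cmod (cinner (p k) (x k) + complex_of_real ((1/4) ^ k))
    then (1/4) ^ k else - ((1/4) ^ k))" for k
  have p0: "p 0 = 0" and pS: "p (Suc k) = p k + c k *\<^sub>R x k" for k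
    by (simp_all add: p_def c_def)
  have pM: "p k \<in> M" for k by (induction k) (auto simp: p0 pS x add_mem scaleR_mem)
  have c: "\<bar>c k\<bar> = (1/4) ^ k" for k by (simp add: c_def)
  \<comment> \<open>The partial sum of the geometric series from index \<open>k\<close> on; the
    whole tail is 4/3 of its first term.\<close>
  have diff: "norm (p (k + m) - p k) \<le> 4/3 * (1/4) ^ k * (1 - (1/4) ^ m)" for k m
  proof (induction m)
    case (Suc m)
    have "norm (p (k + Suc m) - p k) = norm ((p (k + m) - p k) + c (k + m) *\<^sub>R x (k + m))"
      by (simp add: pS algebra_simps)
    also have "\<dots> \<le> 4/3 * (1/4) ^ k * (1 - (1/4) ^ m) + (1/4) ^ (k + m)"
      using Suc by (intro norm_triangle_mono) (simp_all add: c x)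
    also have "\<dots> = 4/3 * (1/4) ^ k * (1 - (1/4) ^ Suc m)" by (simp add: power_add field_simps)
    finally show ?case .
  qed simp
  have diff': "norm (p n - p k) \<le> 4/3 * (1/4) ^ k" if "k \<le> n" for n k
  proof -
    have "norm (p n - p k) \<le> 4/3 * (1/4) ^ k * (1 - (1/4) ^ (n - k))" using diff[of k "n - k"] that by simp
    also have "\<dots> \<le> 4/3 * (1/4) ^ k * 1" by (intro mult_left_mono) auto
    finally show ?thesis by simp
  qed
  have "Cauchy p"
  proof (rule metric_CauchyI)
    fix e :: real assume "0 < e"
    then obtain k where k: "(1/4) ^ k < e / (8/3)"
      using real_arch_pow_inv[of "e / (8/3)" "1/4"] by auto
    have "dist (p m) (p n) < e" if "k \<le> m" "k \<le> n" for m n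
    proof -
      have "dist (p m) (p n) \<le> norm (p m - p k) + norm (p n - p k)"
        by (metis dist_norm dist_triangle2)
      also have "\<dots> \<le> 4/3 * (1/4) ^ k + 4/3 * (1/4) ^ k" using diff' that by (intro add_mono) auto
      finally show ?thesis using k by simp
    qed
    then show "\<exists>k. \<forall>m\<ge>k. \<forall>n\<ge>k. dist (p m) (p n) < e" by blast
  qed
  then obtain y where y: "y \<in> M" "p \<longlonglongrightarrow> y" using Cauchy_lim pM by blast
  have tail: "norm (y - p k) \<le> 4/3 * (1/4) ^ k" for k
  proof (rule LIMSEQ_le_const2)
    show "(\<lambda>n. norm (p n - p k)) \<longlonglongrightarrow> norm (y - p k)" by (intro tendsto_intros y)
  qed (use diff' in blast)
  \<comment> \<open>The summands after the k-th can destroy at most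
    \<open>4/3 * (1/4) ^ Suc k\<close>, a third of what the k-th achieved.\<close>
  have "(2/3) * (1/4) ^ k \<le> cmod (cinner y (x k))" for k
  proof -
    have "(1/4) ^ k \<le> cmod (cinner (p (Suc k)) (x k))"
    proof -
      let ?a = "cinner (p k) (x k)" and ?b = "complex_of_real ((1/4) ^ k)"
      have eq: "cinner (p (Suc k)) (x k) = ?a + complex_of_real (c k)"
        by (simp add: pS cinner_algebra scaleR_scaleC cinner_self x)
      have "2 * (1/4) ^ k = cmod ((?a + ?b) - (?a - ?b))" by (simp add: norm_mult norm_power)
      also have "\<dots> \<le> cmod (?a + ?b) + cmod (?a - ?b)" by (rule norm_triangle_ineq4)
      finally show ?thesis unfolding eq c_def by auto
    qed
    also have "cinner (p (Suc k)) (x k) = cinner y (x k) - cinner (y - p (Suc k)) (x k)"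
      by (simp add: cinner_algebra)
    also have "cmod \<dots> \<le> cmod (cinner y (x k)) + norm (y - p (Suc k)) * norm (x k)"
      by (rule order_trans[OF norm_triangle_ineq4]) (intro add_left_mono cinner_Cauchy_Schwarz)
    also have "\<dots> \<le> cmod (cinner y (x k)) + (1/3) * (1/4) ^ k" using tail[of "Suc k"] by (simp add: x)
    finally show ?thesis by simp
  qed
  with y(1) show ?thesis by blast
qed

text \<open>By normality the adjoints of the shifted operators are as small at \<open>x k\<close> as
  the operators themselves. If \<open>y\<close> were a sum of elements of their ranges, its
  coefficient against \<open>x k\<close> would be of order \<open>(1/5) ^ k\<close>, but it is of
  order \<open>(1/4) ^ k\<close>; any ratio below 1/4 would serve in place of 1/5.\<close>

lemma approx_eigenvalue_taylor:
  assumes R: "\<And>j. j \<in> {1..d} \<Longrightarrow> normal_op M (R j)" and z: "z \<in> {1..d} \<rightarrow>\<^sub>E UNIV"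
    and null: "approx_null ((\<lambda>j. shift (R j) (z j)) ` {1..d})"
  shows "z \<in> taylor_spectrum d M R"
proof (rule ccontr)
  define T where "T = (\<lambda>i. shift (R i) (z i))"
  assume "z \<notin> taylor_spectrum d M R"
  then have exact: "koszul_exact d M T"
    using z by (simp add: taylor_spectrum_def T_def shift_def)
  have TN: "normal_op M (T i)" and TB: "T i \<in> bops M" if "i \<in> {1..d}" for i
    using normal_shift[OF R[OF that]] by (auto simp: T_def normal_op_def)
  have "\<forall>k. \<exists>x\<in>M. norm x = 1 \<and> (\<forall>i\<in>{1..d}. norm (T i x) \<le> (1/5) ^ k)"
    using null by (auto simp: approx_null_def T_def)
  then obtain x where x: "\<And>k. x k \<in> M" "\<And>k. norm (x k) = 1"
    "\<And>i k. i \<in> {1..d} \<Longrightarrow> norm (T i (x k)) \<le> (1/5) ^ k" by metis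
  obtain y where y: "y \<in> M" "\<And>k. (2/3) * (1/4) ^ k \<le> cmod (cinner y (x k))"
    using gliding_hump[of x] x by blast
  obtain v where v: "\<And>i. i \<in> {1..d} \<Longrightarrow> v i \<in> M" "y = (\<Sum>i\<in>{1..d}. T i (v i))"
    using koszul_exact_surj[OF TB exact y(1)] by blast
  define C where "C = (\<Sum>i\<in>{1..d}. norm (v i))"
  have "(2/3) * (5/4) ^ k \<le> C" for k
  proof -
    have "cmod (cinner y (x k)) = cmod (cinner (x k) y)" by (subst cinner_commute) simp
    also have "cinner (x k) y = (\<Sum>i\<in>{1..d}. cinner (adj M (T i) (x k)) (v i))"
      unfolding v(2) cinner_sum_right using v(1) x(1) TB by (intro sum.cong) (auto simp: cinner_adj_left)
    also have "cmod \<dots> \<le> (\<Sum>i\<in>{1..d}. (1/5) ^ k * norm (v i))"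
    proof (rule sum_norm_le)
      fix i assume i: "i \<in> {1..d}"
      have "cmod (cinner (adj M (T i) (x k)) (v i)) \<le> norm (adj M (T i) (x k)) * norm (v i)"
        by (rule cinner_Cauchy_Schwarz)
      also have "\<dots> \<le> (1/5) ^ k * norm (v i)"
        using x i by (intro mult_right_mono) (simp_all add: norm_normal_adj[OF TN[OF i] x(1)])
      finally show "cmod (cinner (adj M (T i) (x k)) (v i)) \<le> (1/5) ^ k * norm (v i)" .
    qed
    also have "\<dots> = (1/5) ^ k * C" by (simp add: C_def sum_distrib_left)
    finally have "(2/3) * (1/4) ^ k \<le> (1/5) ^ k * C" using y(2)[of k] by simp
    then have "5 ^ k * ((2/3) * (1/4) ^ k) \<le> 5 ^ k * ((1/5) ^ k * C)" by (intro mult_left_mono) auto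
    then show ?thesis by (simp add: power_divide field_simps)
  qed
  then have le: "2 * (5/4) ^ k \<le> C * 3" for k by (simp add: field_simps)
  obtain k where "C * (3/2) < (5/4 :: real) ^ k"
    using real_arch_pow[of "5/4" "C * (3/2)"] by auto
  with le[of k] show False by simp
qed

end

subsection \<open>Unitary modules\<close>

lemma elem_sym_top: "elem_sym d d z = (\<Prod>j\<in>{1..d}. z j)"
proof -
  have "{J. J \<subseteq> {1..d} \<and> card J = d} = {{1..d}}"
    using card_subset_eq[of "{1..d}"] by auto
  then show ?thesis by (simp add: elem_sym_def)
qed

text \<open>On the torus, conjugating the product over \<open>J\<close> and multiplying by the full
  product gives the product over the complement of \<open>J\<close>. Complementation is a bijection
  between the subsets of size \<open>k\<close> and those of size \<open>d - k\<close>.\<close>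

lemma elem_sym_complement:
  assumes z: "\<And>j. j \<in> {1..d} \<Longrightarrow> cmod (z j) = 1" and k: "k \<le> d"
  shows "cnj (elem_sym d k z) * elem_sym d d z = elem_sym d (d - k) z"
proof -
  have compl: "cnj (\<Prod>j\<in>J. z j) * (\<Prod>j\<in>{1..d}. z j) = (\<Prod>j\<in>{1..d} - J. z j)" if J: "J \<subseteq> {1..d}" for J
  proof -
    have "cnj (\<Prod>j\<in>J. z j) * (\<Prod>j\<in>J. z j) = (\<Prod>j\<in>J. cnj (z j) * z j)"
      by (simp add: prod.distrib)
    also have "\<dots> = 1"
      using J z by (intro prod.neutral) (auto simp: mult.commute[of "cnj _"] mult_cnj_self)
    finally have "cnj (\<Prod>j\<in>J. z j) * (\<Prod>j\<in>J. z j) = 1" .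
    moreover have "(\<Prod>j\<in>{1..d}. z j) = (\<Prod>j\<in>{1..d} - J. z j) * (\<Prod>j\<in>J. z j)"
      by (rule prod.subset_diff[OF J]) simp
    ultimately show ?thesis by (metis (no_types, lifting) mult.commute mult.assoc mult_1)
  qed
  have "cnj (elem_sym d k z) * elem_sym d d z
      = (\<Sum>J | J \<subseteq> {1..d} \<and> card J = k. \<Prod>j\<in>{1..d} - J. z j)"
    unfolding elem_sym_top unfolding elem_sym_def cnj_sum sum_distrib_right
    by (rule sum.cong) (use compl in auto)
  also have "\<dots> = elem_sym d (d - k) z"
    unfolding elem_sym_def
    by (rule sum.reindex_bij_witness[of _ "\<lambda>J. {1..d} - J" "\<lambda>J. {1..d} - J"])
      (use k in \<open>auto simp: double_diff card_Diff_subset finite_subset\<close>)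
  finally show ?thesis .
qed

text \<open>The last coordinate is the product of numbers of modulus at most 1, so it can have
  modulus 1 only if all of them do.\<close>

lemma dist_boundary_relations:
  assumes s: "s \<in> dist_boundary d" and k: "k \<in> {1..d - 1}"
  shows "cnj (s k) * s d = s (d - k)"
proof -
  from s obtain z where "z \<in> {1..d} \<rightarrow>\<^sub>E cball 0 1" and z2: "s = (\<lambda>k\<in>{1..d}. elem_sym d k z)"
    and sd: "cmod (s d) = 1"
    unfolding dist_boundary_def sym_polydisc_def by blast
  then have z1: "\<And>j. j \<in> {1..d} \<Longrightarrow> cmod (z j) \<le> 1" by (auto simp: PiE_iff)
  note z = z1 z2
  have d: "d \<in> {1..d}" "k \<in> {1..d}" "d - k \<in> {1..d}" "k \<le> d" using k by auto
  have prod1: "(\<Prod>j\<in>{1..d}. cmod (z j)) = 1"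
    using sd d(1) by (simp add: z(2) elem_sym_top prod_norm)
  have "cmod (z j) = 1" if j: "j \<in> {1..d}" for j
  proof -
    have "1 = cmod (z j) * (\<Prod>j\<in>{1..d} - {j}. cmod (z j))"
      using j prod1 by (simp add: prod.remove[of _ j])
    also have "\<dots> \<le> cmod (z j) * 1"
      using z(1) by (intro mult_left_mono prod_le_1) auto
    finally show ?thesis using z(1)[OF j] by simp
  qed
  from elem_sym_complement[OF this d(4)] d show ?thesis by (simp add: z(2))
qed

context closed_csubspace
begin

lemma approx_null_empty: "x \<in> M \<Longrightarrow> x \<noteq> 0 \<Longrightarrow> approx_null {}"
  unfolding approx_null_def by (auto intro!: bexI[of _ "(1 / norm x) *\<^sub>R x"] scaleR_mem)

text \<open>The hypothesis \<open>small\<close> expresses that \<open>D\<close>, regarded as a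
  function of the tuple, vanishes at the points of the spectrum. If \<open>D\<close> were nonzero,
  there would be approximate eigenvectors of \<open>D^* D\<close> for some \<open>s^2 > 0\<close>;
  refining them to joint ones for \<open>R\<close> yields a spectral point near which
  \<open>D\<close> is not small.\<close>

lemma vanishes_on_taylor_spectrum:
  assumes R: "\<And>j. j \<in> {1..d} \<Longrightarrow> normal_op M (R j)"
    and comm: "\<And>i j. i \<in> {1..d} \<Longrightarrow> j \<in> {1..d} \<Longrightarrow> R i \<circ> R j = R j \<circ> R i"
    and D: "normal_op M D" "\<And>j. j \<in> {1..d} \<Longrightarrow> R j \<circ> D = D \<circ> R j"
    and small: "\<And>z e. z \<in> taylor_spectrum d M R \<Longrightarrow> 0 < e \<Longrightarrow> \<exists>\<delta>>0. \<forall>x\<in>M. norm x = 1 \<longrightarrow>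
      (\<forall>j\<in>{1..d}. norm (shift (R j) (z j) x) \<le> \<delta>) \<longrightarrow> norm (D x) \<le> e"
    and x: "x \<in> M"
  shows "D x = 0"
proof (rule ccontr)
  have DB: "D \<in> bops M" using D(1) by (simp add: normal_op_def)
  have RB: "R j \<in> bops M" if "j \<in> {1..d}" for j using R[OF that] by (simp add: normal_op_def)
  assume Dx: "D x \<noteq> 0"
  then have x0: "x \<noteq> 0" using bops_zero[OF DB] by auto
  obtain s where s: "0 \<le> s" "approx_null {square_shift D s}"
    "\<And>x. x \<in> M \<Longrightarrow> norm x = 1 \<Longrightarrow> norm (D x) \<le> s"
    using approx_null_square[OF D(1) _ _ approx_null_empty[OF x x0]] by auto
  have "norm (D ((1 / norm x) *\<^sub>R x)) \<le> s" using x x0 by (intro s(3) scaleR_mem) auto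
  then have "norm (D x) \<le> s * norm x" using x0 by (simp add: bops_scaleR[OF DB x] field_simps)
  then have "s \<noteq> 0" using Dx by auto
  then have s_pos: "0 < s\<^sup>2" by simp
  have "\<exists>z. approx_null ({square_shift D s} \<union> (\<lambda>j. shift (R j) (z j)) ` {1..d})"
  proof (rule joint_approx_eigenvalue)
    show "T \<circ> R j = R j \<circ> T" if T: "T \<in> {square_shift D s}" and j: "j \<in> {1..d}" for T j
    proof -
      have "R j \<circ> adj M D = adj M D \<circ> R j" by (rule Fuglede[OF D(1) RB[OF j] D(2)[OF j]])
      then have "R j \<circ> (adj M D \<circ> D) = (adj M D \<circ> D) \<circ> R j"
        using D(2)[OF j] by (simp add: fun_eq_iff)
      then have "R j \<circ> square_shift D s = square_shift D s \<circ> R j"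
        unfolding square_shift_def by (intro shift_commute comp_bops adj_bops DB RB j)
      then show ?thesis using T by simp
    qed
  qed (use R comm square_shift_bops[OF DB] s(2) in auto)
  then obtain z where z: "approx_null ({square_shift D s} \<union> (\<lambda>j. shift (R j) (z j)) ` {1..d})" ..
  \<comment> \<open>Points of the spectrum are extensional on the index set; only the values of
    \<open>z\<close> there matter.\<close>
  define w where "w = restrict z {1..d}"
  have img: "(\<lambda>j. shift (R j) (w j)) ` {1..d} = (\<lambda>j. shift (R j) (z j)) ` {1..d}"
    by (rule image_cong) (auto simp: w_def)
  have "approx_null ((\<lambda>j. shift (R j) (w j)) ` {1..d})"
    unfolding img using z unfolding approx_null_def by (meson UnCI)
  then have wT: "w \<in> taylor_spectrum d M R"
    by (intro approx_eigenvalue_taylor R) (auto simp: w_def)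
  \<comment> \<open>Makes \<open>D^* D y\<close> of norm at most \<open>s^2 / 4\<close>, while it
    lies within \<open>s^2 / 4\<close> of \<open>s^2\<close> times a unit vector.\<close>
  define e where "e = s\<^sup>2 / (4 * (onorm D + 1))"
  have \<nu>: "0 \<le> onorm D" using onorm_nonneg[OF DB] .
  then have e: "0 < e" using s_pos by (simp add: e_def)
  from small[OF wT e] obtain \<delta> where \<delta>: "0 < \<delta>" "\<And>x. x \<in> M \<Longrightarrow> norm x = 1 \<Longrightarrow>
      (\<forall>j\<in>{1..d}. norm (shift (R j) (w j) x) \<le> \<delta>) \<Longrightarrow> norm (D x) \<le> e" by blast
  define \<eta> where "\<eta> = min \<delta> (s\<^sup>2 / 4)"
  have "0 < \<eta>" using \<delta>(1) s_pos by (simp add: \<eta>_def)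
  then obtain y where y: "y \<in> M" "norm y = 1"
    "\<forall>T\<in>{square_shift D s} \<union> (\<lambda>j. shift (R j) (w j)) ` {1..d}. norm (T y) \<le> \<eta>"
    using z unfolding img[symmetric] approx_null_def by blast
  then have y': "norm (square_shift D s y) \<le> s\<^sup>2 / 4" "\<forall>j\<in>{1..d}. norm (shift (R j) (w j) y) \<le> \<delta>"
    by (auto simp: \<eta>_def)
  have "s\<^sup>2 = norm (complex_of_real (s\<^sup>2) *\<^sub>C y)" by (simp add: y(2) norm_power)
  also have "complex_of_real (s\<^sup>2) *\<^sub>C y = adj M D (D y) - square_shift D s y"
    by (simp add: square_shift_def shift_apply y(1))
  also have "norm \<dots> \<le> norm (adj M D (D y)) + norm (square_shift D s y)" by (rule norm_triangle_ineq4)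
  also have "norm (adj M D (D y)) \<le> onorm D * norm (D y)"
    using norm_le_onorm[OF adj_bops[OF DB], of "D y"] DB by simp
  also have "\<dots> \<le> (onorm D + 1) * e"
    using \<delta>(2)[OF y(1,2) y'(2)] \<nu> by (intro mult_mono) auto
  also have "\<dots> = s\<^sup>2 / 4" using \<nu> by (simp add: e_def field_simps)
  finally have "s\<^sup>2 \<le> s\<^sup>2 / 4 + s\<^sup>2 / 4" using y'(1) by linarith
  with s_pos show False by simp
qed

lemma norm_adj_shift:
  assumes "normal_op M N" "x \<in> M"
  shows "norm (adj M N x - cnj c *\<^sub>C x) = norm (shift N c x)"
  using norm_normal_adj[OF normal_shift[OF assms(1)] assms(2)] adj_shift[OF assms] by simp

lemma unitary_module_star_commute:
  assumes um: "unitary_module d M R" and i: "i \<in> {1..d}" and j: "j \<in> {1..d}" and x: "x \<in> M"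
  shows "R i (R j x) = R j (R i x)" "adj M (R i) (R j x) = R j (adj M (R i) x)"
    "adj M (R i) (adj M (R j) x) = adj M (R j) (adj M (R i) x)"
proof -
  have N: "normal_op M (R i)" "normal_op M (R j)" and c: "R i \<circ> R j = R j \<circ> R i"
    using um i j by (auto simp: unitary_module_def contractive_module_def hilbert_module_def)
  have B: "R i \<in> bops M" "R j \<in> bops M" using N by (auto simp: normal_op_def)
  show "R i (R j x) = R j (R i x)" using c by (metis comp_apply)
  show "adj M (R i) (R j x) = R j (adj M (R i) x)"
    using Fuglede[OF N(1) B(2) c[symmetric]] by (metis comp_apply)
  show "adj M (R i) (adj M (R j) x) = adj M (R j) (adj M (R i) x)"
    using adj_comp[OF B] adj_comp[OF B(2,1)] c by (metis comp_apply)
qed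

theorem unitary_module_relations:
  assumes d: "1 \<le> d" and um: "unitary_module d M R" and x: "x \<in> M"
  shows "adj M (R d) (R d x) = x" "R d (adj M (R d) x) = x"
    and "i \<in> {1..d - 1} \<Longrightarrow> adj M (R i) (R d x) = R (d - i) x"
proof -
  have N: "normal_op M (R j)" and c: "R k \<circ> R j = R j \<circ> R k"
    if "j \<in> {1..d}" "k \<in> {1..d}" for j k
    using um that by (auto simp: unitary_module_def contractive_module_def hilbert_module_def)
  have RB: "R j \<in> bops M" if "j \<in> {1..d}" for j using N[OF that that] by (simp add: normal_op_def)
  have AB: "adj M (R j) \<in> bops M" if "j \<in> {1..d}" for j using RB[OF that] by (rule adj_bops)
  note star = unitary_module_star_commute[OF um]
  have bdry: "z \<in> dist_boundary d" if "z \<in> taylor_spectrum d M R" for z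
    using um that by (auto simp: unitary_module_def)
  have dd: "d \<in> {1..d}" using d by simp
  have mem: "R j y \<in> M" "adj M (R j) y \<in> M" if "j \<in> {1..d}" for j y
    using RB[OF that] AB[OF that] by (auto simp: bops_mem)
  \<comment> \<open>Reading \<open>R 0\<close> as the identity lets one formula cover both kinds of
    relation: \<open>k = d\<close> concerns the unitarity of the last entry, \<open>k < d\<close>
    the adjoints of the others.\<close>
  define D where "D k = (\<lambda>x. adj M (R k) (R d x) - (if k = d then id_op M x else R (d - k) x))" for k
  have Dzero: "D k x = 0" if k: "k \<in> {1..d}" for k
  proof -
    define Q where "Q = (if k = d then id_op M else R (d - k))"
    have dk: "d - k \<in> {1..d}" if "k \<noteq> d" using k that by auto
    have QB: "Q \<in> bops M" using RB[OF dk] by (auto simp: Q_def)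
    have Qmem: "Q y \<in> M" "adj M Q y \<in> M" for y using QB by (auto simp: bops_mem adj_bops)
    have Q: "Q (R j y) = R j (Q y)" "Q (adj M (R j) y) = adj M (R j) (Q y)"
      if "j \<in> {1..d}" "y \<in> M" for j y
      using star[OF dk that(1,2)] star[OF that(1) dk that(2)] mem that by (auto simp: Q_def)
    have D: "D k = (\<lambda>x. (adj M (R k) \<circ> R d) x - Q x)" by (auto simp: D_def Q_def)
    have DB: "D k \<in> bops M" unfolding D by (intro diff_bops comp_bops AB RB QB k dd)
    have DR: "D k (R j y) = R j (D k y)" "D k (adj M (R j) y) = adj M (R j) (D k y)"
      if j: "j \<in> {1..d}" and y: "y \<in> M" for j y
    proof -
      show "D k (R j y) = R j (D k y)"
        by (simp add: D Q[OF j y] star(1)[OF dd j y] star(2)[OF k j] mem[OF dd] mem[OF k] mem[OF j]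
            Qmem bops_diff[OF RB[OF j]])
      show "D k (adj M (R j) y) = adj M (R j) (D k y)"
        by (simp add: D Q[OF j y] star(2)[OF j dd y, symmetric] star(3)[OF k j] mem[OF dd] mem[OF k] mem[OF j]
            Qmem bops_diff[OF AB[OF j]])
    qed
    have adjD: "adj M (D k) = (\<lambda>x. (adj M (R d) \<circ> R k) x - adj M Q x)"
      unfolding D adj_diff[OF comp_bops[OF AB[OF k] RB[OF dd]] QB]
        adj_comp[OF AB[OF k] RB[OF dd]] adj_adj[OF RB[OF k]] ..
    have adjQ: "D k (adj M Q y) = adj M Q (D k y)" if "y \<in> M" for y
      using that DR[OF dk] bops_mem[OF DB, of y] by (auto simp: Q_def)
    have "adj M (D k) \<circ> D k = D k \<circ> adj M (D k)"
    proof (rule bops_eqI)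
      fix y assume y: "y \<in> M"
      show "(adj M (D k) \<circ> D k) y = (D k \<circ> adj M (D k)) y"
        unfolding adjD
        by (simp add: bops_diff[OF DB] DR[OF dd] DR[OF k y] mem[OF k] mem[OF dd] Qmem adjQ[OF y])
    qed (intro comp_bops adj_bops DB)+
    then have DN: "normal_op M (D k)" using DB by (simp add: normal_op_def)
    show ?thesis
    proof (rule vanishes_on_taylor_spectrum[OF _ _ DN _ _ x])
      show "normal_op M (R j)" if "j \<in> {1..d}" for j using N[OF that that] .
      show "R k \<circ> R j = R j \<circ> R k" if "k \<in> {1..d}" "j \<in> {1..d}" for j k using c that by blast
      show "R j \<circ> D k = D k \<circ> R j" if "j \<in> {1..d}" for j
        by (rule bops_eqI) (auto simp: DR[OF that] intro: comp_bops DB RB that)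
      fix z and e :: real assume z: "z \<in> taylor_spectrum d M R" and e: "0 < e"
      define q where "q = (if k = d then 1 else z (d - k))"
      have zd: "cmod (z d) = 1" using bdry[OF z] by (simp add: dist_boundary_def)
      have rel: "cnj (z k) * z d = q"
      proof (cases "k = d")
        case True then show ?thesis using zd by (simp add: q_def mult.commute[of "cnj _"] mult_cnj_self)
      next
        case False
        then have "k < d" using k by simp
        then have "k \<in> {1..d - 1}" using k by auto
        then show ?thesis using dist_boundary_relations[OF bdry[OF z]] False by (simp add: q_def)
      qed
      define \<nu> where "\<nu> = onorm (R k)"
      have \<nu>: "0 \<le> \<nu>" using onorm_nonneg[OF RB[OF k]] by (simp add: \<nu>_def)
      show "\<exists>\<delta>>0. \<forall>x\<in>M. norm x = 1 \<longrightarrow> (\<forall>j\<in>{1..d}. norm (shift (R j) (z j) x) \<le> \<delta>) \<longrightarrow> norm (D k x) \<le> e"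
      \<comment> \<open>\<open>D k y\<close> is a sum of three errors: one is amplified by at most
        \<open>\<nu>\<close>, the other two by 1.\<close>
      proof (intro exI[of _ "e / (\<nu> + 2)"] conjI ballI impI)
        show "0 < e / (\<nu> + 2)" using e \<nu> by simp
        fix y assume y: "y \<in> M" "norm y = 1" and sm: "\<forall>j\<in>{1..d}. norm (shift (R j) (z j) y) \<le> e / (\<nu> + 2)"
        have Qs: "norm (Q y - q *\<^sub>C y) \<le> e / (\<nu> + 2)"
          using sm dk y e \<nu> by (cases "k = d") (auto simp: Q_def q_def shift_apply)
        have "D k y = adj M (R k) (R d y - z d *\<^sub>C y) + z d *\<^sub>C (adj M (R k) y - cnj (z k) *\<^sub>C y) - (Q y - q *\<^sub>C y)"
          by (simp add: D bops_diff[OF AB[OF k]] bops_scale[OF AB[OF k]] y mem[OF dd] scale_mem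
              scaleC_diff_right rel[symmetric] mult.commute)
        also have "norm \<dots> \<le> norm (adj M (R k) (R d y - z d *\<^sub>C y))
            + norm (z d *\<^sub>C (adj M (R k) y - cnj (z k) *\<^sub>C y)) + norm (Q y - q *\<^sub>C y)"
          by (intro order_trans[OF norm_triangle_ineq4] add_right_mono norm_triangle_ineq)
        also have "norm (adj M (R k) (R d y - z d *\<^sub>C y)) \<le> \<nu> * norm (shift (R d) (z d) y)"
          using norm_le_onorm[OF AB[OF k]] RB[OF k] by (simp add: \<nu>_def shift_apply y(1))
        also have "\<dots> \<le> \<nu> * (e / (\<nu> + 2))" using sm dd \<nu> by (intro mult_left_mono) auto
        also have "norm (z d *\<^sub>C (adj M (R k) y - cnj (z k) *\<^sub>C y)) \<le> e / (\<nu> + 2)"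
          using sm k by (simp add: zd norm_adj_shift[OF N[OF k k] y(1)])
        finally have "norm (D k y) \<le> \<nu> * (e / (\<nu> + 2)) + e / (\<nu> + 2) + e / (\<nu> + 2)" using Qs by linarith
        also have "\<dots> = (\<nu> + 2) * (e / (\<nu> + 2))" by (simp add: ring_distribs add_divide_distrib)
        also have "\<dots> = e" using \<nu> by simp
        finally show "norm (D k y) \<le> e" .
      qed
    qed
  qed
  show U: "adj M (R d) (R d x) = x" using Dzero[OF dd] x by (simp add: D_def)
  show "R d (adj M (R d) x) = x" using U star(2)[OF dd dd x] by simp
  show "adj M (R i) (R d x) = R (d - i) x" if "i \<in> {1..d - 1}"
    using Dzero[of i] that by (auto simp: D_def)
qed

end

subsection \<open>Unitary extensions of isometric modules\<close>

lemma closure_csubspace: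
  assumes "csubspace (N :: 'a::chilbert_space set)"
  shows "hilbert_subspace (closure N)"
proof -
  have N: "0 \<in> N" "\<And>x y. x \<in> N \<Longrightarrow> y \<in> N \<Longrightarrow> x + y \<in> N" "\<And>c x. x \<in> N \<Longrightarrow> c *\<^sub>C x \<in> N"
    using assms by (auto simp: csubspace_iff)
  have "x + y \<in> closure N" if xy: "x \<in> closure N" "y \<in> closure N" for x y
  proof -
    obtain f g where f: "\<And>n. f n \<in> N" "f \<longlonglongrightarrow> x" and g: "\<And>n. g n \<in> N" "g \<longlonglongrightarrow> y"
      using xy unfolding closure_sequential by blast
    then show ?thesis unfolding closure_sequential
      by (intro exI[of _ "\<lambda>n. f n + g n"]) (auto intro: N tendsto_add)
  qed
  moreover have "c *\<^sub>C x \<in> closure N" if x: "x \<in> closure N" for c x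
  proof -
    obtain f where f: "\<And>n. f n \<in> N" "f \<longlonglongrightarrow> x"
      using x unfolding closure_sequential by blast
    then show ?thesis unfolding closure_sequential
      by (intro exI[of _ "\<lambda>n. c *\<^sub>C f n"]) (auto intro: N tendsto_scaleC)
  qed
  ultimately show ?thesis
    using N(1) closure_subset[of N] by (auto simp: hilbert_subspace_def csubspace_iff)
qed

lemma (in closed_csubspace) bops_closure:
  assumes A: "A \<in> bops M" and N: "N \<subseteq> M" "A ` N \<subseteq> N" and x: "x \<in> closure N"
  shows "A x \<in> closure N"
proof -
  obtain f where f: "\<And>n. f n \<in> N" "f \<longlonglongrightarrow> x" using x unfolding closure_sequential by blast
  then have "(\<lambda>n. A (f n)) \<longlonglongrightarrow> A x" using N by (intro bops_tendsto[OF A]) auto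
  then show ?thesis unfolding closure_sequential
    using f N by (intro exI[of _ "\<lambda>n. A (f n)"]) auto
qed

text \<open>\<open>V\<close> is kept explicit, and \<open>K\<close> may lie in another type than
  \<open>H\<close>, so that the results apply to every embedding. The operators \<open>S i\<close>
  get an assumption of their own because the embedding speaks only of the images under
  \<open>V\<close> of their values on \<open>H\<close>.\<close>

locale isometric_extension =
  fixes d :: nat and H :: "'a::chilbert_space set" and S :: "nat \<Rightarrow> 'a \<Rightarrow> 'a"
    and K :: "'b::chilbert_space set" and R :: "nat \<Rightarrow> 'b \<Rightarrow> 'b" and V :: "'a \<Rightarrow> 'b"
  assumes d2: "2 \<le> d" and H_subspace: "hilbert_subspace H"
    and S_bops: "i \<in> {1..d} \<Longrightarrow> S i \<in> bops H"
    and unitary: "unitary_module d K R" and embedding: "isometric_embedding d H S K R V"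
begin

sublocale H: closed_csubspace H by unfold_locales (rule H_subspace)

sublocale K: closed_csubspace K
  using unitary by unfold_locales
    (simp add: unitary_module_def contractive_module_def hilbert_module_def)

section \<open>The unitary last entry, its powers, and their relations with the other
  entries\<close>

abbreviation U where "U \<equiv> R d"
abbreviation Us where "Us \<equiv> adj K (R d)"
abbreviation P where "P \<equiv> S d"

lemma d_mem [simp]: "d \<in> {1..d}" and d_ge [simp]: "Suc 0 \<le> d" "0 < d"
  using d2 by auto

lemma R_bops: "i \<in> {1..d} \<Longrightarrow> R i \<in> bops K"
  using unitary by (auto simp: unitary_module_def normal_op_def)

lemma Us_bops: "Us \<in> bops K" by (intro K.adj_bops R_bops) simp

lemma R_mem: "i \<in> {1..d} \<Longrightarrow> R i x \<in> K"
  using R_bops by (simp add: K.bops_mem)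

lemma Us_mem [simp]: "Us x \<in> K" and U_mem [simp]: "U x \<in> K"
  using Us_bops R_bops[OF d_mem] by (simp_all add: K.bops_mem)

lemma U_Us [simp]: "x \<in> K \<Longrightarrow> U (Us x) = x" and Us_U [simp]: "x \<in> K \<Longrightarrow> Us (U x) = x"
  using K.unitary_module_relations(1,2)[OF _ unitary] d2 by auto

lemma R_commute: "i \<in> {1..d} \<Longrightarrow> j \<in> {1..d} \<Longrightarrow> x \<in> K \<Longrightarrow> R i (R j x) = R j (R i x)"
  by (rule K.unitary_module_star_commute[OF unitary])

lemma R_Us: "i \<in> {1..d} \<Longrightarrow> x \<in> K \<Longrightarrow> R i (Us x) = Us (R i x)"
  by (rule K.unitary_module_star_commute(2)[OF unitary, symmetric]) auto

lemma adj_R: "i \<in> {1..d - 1} \<Longrightarrow> x \<in> K \<Longrightarrow> adj K (R i) x = R (d - i) (Us x)"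
  using K.unitary_module_relations(3)[OF _ unitary, of "Us x" i] d2 by simp

lemma adj_R_U: "i \<in> {1..d - 1} \<Longrightarrow> x \<in> K \<Longrightarrow> adj K (R i) (U x) = R (d - i) x"
  using K.unitary_module_relations(3)[OF _ unitary, of x i] d2 by simp

lemma U_pow_mem [simp]: "x \<in> K \<Longrightarrow> (U ^^ m) x \<in> K" and Us_pow_mem [simp]: "x \<in> K \<Longrightarrow> (Us ^^ m) x \<in> K"
  by (induction m) simp_all

lemma U_pow_Us_pow [simp]: "x \<in> K \<Longrightarrow> (U ^^ m) ((Us ^^ m) x) = x"
proof (induction m)
  case (Suc m)
  have "(U ^^ Suc m) ((Us ^^ Suc m) x) = (U ^^ m) (U (Us ((Us ^^ m) x)))"
    unfolding funpow_Suc_right[of m U] by simp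
  with Suc show ?case by simp
qed simp

lemma Us_pow_U_pow [simp]: "x \<in> K \<Longrightarrow> (Us ^^ m) ((U ^^ m) x) = x"
proof (induction m)
  case (Suc m)
  have "(Us ^^ Suc m) ((U ^^ Suc m) x) = (Us ^^ m) (Us (U ((U ^^ m) x)))"
    unfolding funpow_Suc_right[of m Us] by simp
  with Suc show ?case by simp
qed simp

lemma cinner_Us_pow: "x \<in> K \<Longrightarrow> y \<in> K \<Longrightarrow> cinner ((Us ^^ m) x) y = cinner x ((U ^^ m) y)"
proof (induction m arbitrary: y)
  case (Suc m)
  have "cinner ((Us ^^ Suc m) x) y = cinner ((Us ^^ m) x) (U y)"
    using Suc.prems by (simp add: K.cinner_adj_left[OF R_bops[OF d_mem]])
  also have "\<dots> = cinner x ((U ^^ Suc m) y)"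
    unfolding funpow_Suc_right[of m U] using Suc by simp
  finally show ?case .
qed simp

lemma cinner_U_pow: "x \<in> K \<Longrightarrow> y \<in> K \<Longrightarrow> cinner ((U ^^ m) x) y = cinner x ((Us ^^ m) y)"
  by (metis cinner_Us_pow cinner_commute)

lemma norm_U_pow [simp]: "x \<in> K \<Longrightarrow> norm ((U ^^ m) x) = norm x"
proof -
  assume x: "x \<in> K"
  then have "cinner ((U ^^ m) x) ((U ^^ m) x) = cinner x x" by (simp add: cinner_U_pow)
  then show ?thesis by (metis Re_cinner_self norm_ge_zero power2_eq_iff_nonneg)
qed

lemma norm_Us_pow [simp]: "x \<in> K \<Longrightarrow> norm ((Us ^^ m) x) = norm x"
  by (metis Us_pow_mem norm_U_pow U_pow_Us_pow)

lemma R_U_pow: "i \<in> {1..d} \<Longrightarrow> x \<in> K \<Longrightarrow> R i ((U ^^ m) x) = (U ^^ m) (R i x)"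
  by (induction m) (simp_all add: R_commute[of i d])

lemma R_Us_pow: "i \<in> {1..d} \<Longrightarrow> x \<in> K \<Longrightarrow> R i ((Us ^^ m) x) = (Us ^^ m) (R i x)"
  by (induction m) (simp_all add: R_Us)

lemma U_pow_linear:
  assumes "x \<in> K"
  shows "y \<in> K \<Longrightarrow> (U ^^ m) (x + y) = (U ^^ m) x + (U ^^ m) y" "(U ^^ m) (c *\<^sub>C x) = c *\<^sub>C (U ^^ m) x"
  using assms
  by (induction m) (simp_all add: K.bops_add[OF R_bops[OF d_mem]] K.bops_scale[OF R_bops[OF d_mem]])

lemma Us_pow_linear:
  assumes "x \<in> K"
  shows "y \<in> K \<Longrightarrow> (Us ^^ m) (x + y) = (Us ^^ m) x + (Us ^^ m) y" "(Us ^^ m) (c *\<^sub>C x) = c *\<^sub>C (Us ^^ m) x"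
  using assms
  by (induction m) (simp_all add: K.bops_add[OF Us_bops] K.bops_scale[OF Us_bops])

section \<open>The embedding and its adjoint\<close>

lemma S_mem: "i \<in> {1..d} \<Longrightarrow> S i h \<in> H"
  using S_bops by (simp add: H.bops_mem)

lemma P_mem [simp]: "P h \<in> H" by (simp add: S_mem)

lemma P_pow_mem [simp]: "h \<in> H \<Longrightarrow> (P ^^ m) h \<in> H"
  by (induction m) simp_all

lemma V_mem [simp]: "h \<in> H \<Longrightarrow> V h \<in> K"
  and V_add: "h \<in> H \<Longrightarrow> h' \<in> H \<Longrightarrow> V (h + h') = V h + V h'"
  and V_scale: "h \<in> H \<Longrightarrow> V (c *\<^sub>C h) = c *\<^sub>C V h"
  and V_norm [simp]: "h \<in> H \<Longrightarrow> norm (V h) = norm h"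
  and V_S: "i \<in> {1..d} \<Longrightarrow> h \<in> H \<Longrightarrow> V (S i h) = R i (V h)"
  using embedding by (auto simp: isometric_embedding_def clinear_on_def)

lemma V_zero [simp]: "V 0 = 0" using V_scale[of 0 0] by simp

lemma V_diff: "h \<in> H \<Longrightarrow> h' \<in> H \<Longrightarrow> V (h - h') = V h - V h'"
  using V_add[of h "-h'"] V_scale[of h' "-1"] H.minus_mem[of h'] by simp

lemma V_inj: "h \<in> H \<Longrightarrow> h' \<in> H \<Longrightarrow> V h = V h' \<longleftrightarrow> h = h'"
  using V_diff[of h h'] V_norm[of "h - h'"] by (auto simp: H.diff_mem)

lemma V_P_pow: "h \<in> H \<Longrightarrow> V ((P ^^ m) h) = (U ^^ m) (V h)"
  by (induction m) (simp_all add: V_S)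

text \<open>Polarization: norms determine the real part, and replacing h' by
  \<open>\<i> *\<^sub>C h'\<close> gives the imaginary part.\<close>

lemma V_cinner: "h \<in> H \<Longrightarrow> h' \<in> H \<Longrightarrow> cinner (V h) (V h') = cinner h h'"
proof -
  have re: "Re (cinner (V h) (V h')) = Re (cinner h h')" if "h \<in> H" "h' \<in> H" for h h'
    using norm_add_sq[of "V h" "V h'"] norm_add_sq[of h h'] that
    by (simp flip: V_add add: H.add_mem)
  assume h: "h \<in> H" "h' \<in> H"
  have "Im (cinner (V h) (V h')) = Im (cinner h h')"
    using re[of h "\<i> *\<^sub>C h'"] h by (simp add: V_scale cinner_algebra H.scale_mem)
  with re[OF h] show ?thesis by (simp add: complex_eq_iff)
qed

text \<open>The adjoint of \<open>V\<close>. It maps between two different spaces, so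
  \<open>adj\<close> does not apply; the Riesz representation defines it on the whole type.\<close>

definition W :: "'b \<Rightarrow> 'a"
  where "W k = (THE y. y \<in> H \<and> (\<forall>h\<in>H. cinner (V h) k = cinner h y))"

lemma W_ex1: "\<exists>!y. y \<in> H \<and> (\<forall>h\<in>H. cinner (V h) k = cinner h y)"
proof (rule H.Riesz_representation[where B = "norm k"])
  show "cmod (cinner (V h) k) \<le> norm k * norm h" if "h \<in> H" for h
    using cinner_Cauchy_Schwarz[of "V h" k] that by (simp add: mult.commute)
qed (simp_all add: V_add V_scale cinner_algebra)

lemma W_mem [simp]: "W k \<in> H" and cinner_W_right: "h \<in> H \<Longrightarrow> cinner h (W k) = cinner (V h) k"
  using theI'[OF W_ex1[of k]] by (auto simp: W_def)

lemma cinner_W_left: "h \<in> H \<Longrightarrow> cinner (W k) h = cinner k (V h)"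
  by (metis cinner_W_right cinner_commute)

lemma W_add: "W (k + k') = W k + W k'"
  by (rule H.eqI_cinner) (auto simp: cinner_algebra cinner_W_left)

lemma W_scale: "W (c *\<^sub>C k) = c *\<^sub>C W k"
  by (rule H.eqI_cinner) (auto simp: cinner_algebra cinner_W_left)

lemma W_diff: "W (k - k') = W k - W k'"
  by (rule H.eqI_cinner) (auto simp: cinner_algebra cinner_W_left)

lemma W_V [simp]: "h \<in> H \<Longrightarrow> W (V h) = h"
  by (rule H.eqI_cinner) (auto simp: cinner_W_left V_cinner)

lemma norm_W: "norm (W k) \<le> norm k"
proof -
  have "norm (W k) * norm (W k) = cmod (cinner (V (W k)) k)"
    by (simp add: cinner_W_right[symmetric] cmod_cinner_self)
  also have "\<dots> \<le> norm (W k) * norm k" using cinner_Cauchy_Schwarz[of "V (W k)" k] by simp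
  finally show ?thesis by (cases "W k = 0") auto
qed

lemma tendsto_W: "f \<longlonglongrightarrow> k \<Longrightarrow> (\<lambda>n. W (f n)) \<longlonglongrightarrow> W k"
proof -
  assume "f \<longlonglongrightarrow> k"
  then have "(\<lambda>n. norm (f n - k)) \<longlonglongrightarrow> 0" by (simp add: LIM_zero_iff tendsto_norm_zero_iff)
  then have "(\<lambda>n. W (f n) - W k) \<longlonglongrightarrow> 0"
    by (rule Lim_null_comparison[rotated]) (auto simp: W_diff[symmetric] norm_W)
  then show ?thesis by (simp add: LIM_zero_iff)
qed

lemma tendsto_V: "(\<And>n. f n \<in> H) \<Longrightarrow> h \<in> H \<Longrightarrow> f \<longlonglongrightarrow> h \<Longrightarrow> (\<lambda>n. V (f n)) \<longlonglongrightarrow> V h"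
proof -
  assume f: "\<And>n. f n \<in> H" "h \<in> H" "f \<longlonglongrightarrow> h"
  then have "(\<lambda>n. norm (f n - h)) \<longlonglongrightarrow> 0" by (simp add: LIM_zero_iff tendsto_norm_zero_iff)
  then have "(\<lambda>n. V (f n) - V h) \<longlonglongrightarrow> 0"
    by (rule Lim_null_comparison[rotated]) (simp add: V_diff[symmetric] H.diff_mem f(1,2))
  then show ?thesis by (simp add: LIM_zero_iff)
qed

lemma range_V: "closed_csubspace (V ` H)"
proof
  have "closed (V ` H)"
    unfolding closed_sequential_limits
  proof clarify
    fix f l assume f: "\<forall>n. f n \<in> V ` H" "f \<longlonglongrightarrow> l"
    have "f n = V (W (f n))" for n
    proof -
      obtain h where "h \<in> H" "f n = V h" using f(1) by blast
      then show ?thesis by simp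
    qed
    moreover have "(\<lambda>n. V (W (f n))) \<longlonglongrightarrow> V (W l)" by (intro tendsto_V tendsto_W f) auto
    ultimately have "f \<longlonglongrightarrow> V (W l)" by simp
    then have "l = V (W l)" using f(2) LIMSEQ_unique by blast
    then show "l \<in> V ` H" by (metis W_mem imageI)
  qed
  moreover have "csubspace (V ` H)"
    unfolding csubspace_iff
    by (auto simp flip: V_add V_scale intro: H.add_mem H.scale_mem imageI image_eqI[of 0 V 0])
  ultimately show "hilbert_subspace (V ` H)" by (simp add: hilbert_subspace_def)
qed

text \<open>Translates the projection onto the embedded copy of \<open>H\<close> into
  \<open>V \<circ> W\<close>, the form in which compressions are computed.\<close>

lemma orth_proj_range_V: "orth_proj (V ` H) k = V (W k)"
proof -
  interpret VH: closed_csubspace "V ` H" by (rule range_V)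
  show ?thesis
    by (rule VH.orth_proj_eqI) (auto simp: V_cinner cinner_W_left)
qed

text \<open>The union of the increasing sequence of the subspaces \<open>U\<^sup>-\<^sup>m V H\<close>.\<close>

definition core :: "'b set"
  where "core = {k \<in> K. \<exists>m. (U ^^ m) k \<in> V ` H}"

text \<open>The range of \<open>V\<close> is invariant under \<open>U\<close>, because
  \<open>U V = V P\<close>.\<close>

lemma U_pow_core_mono: "k \<in> K \<Longrightarrow> (U ^^ m) k \<in> V ` H \<Longrightarrow> m \<le> n \<Longrightarrow> (U ^^ n) k \<in> V ` H"
proof -
  assume k: "k \<in> K" "(U ^^ m) k \<in> V ` H" "m \<le> n"
  then obtain h where h: "h \<in> H" "(U ^^ m) k = V h" by blast
  have "(U ^^ n) k = (U ^^ (n - m)) ((U ^^ m) k)"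
    using k(3) by (simp flip: funpow_add comp_apply[of "U ^^ _" "U ^^ _" k])
  also have "\<dots> = V ((P ^^ (n - m)) h)" by (simp add: h V_P_pow)
  finally show ?thesis using h by simp
qed

lemma coreE:
  assumes "k \<in> core"
  obtains m where "\<And>n. m \<le> n \<Longrightarrow> (U ^^ n) k \<in> V ` H"
  using assms U_pow_core_mono unfolding core_def by blast

lemma core_subset: "core \<subseteq> K" by (auto simp: core_def)

lemma V_core: "h \<in> H \<Longrightarrow> V h \<in> core"
  by (auto simp: core_def intro: exI[of _ 0])

lemma csubspace_core: "csubspace core"
  unfolding csubspace_iff
proof (intro conjI ballI allI)
  interpret VH: closed_csubspace "V ` H" by (rule range_V)
  show "0 \<in> core" using V_core[of 0] by simp
  fix x assume x: "x \<in> core"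
  then have xK: "x \<in> K" using core_subset by auto
  obtain m where m: "\<And>n. m \<le> n \<Longrightarrow> (U ^^ n) x \<in> V ` H" using coreE[OF x] by blast
  show "c *\<^sub>C x \<in> core" for c
    using m[of m] xK VH.scale_mem by (auto simp: core_def U_pow_linear intro!: exI[of _ m] K.scale_mem)
  fix y assume y: "y \<in> core"
  then have yK: "y \<in> K" using core_subset by auto
  obtain m' where m': "\<And>n. m' \<le> n \<Longrightarrow> (U ^^ n) y \<in> V ` H" using coreE[OF y] by blast
  have "(U ^^ (max m m')) (x + y) \<in> V ` H"
    unfolding U_pow_linear(1)[OF xK yK] using m m' by (intro VH.add_mem) auto
  then show "x + y \<in> core" using xK yK unfolding core_def by blast
qed

lemma R_core:
  assumes i: "i \<in> {1..d}" and k: "k \<in> core"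
  shows "R i k \<in> core"
proof -
  obtain m h where m: "k \<in> K" "h \<in> H" "(U ^^ m) k = V h" using k by (auto simp: core_def)
  then have "(U ^^ m) (R i k) = V (S i h)" using i by (simp add: R_U_pow[symmetric] V_S)
  then show ?thesis using S_mem[OF i] R_mem[OF i] unfolding core_def by blast
qed

lemma Us_core:
  assumes k: "k \<in> core"
  shows "Us k \<in> core"
proof -
  obtain m h where m: "k \<in> K" "h \<in> H" "(U ^^ m) k = V h" using k by (auto simp: core_def)
  then have "(U ^^ Suc m) (Us k) = V h" unfolding funpow_Suc_right by simp
  then show ?thesis using m Us_mem unfolding core_def by blast
qed

lemma adj_R_core:
  assumes i: "i \<in> {1..d}" and k: "k \<in> core"
  shows "adj K (R i) k \<in> core"
proof (cases "i = d")
  case False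
  with i have i': "i \<in> {1..d - 1}" "d - i \<in> {1..d}" by auto
  have "k \<in> K" using k core_subset by blast
  then show ?thesis unfolding adj_R[OF i'(1) \<open>k \<in> K\<close>] by (intro R_core i' Us_core k)
qed (simp add: Us_core k)

lemma reducing_closure_core: "reducing d (closure core) K R"
  unfolding reducing_def
proof (intro conjI ballI image_subsetI)
  show "closure core \<subseteq> K" by (intro closure_minimal core_subset K.closed)
  fix i x assume i: "i \<in> {1..d}" and x: "x \<in> closure core"
  show "R i x \<in> closure core"
    using R_core[OF i] by (intro K.bops_closure[OF R_bops[OF i] core_subset _ x]) auto
  show "adj K (R i) x \<in> closure core"
    using adj_R_core[OF i] by (intro K.bops_closure[OF K.adj_bops[OF R_bops[OF i]] core_subset _ x]) auto
qed (rule closure_csubspace[OF csubspace_core])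

lemma inv_into_U: "x \<in> K \<Longrightarrow> inv_into K U x = Us x"
proof -
  assume x: "x \<in> K"
  have "inj_on U K" by (rule inj_on_inverseI[where g = Us]) simp
  from inv_into_f_f[OF this, of "Us x"] x show ?thesis by simp
qed

lemma zpow_V: "h \<in> H \<Longrightarrow> zpow_op K U m (V h) = (if m \<ge> 0 then V ((P ^^ nat m) h) else (Us ^^ nat (- m)) (V h))"
proof -
  have "(inv_into K U ^^ n) x = (Us ^^ n) x" if "x \<in> K" for n x
    using that by (induction n) (simp_all add: inv_into_U)
  then show "h \<in> H \<Longrightarrow> ?thesis" by (simp add: zpow_op_def V_P_pow)
qed

text \<open>An increasing union of subspaces is a subspace, so forming the span adds nothing to
  \<open>core\<close>.\<close>

lemma cspan_zpow: "cspan {zpow_op K U m (V h) | m h. h \<in> H} = core"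
proof (rule antisym)
  show "cspan {zpow_op K U m (V h) | m h. h \<in> H} \<subseteq> core"
  proof (rule cvs.span_minimal)
    show "{zpow_op K U m (V h) |m h. h \<in> H} \<subseteq> core"
    proof clarify
      fix m h assume h: "h \<in> H"
      have "(Us ^^ n) (V h) \<in> core" for n
        using V_core[OF h] by (induction n) (simp_all add: Us_core)
      then show "zpow_op K U m (V h) \<in> core" using V_core h by (simp add: zpow_V)
    qed
  qed (rule csubspace_core)
  show "core \<subseteq> cspan {zpow_op K U m (V h) | m h. h \<in> H}"
  proof
    fix k assume "k \<in> core"
    then obtain m h where k: "k \<in> K" "h \<in> H" "(U ^^ m) k = V h" by (auto simp: core_def)
    then have "k = (Us ^^ m) (V h)" by (metis Us_pow_U_pow)
    also have "\<dots> = zpow_op K U (- int m) (V h)"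
      using k by (cases "m = 0") (simp_all add: zpow_V)
    finally show "k \<in> cspan {zpow_op K U m (V h) | m h. h \<in> H}"
      using k(2) by (intro cvs.span_base) blast
  qed
qed

end

subsection \<open>Restriction to a reducing subspace\<close>

context closed_csubspace
begin

context
  fixes d R N
  assumes um: "unitary_module d M R" and red: "reducing d N M R"
begin

interpretation N: closed_csubspace N
  using red by unfold_locales (simp add: reducing_def)

private lemma N_subset: "x \<in> N \<Longrightarrow> x \<in> M"
  and N_R: "i \<in> {1..d} \<Longrightarrow> x \<in> N \<Longrightarrow> R i x \<in> N"
  and N_adj: "i \<in> {1..d} \<Longrightarrow> x \<in> N \<Longrightarrow> adj M (R i) x \<in> N"
  using red unfolding reducing_def by blast+

private lemma R_bops: "i \<in> {1..d} \<Longrightarrow> R i \<in> bops M"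
  using um by (auto simp: unitary_module_def normal_op_def)

lemma restrict_reducing_bops: "i \<in> {1..d} \<Longrightarrow> restrict_op N (R i) \<in> bops N"
  by (rule N.bopsI[where B = "onorm (R i)"])
    (auto simp: restrict_op_def bops_add bops_scale R_bops N_subset N_R N.add_mem N.scale_mem norm_le_onorm)

lemma adj_restrict_reducing:
  assumes i: "i \<in> {1..d}"
  shows "adj N (restrict_op N (R i)) = restrict_op N (adj M (R i))"
proof (rule N.adj_eqI)
  show "restrict_op N (adj M (R i)) \<in> bops N"
    by (rule N.bopsI[where B = "onorm (R i)"])
      (use norm_le_onorm[OF adj_bops[OF R_bops[OF i]]] in \<open>simp_all add: restrict_op_def
        bops_add[OF adj_bops[OF R_bops[OF i]]] bops_scale[OF adj_bops[OF R_bops[OF i]]]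
        R_bops[OF i] N_subset N_adj[OF i] N.add_mem N.scale_mem\<close>)
next
  show "restrict_op N (R i) \<in> bops N" by (rule restrict_reducing_bops[OF i])
  show "cinner (restrict_op N (R i) x) y = cinner x (restrict_op N (adj M (R i)) y)" if "x \<in> N" "y \<in> N" for x y
    using that by (simp add: restrict_op_def N_subset cinner_adj_right[OF R_bops[OF i]])
qed

text \<open>Invariance of \<open>N\<close> under the adjoints is exactly what makes the projection
  onto \<open>N\<close> commute with the operators.\<close>

private lemma orth_proj_R: "i \<in> {1..d} \<Longrightarrow> x \<in> M \<Longrightarrow> orth_proj N (R i x) = R i (orth_proj N x)"
proof (rule N.orth_proj_eqI)
  assume i: "i \<in> {1..d}" and x: "x \<in> M"
  show "R i (orth_proj N x) \<in> N" by (intro N_R i N.orth_proj_mem)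
  fix z assume z: "z \<in> N"
  have "cinner (R i x) z = cinner x (adj M (R i) z)"
    using z x i by (simp add: cinner_adj_right R_bops N_subset)
  also have "\<dots> = cinner (orth_proj N x) (adj M (R i) z)"
    by (rule N.cinner_orth_proj_left[symmetric]) (intro N_adj i z)
  also have "\<dots> = cinner (R i (orth_proj N x)) z"
    using z i by (simp add: cinner_adj_right R_bops N_subset)
  finally show "cinner (R i x) z = cinner (R i (orth_proj N x)) z" .
qed

text \<open>If a form with values in \<open>N\<close> has a primitive with values in
  \<open>M\<close>, the projection of that primitive onto \<open>N\<close> is again a primitive,
  since the projection commutes with the differential. So exactness over \<open>M\<close> gives
  exactness over \<open>N\<close>.\<close>

private lemma taylor_spectrum_reducing: "taylor_spectrum d N (\<lambda>i. restrict_op N (R i)) \<subseteq> taylor_spectrum d M R"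
proof -
  have "koszul_exact d N (\<lambda>i. restrict_op N (\<lambda>x. restrict_op N (R i) x - z i *\<^sub>C x))"
    if exact: "koszul_exact d M (\<lambda>i. restrict_op M (\<lambda>x. R i x - z i *\<^sub>C x))" for z
  proof -
    let ?T = "\<lambda>i. restrict_op M (\<lambda>x. R i x - z i *\<^sub>C x)"
    let ?T' = "\<lambda>i. restrict_op N (\<lambda>x. restrict_op N (R i) x - z i *\<^sub>C x)"
    have TM: "?T i \<in> bops M" if "i \<in> {1..d}" for i
      using shift_bops[OF R_bops[OF that]] by (simp add: shift_def)
    have TN: "?T i x \<in> N" "?T' i x = ?T i x" if "i \<in> {1..d}" "x \<in> N" for i x
      using that N_R[OF that] N_subset[OF that(2)]
      by (auto simp: restrict_op_def N.diff_mem N.scale_mem)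
    have mem: "\<omega> J \<in> N" if "\<omega> \<in> koszul_forms d N" for \<omega> J
      using that by (cases "J \<subseteq> {1..d}") (auto simp: koszul_forms_def split: if_splits dest: spec[of _ J])
    have diff_eq: "koszul_diff d ?T' \<omega> = koszul_diff d ?T \<omega>" if "\<omega> \<in> koszul_forms d N" for \<omega>
    proof
      fix I
      have "?T' i (\<omega> (I - {i})) = ?T i (\<omega> (I - {i}))" if "I \<subseteq> {1..d}" "i \<in> I" for i
        by (rule TN(2)) (use that mem[OF \<open>\<omega> \<in> koszul_forms d N\<close>] in auto)
      then show "koszul_diff d ?T' \<omega> I = koszul_diff d ?T \<omega> I"
        unfolding koszul_diff_def by (intro if_cong sum.cong refl arg_cong2[where f = scaleR]) auto
    qed
    have sub: "\<omega> \<in> koszul_forms d M" if "\<omega> \<in> koszul_forms d N" for \<omega>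
      using that N_subset by (auto simp: koszul_forms_def split: if_splits)
    have diff_N: "koszul_diff d ?T \<omega> \<in> koszul_forms d N" if "\<omega> \<in> koszul_forms d N" for \<omega>
      using TN(1)[OF _ mem[OF that]]
      by (auto simp: koszul_forms_def koszul_diff_def intro!: N.sum_mem N.scaleR_mem)
    show ?thesis unfolding koszul_exact_def
    proof safe
      fix \<omega> assume \<omega>: "\<omega> \<in> koszul_forms d N"
      show "koszul_diff d ?T' \<omega> \<in> koszul_forms d N" using diff_N[OF \<omega>] by (simp add: diff_eq \<omega>)
      \<comment> \<open>That the differential squares to zero is read off from exactness over
        \<open>M\<close>, which contains the inclusion of the range in the kernel.\<close>
      have "koszul_diff d ?T \<omega> \<in> koszul_diff d ?T ` koszul_forms d M" using sub[OF \<omega>] by blast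
      then have "koszul_diff d ?T (koszul_diff d ?T \<omega>) = (\<lambda>_. 0)"
        using exact by (auto simp: koszul_exact_def)
      then show "koszul_diff d ?T' (koszul_diff d ?T' \<omega>) = (\<lambda>_. 0)"
        by (simp add: diff_eq \<omega> diff_N)
    next
      fix \<omega> assume \<omega>: "\<omega> \<in> koszul_forms d N" "koszul_diff d ?T' \<omega> = (\<lambda>_. 0)"
      then have "\<omega> \<in> koszul_diff d ?T ` koszul_forms d M"
        using exact sub[OF \<omega>(1)] by (auto simp: koszul_exact_def diff_eq)
      then obtain \<eta> where \<eta>: "\<eta> \<in> koszul_forms d M" "\<omega> = koszul_diff d ?T \<eta>" by blast
      define \<eta>' where "\<eta>' = (\<lambda>I. orth_proj N (\<eta> I))"
      have \<eta>M: "\<eta> J \<in> M" for J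
        using \<eta>(1) by (cases "J \<subseteq> {1..d}") (auto simp: koszul_forms_def split: if_splits dest: spec[of _ J])
      have \<eta>': "\<eta>' \<in> koszul_forms d N"
        using \<eta>(1) by (auto simp: koszul_forms_def \<eta>'_def split: if_splits)
      have TP: "?T i (orth_proj N x) = orth_proj N (?T i x)" if "i \<in> {1..d}" "x \<in> M" for i x
      proof -
        have "orth_proj N (R i x - z i *\<^sub>C x) = orth_proj N (R i x) + orth_proj N ((- z i) *\<^sub>C x)"
          by (simp flip: N.orth_proj_add)
        also have "\<dots> = R i (orth_proj N x) - z i *\<^sub>C orth_proj N x"
          using that by (simp only: N.orth_proj_scale orth_proj_R) simp
        finally show ?thesis
          using that N_subset[OF N.orth_proj_mem[of x]] by (simp add: restrict_op_def)
      qed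
      have "koszul_diff d ?T \<eta>' I = \<omega> I" for I
      proof (cases "I \<subseteq> {1..d}")
        case True
        have sumP: "orth_proj N (sum f J) = (\<Sum>i\<in>J. orth_proj N (f i))" for f and J :: "nat set"
          using N.orth_proj_ident[OF N.zero_mem]
          by (induction J rule: infinite_finite_induct) (auto simp: N.orth_proj_add)
        have "koszul_diff d ?T \<eta>' I = (\<Sum>i\<in>I. orth_proj N ((- 1) ^ card {j \<in> I. j < i} *\<^sub>R ?T i (\<eta> (I - {i}))))"
          using True by (auto simp: koszul_diff_def \<eta>'_def TP[OF subsetD[OF True] \<eta>M] scaleR_scaleC N.orth_proj_scale
              simp del: of_real_power intro!: sum.cong)
        also have "\<dots> = orth_proj N (\<omega> I)" using True by (simp add: \<eta>(2) koszul_diff_def sumP)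
        also have "\<dots> = \<omega> I" by (rule N.orth_proj_ident[OF mem[OF \<omega>(1)]])
        finally show ?thesis .
      qed (simp add: \<eta>(2) koszul_diff_def)
      then have "\<omega> = koszul_diff d ?T' \<eta>'" by (simp add: diff_eq[OF \<eta>'] ext)
      then show "\<omega> \<in> koszul_diff d ?T' ` koszul_forms d N" using \<eta>' by blast
    qed
  qed
  then show ?thesis by (auto simp: taylor_spectrum_def)
qed

private lemma op_cpoly_restrict: "h \<in> N \<Longrightarrow> op_cpoly d f (\<lambda>i. restrict_op N (R i)) h = op_cpoly d f R h"
proof -
  assume h: "h \<in> N"
  have pow: "(restrict_op N (R i) ^^ n) x = (R i ^^ n) x \<and> (R i ^^ n) x \<in> N"
    if "i \<in> {1..d}" "x \<in> N" for i n x
    using that by (induction n) (auto simp: restrict_op_def N_R)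
  have "foldr (\<lambda>i A. (restrict_op N (R i) ^^ a i) \<circ> A) xs id h = foldr (\<lambda>i A. (R i ^^ a i) \<circ> A) xs id h
      \<and> foldr (\<lambda>i A. (R i ^^ a i) \<circ> A) xs id h \<in> N" if "set xs \<subseteq> {1..d}" for a xs
    using that by (induction xs) (auto simp: h pow)
  moreover have "set [1..<Suc d] \<subseteq> {1..d}" by auto
  ultimately have "op_monomial d \<alpha> (\<lambda>i. restrict_op N (R i)) h = op_monomial d \<alpha> R h" for \<alpha>
    unfolding op_monomial_def by blast
  then show ?thesis by (simp add: op_cpoly_def)
qed

lemma unitary_module_reducing: "unitary_module d N (\<lambda>i. restrict_op N (R i))"
proof -
  have comm: "restrict_op N (R i) \<circ> restrict_op N (R j) = restrict_op N (R j) \<circ> restrict_op N (R i)"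
    if "i \<in> {1..d}" "j \<in> {1..d}" for i j
  proof (rule N.bops_eqI)
    fix x assume x: "x \<in> N"
    have "R i x \<in> N" "R j x \<in> N" using N_R that x by blast+
    then show "(restrict_op N (R i) \<circ> restrict_op N (R j)) x = (restrict_op N (R j) \<circ> restrict_op N (R i)) x"
      using unitary_module_star_commute(1)[OF um that N_subset[OF x]] x by (simp add: restrict_op_def)
  qed (use that restrict_reducing_bops in blast)+
  have "normal_op N (restrict_op N (R i))" if i: "i \<in> {1..d}" for i
    unfolding normal_op_def
  proof
    show "adj N (restrict_op N (R i)) \<circ> restrict_op N (R i) = restrict_op N (R i) \<circ> adj N (restrict_op N (R i))"
    proof (rule N.bops_eqI)
      fix x assume x: "x \<in> N"
      show "(adj N (restrict_op N (R i)) \<circ> restrict_op N (R i)) x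
          = (restrict_op N (R i) \<circ> adj N (restrict_op N (R i))) x"
        unfolding adj_restrict_reducing[OF i]
        using unitary_module_star_commute(2)[OF um i i N_subset[OF x]] x N_R[OF i x] N_adj[OF i x]
        by (simp add: restrict_op_def)
    qed (use i restrict_reducing_bops N.adj_bops N.comp_bops in blast)+
  qed (rule restrict_reducing_bops[OF i])
  moreover have "contractive_module d N (\<lambda>i. restrict_op N (R i))"
    using um comm restrict_reducing_bops N.hilbert_subspace N_subset
    by (auto simp: unitary_module_def contractive_module_def hilbert_module_def op_cpoly_restrict)
  moreover have "taylor_spectrum d N (\<lambda>i. restrict_op N (R i)) \<subseteq> dist_boundary d"
    using taylor_spectrum_reducing um by (auto simp: unitary_module_def)
  ultimately show ?thesis by (simp add: unitary_module_def)
qed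

end

end

context isometric_extension
begin

text \<open>A reducing subspace that contains the range of \<open>V\<close> is invariant under the
  inverse of \<open>U\<close>, hence contains every \<open>U^{-m} V h\<close>.\<close>

lemma minimal_extension_closure_core:
  "minimal_unitary_extension d H S (closure core) (\<lambda>i. restrict_op (closure core) (R i)) V"
  unfolding minimal_unitary_extension_def
proof (intro conjI allI impI)
  let ?R = "\<lambda>i. restrict_op (closure core) (R i)"
  show "unitary_module d (closure core) ?R"
    by (rule K.unitary_module_reducing[OF unitary reducing_closure_core])
  show "isometric_embedding d H S (closure core) ?R V"
    using embedding V_core closure_subset[of core]
    by (auto simp: isometric_embedding_def restrict_op_def)
  fix N assume N: "reducing d N (closure core) ?R \<and> V ` H \<subseteq> N"
  then have "adj (closure core) (?R d) ` N \<subseteq> N" and sub: "N \<subseteq> closure core" and cl: "closed N"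
    by (auto simp: reducing_def hilbert_subspace_def)
  moreover have "adj (closure core) (?R d) = restrict_op (closure core) Us"
    by (rule K.adj_restrict_reducing[OF unitary reducing_closure_core d_mem])
  ultimately have Us: "Us x \<in> N" if "x \<in> N" for x
    using that by (auto simp: restrict_op_def image_subset_iff split: if_splits)
  have "k \<in> N" if "k \<in> core" for k
  proof -
    obtain m h where m: "k \<in> K" "h \<in> H" "(U ^^ m) k = V h" using \<open>k \<in> core\<close> by (auto simp: core_def)
    then have "k = (Us ^^ m) (V h)" by (metis Us_pow_U_pow)
    moreover have "(Us ^^ m) (V h) \<in> N" using N m(2) by (induction m) (auto simp: Us)
    ultimately show ?thesis by simp
  qed
  then have "closure core \<subseteq> N" by (intro closure_minimal cl) auto
  with sub show "N = closure core" by blast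
qed

end

subsection \<open>The minimal extension and Toeplitz operators\<close>

text \<open>Used twice: to extend convergence from a dense set of vectors to all vectors, and from a
  sequence of operators to its norm limit.\<close>

lemma convergent_uniform_approx:
  fixes f :: "nat \<Rightarrow> 'c::banach"
  assumes "\<And>e. 0 < e \<Longrightarrow> \<exists>g. convergent g \<and> (\<forall>n. norm (f n - g n) \<le> e)"
  shows "convergent f"
proof (rule Cauchy_convergent, rule metric_CauchyI)
  fix e :: real assume e: "0 < e"
  then obtain g where g: "convergent g" "\<And>n. norm (f n - g n) \<le> e / 4" using assms[of "e / 4"] by auto
  obtain N where N: "\<And>m n. N \<le> m \<Longrightarrow> N \<le> n \<Longrightarrow> dist (g m) (g n) < e / 4"
    using metric_CauchyD[OF convergent_Cauchy[OF g(1)], of "e / 4"] e by auto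
  have "dist (f m) (f n) < e" if "N \<le> m" "N \<le> n" for m n
  proof -
    have "dist (f m) (f n) \<le> dist (f m) (g m) + dist (g m) (g n) + dist (f n) (g n)"
      using dist_triangle[of "f m" "f n" "g m"] dist_triangle[of "g m" "f n" "g n"]
      by (simp add: dist_commute)
    then show ?thesis using g(2)[of m] g(2)[of n] N[OF that] e by (simp add: dist_norm)
  qed
  then show "\<exists>M. \<forall>m\<ge>M. \<forall>n\<ge>M. dist (f m) (f n) < e" by blast
qed

text \<open>Minimality acts only through this density; it follows because the closure of
  \<open>core\<close> is a reducing subspace containing the range of \<open>V\<close>.\<close>

locale minimal_extension = isometric_extension +
  assumes dense: "closure core = K"

lemma (in isometric_extension) minimal_extensionI:
  assumes "minimal_unitary_extension d H S K R V"
  shows "minimal_extension d H S K R V"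
proof unfold_locales
  have "V ` H \<subseteq> closure core" using V_core closure_subset[of core] by auto
  then show "closure core = K"
    using assms reducing_closure_core unfolding minimal_unitary_extension_def by blast
qed

context minimal_extension
begin

lemma core_approx: "k \<in> K \<Longrightarrow> 0 < e \<Longrightarrow> \<exists>c\<in>core. norm (k - c) < e"
  using closure_approachable[of k core] by (auto simp: dense dist_norm norm_minus_commute)

lemma core_K: "k \<in> core \<Longrightarrow> k \<in> K" using core_subset by auto

text \<open>The spaces \<open>U^{-n} V H\<close> increase with \<open>n\<close>, so two vectors of
  their union lie in one of them.\<close>

lemma common_level:
  assumes "k \<in> core" "k' \<in> core"
  obtains n h h' where "h \<in> H" "h' \<in> H" "(U ^^ n) k = V h" "(U ^^ n) k' = V h'"
proof -
  obtain m m' where "\<And>n. m \<le> n \<Longrightarrow> (U ^^ n) k \<in> V ` H" "\<And>n. m' \<le> n \<Longrightarrow> (U ^^ n) k' \<in> V ` H"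
    using coreE assms by metis
  then have "(U ^^ (max m m')) k \<in> V ` H" "(U ^^ (max m m')) k' \<in> V ` H" by auto
  then show thesis using that by blast
qed

lemma bops_eqI_core:
  assumes A: "A \<in> bops K" and B: "B \<in> bops K"
    and eq: "\<And>k k'. k \<in> core \<Longrightarrow> k' \<in> core \<Longrightarrow> cinner (A k) k' = cinner (B k) k'"
  shows "A = B"
proof (rule K.bops_eqI_cinner[OF A B])
  fix x y assume "x \<in> K" "y \<in> K"
  then have xy: "x \<in> closure core" "y \<in> closure core" by (simp_all add: dense)
  obtain f where f: "\<And>n. f n \<in> core" "f \<longlonglongrightarrow> x" using xy(1) unfolding closure_sequential by blast
  obtain g where g: "\<And>n. g n \<in> core" "g \<longlonglongrightarrow> y" using xy(2) unfolding closure_sequential by blast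
  have "(\<lambda>n. cinner (A (f n)) (g n)) \<longlonglongrightarrow> cinner (A x) y"
    by (rule tendsto_cinner[OF K.bops_tendsto[OF A core_K[OF f(1)] f(2)] g(2)])
  moreover have "(\<lambda>n. cinner (A (f n)) (g n)) \<longlonglongrightarrow> cinner (B x) y"
    unfolding eq[OF f(1) g(1)] by (rule tendsto_cinner[OF K.bops_tendsto[OF B core_K[OF f(1)] f(2)] g(2)])
  ultimately show "cinner (A x) y = cinner (B x) y" by (rule LIMSEQ_unique)
qed

lemma K_eq_closure_cspan: "K = closure (cspan {zpow_op K U m (V h) | m h. h \<in> H})"
  by (simp only: cspan_zpow dense)

text \<open>\<open>U^{-m} V X V^* U^m\<close>: the operator \<open>X\<close> transported to the copy
  \<open>U^{-m} V H\<close> of \<open>H\<close> and extended by 0 on its complement.\<close>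

definition Phi :: "nat \<Rightarrow> ('a \<Rightarrow> 'a) \<Rightarrow> 'b \<Rightarrow> 'b"
  where "Phi m X = restrict_op K (\<lambda>k. (Us ^^ m) (V (X (W ((U ^^ m) k)))))"

lemma Phi_apply: "k \<in> K \<Longrightarrow> Phi m X k = (Us ^^ m) (V (X (W ((U ^^ m) k))))"
  by (simp add: Phi_def restrict_op_def)

lemma norm_Phi:
  assumes X: "X \<in> bops H" and k: "k \<in> K"
  shows "norm (Phi m X k) \<le> onorm X * norm k"
proof -
  have "norm (Phi m X k) = norm (X (W ((U ^^ m) k)))"
    by (simp add: Phi_apply k H.bops_mem[OF X])
  also have "\<dots> \<le> onorm X * norm (W ((U ^^ m) k))" by (rule H.norm_le_onorm[OF X])
  also have "\<dots> \<le> onorm X * norm k"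
    using norm_W[of "(U ^^ m) k"] k by (intro mult_left_mono H.onorm_nonneg X) simp
  finally show ?thesis .
qed

lemma Phi_bops:
  assumes X: "X \<in> bops H"
  shows "Phi m X \<in> bops K"
proof (rule K.bopsI[where B = "onorm X"])
  show "norm (Phi m X x) \<le> onorm X * norm x" if "x \<in> K" for x
    using norm_Phi[OF X that] .
qed (simp_all add: Phi_def restrict_op_def K.add_mem K.scale_mem U_pow_linear Us_pow_linear W_add W_scale
    H.bops_add[OF X] H.bops_scale[OF X] V_add V_scale H.bops_mem[OF X])

lemma cinner_Phi:
  assumes X: "X \<in> bops H" and k: "k \<in> K" "k' \<in> K"
  shows "cinner (Phi m X k) k' = cinner (X (W ((U ^^ m) k))) (W ((U ^^ m) k'))"
  using k by (simp add: Phi_apply cinner_Us_pow H.bops_mem[OF X] cinner_W_right)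

text \<open>For vectors represented at level n by \<open>h\<close> and h', the coefficient at level
  \<open>m \<ge> n\<close> is that of \<open>X\<close> at \<open>P^{m-n} h\<close> and
  \<open>P^{m-n}\<close> h', and \<open>P^* X P = X\<close> reduces it to the one at
  \<open>h\<close> and h'. So the sequence is eventually constant on \<open>core\<close>, and
  uniform boundedness does the rest.\<close>

lemma Phi_convergent_weak:
  assumes X: "X \<in> bops H" and PXP: "\<And>h h'. h \<in> H \<Longrightarrow> h' \<in> H \<Longrightarrow> cinner (X (P h)) (P h') = cinner (X h) h'"
    and k: "k \<in> K" "k' \<in> K"
  shows "convergent (\<lambda>m. cinner (Phi m X k) k')"
    and "(U ^^ n) k = V h \<Longrightarrow> (U ^^ n) k' = V h' \<Longrightarrow> h \<in> H \<Longrightarrow> h' \<in> H \<Longrightarrow>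
      (\<lambda>m. cinner (Phi m X k) k') \<longlonglongrightarrow> cinner (X h) h'"
proof -
  have const: "(\<lambda>m. cinner (Phi m X c) c') \<longlonglongrightarrow> cinner (X h) h'"
    if c: "c \<in> K" "c' \<in> K" "(U ^^ n) c = V h" "(U ^^ n) c' = V h'" "h \<in> H" "h' \<in> H" for c c' n h h'
  proof (rule tendsto_eventually, rule eventually_sequentiallyI[of n])
    fix m assume m: "n \<le> m"
    have pow: "cinner (X ((P ^^ j) h)) ((P ^^ j) h') = cinner (X h) h'" for j
      using c by (induction j) (simp_all add: PXP)
    have shift: "(U ^^ m) x = (U ^^ (m - n)) ((U ^^ n) x)" for x
      using m by (simp flip: funpow_add comp_apply[of "U ^^ _" "U ^^ _" x])
    show "cinner (Phi m X c) c' = cinner (X h) h'"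
      using c by (simp add: cinner_Phi[OF X] shift V_P_pow[symmetric] pow)
  qed
  then show "(U ^^ n) k = V h \<Longrightarrow> (U ^^ n) k' = V h' \<Longrightarrow> h \<in> H \<Longrightarrow> h' \<in> H \<Longrightarrow>
      (\<lambda>m. cinner (Phi m X k) k') \<longlonglongrightarrow> cinner (X h) h'" using k by blast
  show "convergent (\<lambda>m. cinner (Phi m X k) k')"
  proof (rule convergent_uniform_approx)
    fix e :: real assume e: "0 < e"
    define C where "C = onorm X + 1"
    have C: "0 < C" "onorm X \<le> C" using H.onorm_nonneg[OF X] by (auto simp: C_def)
    \<comment> \<open>The tolerances make each of the two error terms at most \<open>e / 2\<close>.
      The approximation of \<open>k\<close> comes first because the tolerance for the other vector
      involves \<open>norm c\<close>.\<close>
    have pos: "0 < e / (2 * C * (norm k' + 1))" using C e by (simp add: add_nonneg_pos)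
    obtain c where c: "c \<in> core" "norm (k - c) < e / (2 * C * (norm k' + 1))"
      using core_approx[OF k(1) pos] by blast
    have pos': "0 < e / (2 * C * (norm c + 1))" using C e by (simp add: add_nonneg_pos)
    obtain c' where c': "c' \<in> core" "norm (k' - c') < e / (2 * C * (norm c + 1))"
      using core_approx[OF k(2) pos'] by blast
    have cK: "c \<in> K" "c' \<in> K" using c c' core_K by auto
    have "convergent (\<lambda>m. cinner (Phi m X c) c')"
    proof -
      obtain n h h' where "h \<in> H" "h' \<in> H" "(U ^^ n) c = V h" "(U ^^ n) c' = V h'"
        by (rule common_level[OF c(1) c'(1)])
      from convergentI[OF const[OF cK this(3,4,1,2)]] show ?thesis .
    qed
    moreover have "norm (cinner (Phi m X k) k' - cinner (Phi m X c) c') \<le> e" for m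
    proof -
      have PB: "Phi m X \<in> bops K" using Phi_bops[OF X] .
      have "cinner (Phi m X k) k' - cinner (Phi m X c) c'
          = cinner (Phi m X (k - c)) k' + cinner (Phi m X c) (k' - c')"
        by (simp add: K.bops_diff[OF PB] k cK cinner_algebra)
      also have "norm \<dots> \<le> norm (Phi m X (k - c)) * norm k' + norm (Phi m X c) * norm (k' - c')"
        by (intro norm_triangle_mono cinner_Cauchy_Schwarz)
      also have "\<dots> \<le> (C * norm (k - c)) * (norm k' + 1) + (C * (norm c + 1)) * norm (k' - c')"
      proof (intro add_mono mult_mono)
        show "norm (Phi m X (k - c)) \<le> C * norm (k - c)"
          by (rule order_trans[OF norm_Phi[OF X]]) (use C k cK in \<open>auto intro: K.diff_mem mult_right_mono\<close>)
        show "norm (Phi m X c) \<le> C * (norm c + 1)"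
          by (rule order_trans[OF norm_Phi[OF X cK(1)]], rule mult_mono) (use C in auto)
      qed (use C in auto)
      also have "\<dots> \<le> (C * (e / (2 * C * (norm k' + 1)))) * (norm k' + 1)
          + (C * (norm c + 1)) * (e / (2 * C * (norm c + 1)))"
        using c(2) c'(2) C e by (intro add_mono mult_mono) (auto simp: add_nonneg_nonneg)
      also have "\<dots> = e"
      proof -
        have "(C * (e / (2 * C * a))) * a + (C * b) * (e / (2 * C * b)) = e" if "0 < a" "0 < b" for a b :: real
          using C(1) that by (simp add: field_simps)
        then show ?thesis by (simp add: add_nonneg_pos)
      qed
      finally show ?thesis .
    qed
    ultimately show "\<exists>g. convergent g \<and> (\<forall>m. norm (cinner (Phi m X k) k' - g m) \<le> e)" by blast
  qed
qed

text \<open>The weak limits form a bounded sesquilinear form, hence an operator. Its coefficients on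
  \<open>core\<close> are recorded because commutation with \<open>R\<close> is later read off from
  them.\<close>

lemma Toeplitz_symbol:
  assumes X: "X \<in> bops H" and PXP: "\<And>h h'. h \<in> H \<Longrightarrow> h' \<in> H \<Longrightarrow> cinner (X (P h)) (P h') = cinner (X h) h'"
  obtains Y where "Y \<in> bops K" "onorm Y \<le> onorm X"
    "\<And>k k' n h h'. k \<in> K \<Longrightarrow> k' \<in> K \<Longrightarrow> (U ^^ n) k = V h \<Longrightarrow> (U ^^ n) k' = V h' \<Longrightarrow> h \<in> H \<Longrightarrow> h' \<in> H \<Longrightarrow>
      cinner (Y k) k' = cinner (X h) h'"
proof -
  define b where "b k k' = lim (\<lambda>m. cinner (Phi m X k) k')" for k k'
  have b: "(\<lambda>m. cinner (Phi m X k) k') \<longlonglongrightarrow> b k k'" if "k \<in> K" "k' \<in> K" for k k'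
    unfolding b_def using Phi_convergent_weak(1)[OF X PXP that] convergent_LIMSEQ_iff by blast
  note PB = Phi_bops[OF X]
  obtain Y where Y: "Y \<in> bops K" "\<And>x y. x \<in> K \<Longrightarrow> y \<in> K \<Longrightarrow> cinner (Y x) y = b x y"
    "\<And>x. x \<in> K \<Longrightarrow> norm (Y x) \<le> onorm X * norm x"
  proof (rule K.sesquilinear_representation[of b "onorm X"])
    fix x y z assume xyz: "x \<in> K" "y \<in> K" "z \<in> K"
    show "b (x + y) z = b x z + b y z"
      using LIMSEQ_unique[OF b[OF K.add_mem[OF xyz(1,2)] xyz(3)]] tendsto_add[OF b[OF xyz(1,3)] b[OF xyz(2,3)]]
      by (simp add: K.bops_add[OF PB] xyz cinner_algebra)
    show "b x (y + z) = b x y + b x z"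
      using LIMSEQ_unique[OF b[OF xyz(1) K.add_mem[OF xyz(2,3)]]] tendsto_add[OF b[OF xyz(1,2)] b[OF xyz(1,3)]]
      by (simp add: cinner_algebra)
  next
    fix c x y assume xy: "x \<in> K" "y \<in> K"
    show "b (c *\<^sub>C x) y = c * b x y"
      using LIMSEQ_unique[OF b[OF K.scale_mem[OF xy(1)] xy(2)]] tendsto_mult_left[OF b[OF xy], of c]
      by (simp add: K.bops_scale[OF PB] xy cinner_algebra)
    show "b x (c *\<^sub>C y) = cnj c * b x y"
      using LIMSEQ_unique[OF b[OF xy(1) K.scale_mem[OF xy(2)]]] tendsto_mult_left[OF b[OF xy], of "cnj c"]
      by (simp add: cinner_algebra)
    show "cmod (b x y) \<le> onorm X * norm x * norm y"
    proof (rule LIMSEQ_le_const2[OF tendsto_norm[OF b[OF xy]]], intro exI allI impI)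
      show "cmod (cinner (Phi n X x) y) \<le> onorm X * norm x * norm y" for n
        by (rule order_trans[OF cinner_Cauchy_Schwarz]) (intro mult_right_mono norm_Phi X xy norm_ge_zero)
    qed
  qed blast
  show thesis
  proof (rule that[OF Y(1)])
    show "onorm Y \<le> onorm X" by (intro K.onorm_leI Y H.onorm_nonneg X)
    fix k k' n h h' assume "k \<in> K" "k' \<in> K" "(U ^^ n) k = V h" "(U ^^ n) k' = V h'" "h \<in> H" "h' \<in> H"
    then show "cinner (Y k) k' = cinner (X h) h'"
      using LIMSEQ_unique[OF b Phi_convergent_weak(2)[OF X PXP]] by (simp add: Y(2))
  qed
qed

end

text \<open>Commuting with both \<open>Y\<close> and its adjoint is a condition stable under
  adjoints. Each relation is an equation between coefficients \<open>cinner (A x) y\<close>, hence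
  closed in the weak operator topology.\<close>

lemma (in closed_csubspace) von_neumann_algebra_commutant:
  assumes Y: "Y \<in> bops M"
  shows "von_neumann_algebra M {A \<in> bops M. A \<circ> Y = Y \<circ> A \<and> A \<circ> adj M Y = adj M Y \<circ> A}"
    (is "von_neumann_algebra M ?C")
  unfolding von_neumann_algebra_def
proof
  have Y': "adj M Y \<in> bops M" using Y by (rule adj_bops)
  have Cp: "A \<in> ?C \<longleftrightarrow> A \<in> bops M \<and> (\<forall>x\<in>M. A (Y x) = Y (A x)) \<and> (\<forall>x\<in>M. A (adj M Y x) = adj M Y (A x))" for A
    using Y Y' by (auto simp: fun_eq_iff) (metis bops_off bops_zero)+
  show "star_subalgebra M ?C"
    unfolding star_subalgebra_def
  proof (intro conjI ballI allI)
    show "id_op M \<in> ?C" unfolding Cp using Y Y' by (auto simp: bops_mem)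
    fix A assume A: "A \<in> ?C"
    then have AB: "A \<in> bops M" by simp
    show "(\<lambda>x. c *\<^sub>C A x) \<in> ?C" for c
      using A Y Y' unfolding Cp by (auto simp: bops_scale bops_mem)
    have "Y \<circ> adj M A = adj M A \<circ> Y"
    proof -
      have "adj M (A \<circ> adj M Y) = adj M (adj M Y \<circ> A)" using A by simp
      then show ?thesis using AB Y Y' by (simp add: adj_comp)
    qed
    moreover have "adj M Y \<circ> adj M A = adj M A \<circ> adj M Y"
    proof -
      have "adj M (A \<circ> Y) = adj M (Y \<circ> A)" using A by simp
      then show ?thesis using AB Y by (simp add: adj_comp)
    qed
    ultimately show "adj M A \<in> ?C" using AB by (simp add: adj_bops)
    fix B assume B: "B \<in> ?C"
    show "(\<lambda>x. A x + B x) \<in> ?C"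
      using A B Y Y' unfolding Cp by (auto simp: bops_add bops_mem)
    show "A \<circ> B \<in> ?C"
      using A B Y Y' unfolding Cp by (auto simp: bops_mem)
  qed auto
  let ?f = "\<lambda>A (x, y). cinner (A x) y"
  \<comment> \<open>The two commutation relations written for the coefficient function of
    \<open>A\<close>, where they become equalities of coordinates.\<close>
  define T where "T = (\<Inter>x\<in>M. \<Inter>y\<in>M. {g :: 'a \<times> 'a \<Rightarrow> complex. g (Y x, y) = g (x, adj M Y y)} \<inter>
    {g. g (adj M Y x, y) = g (x, Y y)})"
  have "closed T" unfolding T_def
    by (intro closed_INT ballI closed_Int closed_Collect_eq continuous_on_product_coordinates)
  have C_T: "A \<in> ?C \<longleftrightarrow> ?f A \<in> T" if A: "A \<in> bops M" for A
  proof -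
    have "(\<forall>x\<in>M. A (Y x) = Y (A x)) \<longleftrightarrow> (\<forall>x\<in>M. \<forall>y\<in>M. cinner (A (Y x)) y = cinner (A x) (adj M Y y))"
      using A Y by (auto simp: cinner_adj_right bops_mem intro!: eqI_cinner)
    moreover have "(\<forall>x\<in>M. A (adj M Y x) = adj M Y (A x))
        \<longleftrightarrow> (\<forall>x\<in>M. \<forall>y\<in>M. cinner (A (adj M Y x)) y = cinner (A x) (Y y))"
      using A Y by (auto simp: cinner_adj_left bops_mem adj_bops intro!: eqI_cinner)
    ultimately show ?thesis unfolding Cp T_def using A by auto
  qed
  have "openin (weak_operator_topology M) (bops M - ?C)"
    unfolding weak_operator_topology_def openin_pullback_topology
  proof (intro exI[of _ "- T"] conjI)
    show "openin euclidean (- T)" using \<open>closed T\<close> by auto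
    show "bops M - ?C = ?f -` (- T) \<inter> bops M" using C_T by blast
  qed
  then show "closedin (weak_operator_topology M) ?C"
    by (auto simp: closedin_def weak_operator_topology_def topspace_pullback_topology)
qed

context minimal_extension
begin

section \<open>The commutant of the extension and the Toeplitz operators\<close>

lemma commute_Us:
  assumes Y: "Y \<in> bops K" and YU: "Y \<circ> U = U \<circ> Y" and x: "x \<in> K"
  shows "Y (Us x) = Us (Y x)"
proof -
  have "Y x = Y (U (Us x))" using x by simp
  also have "\<dots> = U (Y (Us x))" using YU by (metis comp_apply)
  finally show ?thesis using K.bops_mem[OF Y] by simp
qed

lemma commute_Us_pow:
  assumes "Y \<in> bops K" "Y \<circ> U = U \<circ> Y" "x \<in> K"
  shows "Y ((Us ^^ m) x) = (Us ^^ m) (Y x)" "Y ((U ^^ m) x) = (U ^^ m) (Y x)"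
proof -
  show "Y ((Us ^^ m) x) = (Us ^^ m) (Y x)"
    using assms(3) by (induction m) (simp_all add: commute_Us[OF assms(1,2)])
  have "Y (U x) = U (Y x)" for x using assms(2) by (metis comp_apply)
  then show "Y ((U ^^ m) x) = (U ^^ m) (Y x)" by (induction m) simp_all
qed

text \<open>The adjoint of \<open>R i\<close> is \<open>R (d - i)\<close> times the inverse of
  \<open>U\<close>, and commuting with \<open>U\<close> means commuting with its inverse.\<close>

lemma commute_adj_R:
  assumes Y: "Y \<in> bops K" and YR: "\<And>i. i \<in> {1..d} \<Longrightarrow> Y \<circ> R i = R i \<circ> Y" and i: "i \<in> {1..d}"
  shows "Y \<circ> adj K (R i) = adj K (R i) \<circ> Y"
proof (rule K.bops_eqI)
  fix x assume x: "x \<in> K"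
  show "(Y \<circ> adj K (R i)) x = (adj K (R i) \<circ> Y) x"
  proof (cases "i = d")
    case True then show ?thesis using commute_Us[OF Y YR[OF d_mem] x] by simp
  next
    case False
    with i have i': "i \<in> {1..d - 1}" "d - i \<in> {1..d}" by auto
    have "Y (R (d - i) (Us x)) = R (d - i) (Us (Y x))"
      using YR[OF i'(2)] commute_Us[OF Y YR[OF d_mem] x] by (metis comp_apply)
    then show ?thesis using x by (simp add: adj_R[OF i'(1)] K.bops_mem[OF Y])
  qed
qed (intro K.comp_bops K.adj_bops R_bops Y i)+

text \<open>The operators that commute with \<open>Y\<close> and its adjoint form a von Neumann
  algebra. It contains the generators \<open>R i\<close> once \<open>Y\<close> commutes with them,
  and therefore everything they generate.\<close>

lemma commutant_iff:
  "Y \<in> commutant K (von_neumann_gen K (R ` {1..d})) \<longleftrightarrow> Y \<in> bops K \<and> (\<forall>i\<in>{1..d}. Y \<circ> R i = R i \<circ> Y)"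
proof
  assume "Y \<in> commutant K (von_neumann_gen K (R ` {1..d}))"
  then show "Y \<in> bops K \<and> (\<forall>i\<in>{1..d}. Y \<circ> R i = R i \<circ> Y)"
    using hull_inc[of "R _" "R ` {1..d}" "von_neumann_algebra K"]
    unfolding commutant_def von_neumann_gen_def by force
next
  assume Y: "Y \<in> bops K \<and> (\<forall>i\<in>{1..d}. Y \<circ> R i = R i \<circ> Y)"
  let ?C = "{A \<in> bops K. A \<circ> Y = Y \<circ> A \<and> A \<circ> adj K Y = adj K Y \<circ> A}"
  have "R i \<circ> adj K Y = adj K Y \<circ> R i" if i: "i \<in> {1..d}" for i
  proof -
    have "adj K (Y \<circ> adj K (R i)) = adj K (adj K (R i) \<circ> Y)"
      using commute_adj_R[of Y i] Y i by simp
    then show ?thesis using Y R_bops[OF i] by (simp add: K.adj_comp K.adj_bops)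
  qed
  then have "R ` {1..d} \<subseteq> ?C" using Y R_bops by auto
  then have "von_neumann_gen K (R ` {1..d}) \<subseteq> ?C"
    unfolding von_neumann_gen_def using K.von_neumann_algebra_commutant Y by (intro hull_minimal) auto
  then show "Y \<in> commutant K (von_neumann_gen K (R ` {1..d}))"
    using Y by (auto simp: commutant_def)
qed

lemma toeplitz_ops_iff:
  assumes X: "X \<in> bops H"
  shows "X \<in> toeplitz_ops d H S \<longleftrightarrow>
    (\<forall>i\<in>{1..d - 1}. \<forall>h\<in>H. \<forall>h'\<in>H. cinner (X (P h)) (S i h') = cinner (X (S (d - i) h)) h') \<and>
    (\<forall>h\<in>H. \<forall>h'\<in>H. cinner (X (P h)) (P h') = cinner (X h) h')"
proof -
  have gen: "adj H (S i) \<circ> X \<circ> P = Z \<longleftrightarrow> (\<forall>h\<in>H. \<forall>h'\<in>H. cinner (X (P h)) (S i h') = cinner (Z h) h')"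
    if i: "i \<in> {1..d}" and Z: "Z \<in> bops H" for i Z
  proof
    assume eq: "adj H (S i) \<circ> X \<circ> P = Z"
    show "\<forall>h\<in>H. \<forall>h'\<in>H. cinner (X (P h)) (S i h') = cinner (Z h) h'"
      unfolding eq[symmetric] by (simp add: H.cinner_adj_left[OF S_bops[OF i]] H.bops_mem[OF X])
  next
    assume eq: "\<forall>h\<in>H. \<forall>h'\<in>H. cinner (X (P h)) (S i h') = cinner (Z h) h'"
    show "adj H (S i) \<circ> X \<circ> P = Z"
    proof (rule H.bops_eqI_cinner[OF _ Z])
      show "adj H (S i) \<circ> X \<circ> P \<in> bops H" by (intro H.comp_bops H.adj_bops X S_bops i d_mem)
      show "cinner ((adj H (S i) \<circ> X \<circ> P) x) y = cinner (Z x) y" if "x \<in> H" "y \<in> H" for x y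
        using eq that by (simp add: H.cinner_adj_left[OF S_bops[OF i]] H.bops_mem[OF X])
    qed
  qed
  have "adj H (S i) \<circ> X \<circ> P = X \<circ> S (d - i) \<longleftrightarrow>
      (\<forall>h\<in>H. \<forall>h'\<in>H. cinner (X (P h)) (S i h') = cinner (X (S (d - i) h)) h')" if "i \<in> {1..d - 1}" for i
  proof -
    from that have i: "i \<in> {1..d}" "d - i \<in> {1..d}" by auto
    show ?thesis using gen[OF i(1) H.comp_bops[OF X S_bops[OF i(2)]]] by simp
  qed
  with gen[OF d_mem X] X show ?thesis unfolding toeplitz_ops_def by auto
qed

text \<open>Since \<open>Y\<close> commutes with \<open>U\<close>, the coefficient of
  \<open>X P\<close> against \<open>S_i\<close> is that of \<open>R_i^* U Y V\<close>; here
  \<open>R_i^* U\<close> equals \<open>R_{d-i}\<close>, or 1 if \<open>i = d\<close>, and can be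
  moved back past \<open>Y\<close>.\<close>

lemma compression_toeplitz:
  assumes X: "X \<in> bops H" and Y: "Y \<in> bops K" and YR: "\<And>i. i \<in> {1..d} \<Longrightarrow> Y \<circ> R i = R i \<circ> Y"
    and XY: "\<And>h. h \<in> H \<Longrightarrow> X h = W (Y (V h))"
  shows "X \<in> toeplitz_ops d H S"
proof -
  have YRx: "Y (R i x) = R i (Y x)" if "i \<in> {1..d}" for i x using YR[OF that] by (metis comp_apply)
  have val: "cinner (X (P h)) (S i h') = cinner (adj K (R i) (U (Y (V h)))) (V h')"
    if i: "i \<in> {1..d}" and h: "h \<in> H" "h' \<in> H" for i h h'
  proof -
    have "cinner (X (P h)) (S i h') = cinner (Y (U (V h))) (R i (V h'))"
      using h S_mem[OF i] by (simp add: XY cinner_W_left V_S[OF i] V_S)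
    also have "\<dots> = cinner (adj K (R i) (Y (U (V h)))) (V h')"
      using h by (simp add: K.cinner_adj_left[OF R_bops[OF i]] K.bops_mem[OF Y])
    finally show ?thesis by (simp add: YRx)
  qed
  show ?thesis unfolding toeplitz_ops_iff[OF X]
  proof (intro conjI ballI)
    fix h h' assume h: "h \<in> H" "h' \<in> H"
    show "cinner (X (P h)) (P h') = cinner (X h) h'"
      using val[OF d_mem h] h by (simp add: XY cinner_W_left K.bops_mem[OF Y])
    fix i assume i: "i \<in> {1..d - 1}"
    then have i': "i \<in> {1..d}" "d - i \<in> {1..d}" by auto
    show "cinner (X (P h)) (S i h') = cinner (X (S (d - i) h)) h'"
      using val[OF i'(1) h] h S_mem[OF i'(2)]
      by (simp add: XY cinner_W_left K.bops_mem[OF Y] adj_R_U[OF i] V_S[OF i'(2)] YRx[OF i'(2)])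
  qed
qed

text \<open>An operator commuting with \<open>U\<close> has the same coefficients at
  \<open>k\<close>, k' as at \<open>U^n k\<close>, \<open>U^n\<close> k'. For large \<open>n\<close>
  these vectors lie in the range of \<open>V\<close>, where only the compression is visible.\<close>

lemma symbol_unique:
  assumes Y: "Y \<in> bops K" "Y \<circ> U = U \<circ> Y" and Y': "Y' \<in> bops K" "Y' \<circ> U = U \<circ> Y'"
    and eq: "\<And>h. h \<in> H \<Longrightarrow> W (Y (V h)) = W (Y' (V h))"
  shows "Y = Y'"
proof (rule bops_eqI_core[OF Y(1) Y'(1)])
  fix k k' assume k: "k \<in> core" "k' \<in> core"
  obtain n h h' where n: "h \<in> H" "h' \<in> H" "(U ^^ n) k = V h" "(U ^^ n) k' = V h'"
    by (rule common_level[OF k])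
  have kK: "k \<in> K" "k' \<in> K" using k core_K by auto
  have "cinner (Z k) k' = cinner (W (Z (V h))) h'" if Z: "Z \<in> bops K" "Z \<circ> U = U \<circ> Z" for Z
  proof -
    have "cinner (Z k) k' = cinner ((U ^^ n) (Z k)) ((U ^^ n) k')"
      using kK K.bops_mem[OF Z(1)] by (simp add: cinner_U_pow)
    also have "\<dots> = cinner (Z (V h)) (V h')"
      by (simp add: commute_Us_pow(2)[OF Z kK(1), symmetric] n)
    finally show ?thesis using n by (simp add: cinner_W_left)
  qed
  then show "cinner (Y k) k' = cinner (Y' k) k'" using Y Y' eq[OF n(1)] by simp
qed

lemma onorm_compression_le:
  assumes X: "X \<in> bops H" and Y: "Y \<in> bops K" and XY: "\<And>h. h \<in> H \<Longrightarrow> X h = W (Y (V h))"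
  shows "onorm X \<le> onorm Y"
proof (rule H.onorm_leI[OF X K.onorm_nonneg[OF Y]])
  show "norm (X h) \<le> onorm Y * norm h" if "h \<in> H" for h
    using order_trans[OF norm_W K.norm_le_onorm[OF Y, of "V h"]] that by (simp add: XY)
qed

text \<open>To check commutation with \<open>R i\<close> on \<open>core\<close>, \<open>R i\<close>
  is moved to the other argument, where it becomes \<open>R (d - i)\<close> times the inverse of
  \<open>U\<close>. Raising the level from n to n + 1 absorbs the inverse, and the Toeplitz relation
  for the index \<open>d - i\<close> closes the computation.\<close>

lemma toeplitz_symbol_exists:
  assumes X: "X \<in> toeplitz_ops d H S"
  obtains Y where "Y \<in> bops K" "\<And>i. i \<in> {1..d} \<Longrightarrow> Y \<circ> R i = R i \<circ> Y" "onorm Y = onorm X"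
    "\<And>h. h \<in> H \<Longrightarrow> X h = W (Y (V h))"
    "\<And>k k' n h h'. k \<in> K \<Longrightarrow> k' \<in> K \<Longrightarrow> (U ^^ n) k = V h \<Longrightarrow> (U ^^ n) k' = V h' \<Longrightarrow> h \<in> H \<Longrightarrow> h' \<in> H \<Longrightarrow>
      cinner (Y k) k' = cinner (X h) h'"
proof -
  have XB: "X \<in> bops H" using X by (simp add: toeplitz_ops_def)
  have rel: "\<And>i h h'. i \<in> {1..d - 1} \<Longrightarrow> h \<in> H \<Longrightarrow> h' \<in> H \<Longrightarrow> cinner (X (P h)) (S i h') = cinner (X (S (d - i) h)) h'"
    and PXP: "\<And>h h'. h \<in> H \<Longrightarrow> h' \<in> H \<Longrightarrow> cinner (X (P h)) (P h') = cinner (X h) h'"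
    using X toeplitz_ops_iff[OF XB] by blast+
  obtain Y where Y: "Y \<in> bops K" "onorm Y \<le> onorm X"
    and val: "\<And>k k' n h h'. k \<in> K \<Longrightarrow> k' \<in> K \<Longrightarrow> (U ^^ n) k = V h \<Longrightarrow> (U ^^ n) k' = V h' \<Longrightarrow> h \<in> H \<Longrightarrow> h' \<in> H \<Longrightarrow>
      cinner (Y k) k' = cinner (X h) h'"
  proof (rule Toeplitz_symbol[OF XB])
    show "cinner (X (P h)) (P h') = cinner (X h) h'" if "h \<in> H" "h' \<in> H" for h h'
      by (rule PXP[OF that])
  qed blast
  have XY: "X h = W (Y (V h))" if h: "h \<in> H" for h
  proof (rule H.eqI_cinner)
    show "cinner (X h) z = cinner (W (Y (V h))) z" if "z \<in> H" for z
      using val[of "V h" "V z" 0 h z] h that by (simp add: cinner_W_left)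
  qed (simp_all add: H.bops_mem[OF XB])
  have YR: "Y \<circ> R i = R i \<circ> Y" if i: "i \<in> {1..d}" for i
  proof (rule bops_eqI_core)
    fix k k' assume k: "k \<in> core" "k' \<in> core"
    obtain n h h' where n: "h \<in> H" "h' \<in> H" "(U ^^ n) k = V h" "(U ^^ n) k' = V h'"
      by (rule common_level[OF k])
    have kK: "k \<in> K" "k' \<in> K" using k core_K by auto
    have Un: "(U ^^ Suc n) k = V (P h)" using n by (simp add: V_S)
    have Ri: "cinner (Y (R i k)) k' = cinner (X (S i h)) h'"
      by (rule val[of _ _ n]) (use n kK in \<open>simp_all add: R_mem[OF i] S_mem[OF i] R_U_pow[OF i, symmetric] V_S[OF i]\<close>)
    have "cinner (Y (R i k)) k' = cinner (Y k) (adj K (R i) k')"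
    proof (cases "i = d")
      case True
      \<comment> \<open>At level n + 1 the shifted vector is still represented by h', whereas
        \<open>k\<close> is represented by \<open>P h\<close>.\<close>
      have "(U ^^ Suc n) (Us k') = V h'" unfolding funpow_Suc_right using n kK by simp
      then have "cinner (Y k) (Us k') = cinner (X (P h)) h'"
        by (intro val[of _ _ "Suc n"] Un) (use n kK in auto)
      then show ?thesis using Ri True by simp
    next
      case False
      with i have i': "i \<in> {1..d - 1}" "d - i \<in> {1..d - 1}" "d - i \<in> {1..d}" "d - (d - i) = i" by auto
      have "(U ^^ Suc n) (R (d - i) (Us k')) = R (d - i) ((U ^^ Suc n) (Us k'))"
        by (rule R_U_pow[OF i'(3), symmetric]) simp
      also have "\<dots> = V (S (d - i) h')"
        unfolding funpow_Suc_right using n kK by (simp add: V_S[OF i'(3)])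
      finally have "cinner (Y k) (R (d - i) (Us k')) = cinner (X (P h)) (S (d - i) h')"
        by (intro val[of _ _ "Suc n"] Un) (use n kK in \<open>auto simp: R_mem[OF i'(3)] S_mem[OF i'(3)]\<close>)
      also have "\<dots> = cinner (X (S i h)) h'" using rel[OF i'(2) n(1,2)] i'(4) by simp
      finally show ?thesis using Ri by (simp add: adj_R[OF i'(1)] kK)
    qed
    then show "cinner ((Y \<circ> R i) k) k' = cinner ((R i \<circ> Y) k) k'"
      using kK by (simp add: K.cinner_adj_right[OF R_bops[OF i]] K.bops_mem[OF Y(1)])
  qed (intro K.comp_bops Y R_bops i)+
  have "onorm Y = onorm X" using Y(2) onorm_compression_le[OF XB Y(1) XY] by simp
  from that[OF Y(1) YR this XY val] show thesis .
qed

theorem toeplitz_iff_unique_symbol: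
  assumes X: "X \<in> bops H"
  shows "X \<in> toeplitz_ops d H S \<longleftrightarrow>
    (\<exists>!Y. Y \<in> commutant K (von_neumann_gen K (R ` {1..d})) \<and> onorm X = onorm Y \<and>
      (\<forall>h\<in>H. V (X h) = orth_proj (V ` H) (Y (V h))))" (is "_ \<longleftrightarrow> (\<exists>!Y. ?Q Y)")
proof -
  have Q: "?Q Y \<longleftrightarrow> Y \<in> bops K \<and> (\<forall>i\<in>{1..d}. Y \<circ> R i = R i \<circ> Y) \<and> onorm X = onorm Y \<and> (\<forall>h\<in>H. X h = W (Y (V h)))" for Y
  proof -
    have "V (X h) = V (W (Y (V h))) \<longleftrightarrow> X h = W (Y (V h))" if "h \<in> H" for h
      by (intro V_inj H.bops_mem[OF X] W_mem)
    then show ?thesis unfolding commutant_iff orth_proj_range_V by auto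
  qed
  show ?thesis
  proof
    assume "X \<in> toeplitz_ops d H S"
    then obtain Y where Y: "Y \<in> bops K" "\<And>i. i \<in> {1..d} \<Longrightarrow> Y \<circ> R i = R i \<circ> Y" "onorm Y = onorm X"
      "\<And>h. h \<in> H \<Longrightarrow> X h = W (Y (V h))" by (rule toeplitz_symbol_exists) blast
    show "\<exists>!Y. ?Q Y" unfolding Q
    proof (rule ex1I[of _ Y])
      show "Y \<in> bops K \<and> (\<forall>i\<in>{1..d}. Y \<circ> R i = R i \<circ> Y) \<and> onorm X = onorm Y \<and> (\<forall>h\<in>H. X h = W (Y (V h)))"
        using Y by simp
      fix Y' assume Y': "Y' \<in> bops K \<and> (\<forall>i\<in>{1..d}. Y' \<circ> R i = R i \<circ> Y') \<and> onorm X = onorm Y' \<and> (\<forall>h\<in>H. X h = W (Y' (V h)))"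
      show "Y' = Y"
      proof (rule symbol_unique[OF _ _ Y(1) Y(2)[OF d_mem]])
        show "W (Y' (V h)) = W (Y (V h))" if "h \<in> H" for h
          using Y' Y(4)[OF that] that by metis
        show "Y' \<in> bops K" using Y' by blast
        show "Y' \<circ> U = U \<circ> Y'" using Y' d_mem by blast
      qed
    qed
  next
    assume "\<exists>!Y. ?Q Y"
    then obtain Y where "?Q Y" by blast
    then show "X \<in> toeplitz_ops d H S" unfolding Q by (intro compression_toeplitz[OF X]) auto
  qed
qed

theorem commute_iff_unique_extension:
  assumes X: "X \<in> bops H"
  shows "(\<forall>i\<in>{1..d}. X \<circ> S i = S i \<circ> X) \<longleftrightarrow>
    (\<exists>!Y. Y \<in> bops K \<and> (\<forall>i\<in>{1..d}. Y \<circ> R i = R i \<circ> Y) \<and>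
      (\<forall>h\<in>H. Y (V h) = V (X h)) \<and> onorm Y = onorm X)" (is "_ \<longleftrightarrow> (\<exists>!Y. ?Q Y)")
proof
  assume comm: "\<forall>i\<in>{1..d}. X \<circ> S i = S i \<circ> X"
  have XS: "X (S i h) = S i (X h)" if "i \<in> {1..d}" for i h using comm that by (metis comp_apply)
  have XH: "X h \<in> H" for h by (rule H.bops_mem[OF X])
  have "X \<in> toeplitz_ops d H S"
    unfolding toeplitz_ops_iff[OF X]
  proof (intro conjI ballI)
    fix h h' assume h: "h \<in> H" "h' \<in> H"
    have val: "cinner (X (P h)) (S i h') = cinner (adj K (R i) (U (V (X h)))) (V h')" if i: "i \<in> {1..d}" for i
    proof -
      have "cinner (X (P h)) (S i h') = cinner (V (P (X h))) (V (S i h'))"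
        using h by (simp add: XS V_cinner S_mem[OF i])
      also have "\<dots> = cinner (U (V (X h))) (R i (V h'))"
        using h XH by (simp add: V_S V_S[OF i])
      finally show ?thesis using h XH by (simp add: K.cinner_adj_left[OF R_bops[OF i]])
    qed
    show "cinner (X (P h)) (P h') = cinner (X h) h'"
      using val[OF d_mem] h XH by (simp add: V_cinner)
    fix i assume i: "i \<in> {1..d - 1}"
    then have i': "i \<in> {1..d}" "d - i \<in> {1..d}" by auto
    show "cinner (X (P h)) (S i h') = cinner (X (S (d - i) h)) h'"
      using val[OF i'(1)] h XH S_mem[OF i'(2)]
      by (simp add: adj_R_U[OF i] V_S[OF i'(2), symmetric] V_cinner XS[OF i'(2)])
  qed
  then obtain Y where Y: "Y \<in> bops K" "\<And>i. i \<in> {1..d} \<Longrightarrow> Y \<circ> R i = R i \<circ> Y" "onorm Y = onorm X"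
    "\<And>h. h \<in> H \<Longrightarrow> X h = W (Y (V h))"
    and val: "\<And>k k' n h h'. k \<in> K \<Longrightarrow> k' \<in> K \<Longrightarrow> (U ^^ n) k = V h \<Longrightarrow> (U ^^ n) k' = V h' \<Longrightarrow> h \<in> H \<Longrightarrow> h' \<in> H \<Longrightarrow>
      cinner (Y k) k' = cinner (X h) h'" by (rule toeplitz_symbol_exists) blast
  \<comment> \<open>At level n the vector \<open>V h\<close> is represented by \<open>P^n h\<close>,
    and \<open>X\<close> can be moved past \<open>P^n\<close>. So \<open>Y (V h)\<close> and
    \<open>V (X h)\<close> have the same coefficients against the dense set
    \<open>core\<close>.\<close>
  have ext: "Y (V h) = V (X h)" if h: "h \<in> H" for h
  proof -
    have core_eq: "cinner (Y (V h)) k' = cinner (V (X h)) k'" if k': "k' \<in> core" for k'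
    proof -
      obtain n g h' where n: "g \<in> H" "h' \<in> H" "(U ^^ n) (V h) = V g" "(U ^^ n) k' = V h'"
        by (rule common_level[OF V_core[OF h] k'])
      have "V g = V ((P ^^ n) h)" by (simp only: V_P_pow[OF h] n(3))
      then have g: "g = (P ^^ n) h" using V_inj[of g "(P ^^ n) h"] n(1) h by simp
      have "X ((P ^^ n) h) = (P ^^ n) (X h)" for h by (induction n) (simp_all add: XS)
      then have "V (X g) = (U ^^ n) (V (X h))" using XH by (simp add: g V_P_pow)
      moreover have "cinner (Y (V h)) k' = cinner (X g) h'"
        by (rule val[OF _ _ n(3,4,1,2)]) (use h core_K[OF k'] in auto)
      moreover have "cinner (X g) h' = cinner (V (X g)) (V h')"
        by (rule V_cinner[OF XH n(2), symmetric])
      moreover have "cinner ((U ^^ n) (V (X h))) ((U ^^ n) k') = cinner (V (X h)) k'"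
        using core_K[OF k'] XH by (simp add: cinner_U_pow)
      ultimately show ?thesis using n(4) by metis
    qed
    have "cinner (Y (V h)) z = cinner (V (X h)) z" if "z \<in> K" for z
    proof -
      have "z \<in> closure core" using that by (simp add: dense)
      then obtain f where f: "\<And>n. f n \<in> core" "f \<longlonglongrightarrow> z"
        unfolding closure_sequential by blast
      have "(\<lambda>n. cinner (Y (V h)) (f n)) \<longlonglongrightarrow> cinner (Y (V h)) z"
        "(\<lambda>n. cinner (V (X h)) (f n)) \<longlonglongrightarrow> cinner (V (X h)) z" by (intro tendsto_intros f)+
      then show ?thesis unfolding core_eq[OF f(1)] by (rule LIMSEQ_unique)
    qed
    then show ?thesis by (intro K.eqI_cinner) (auto simp: K.bops_mem[OF Y(1)] XH)
  qed
  show "\<exists>!Y. ?Q Y"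
  proof (rule ex1I[of _ Y])
    show "?Q Y" using Y ext by simp
    fix Y' assume Y': "?Q Y'"
    show "Y' = Y"
    proof (rule symbol_unique[OF _ _ Y(1) Y(2)[OF d_mem]])
      show "W (Y' (V h)) = W (Y (V h))" if "h \<in> H" for h
        unfolding ext[OF that] using Y' that by metis
      show "Y' \<in> bops K" using Y' by blast
      show "Y' \<circ> U = U \<circ> Y'" using Y' d_mem by blast
    qed
  qed
next
  assume "\<exists>!Y. ?Q Y"
  then obtain Y where Y: "Y \<in> bops K" "\<And>i. i \<in> {1..d} \<Longrightarrow> Y \<circ> R i = R i \<circ> Y" "\<And>h. h \<in> H \<Longrightarrow> Y (V h) = V (X h)"
    by blast
  show "\<forall>i\<in>{1..d}. X \<circ> S i = S i \<circ> X"
  proof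
    fix i assume i: "i \<in> {1..d}"
    show "X \<circ> S i = S i \<circ> X"
    proof (rule H.bops_eqI)
      fix h assume h: "h \<in> H"
      have "V (X (S i h)) = Y (R i (V h))" using h S_mem[OF i] by (simp add: Y(3)[symmetric] V_S[OF i])
      also have "\<dots> = R i (Y (V h))" using Y(2)[OF i] by (metis comp_apply)
      also have "\<dots> = V (S i (X h))" using h by (simp add: Y(3) V_S[OF i] H.bops_mem[OF X])
      finally show "(X \<circ> S i) h = (S i \<circ> X) h"
        using V_inj H.bops_mem[OF X] S_mem[OF i] by simp
    qed (intro H.comp_bops X S_bops i)+
  qed
qed

end

subsection \<open>Norm limits and generated C*-algebras\<close>

context closed_csubspace
begin

definition norm_lim :: "(nat \<Rightarrow> 'a \<Rightarrow> 'a) \<Rightarrow> ('a \<Rightarrow> 'a) \<Rightarrow> bool"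
  where "norm_lim F A \<longleftrightarrow> (\<lambda>n. onorm (\<lambda>x. F n x - A x)) \<longlonglongrightarrow> 0"

lemma norm_limI:
  assumes "\<And>n. F n \<in> bops M" "A \<in> bops M" "e \<longlonglongrightarrow> 0" "\<And>n. onorm (\<lambda>x. F n x - A x) \<le> e n"
  shows "norm_lim F A"
  unfolding norm_lim_def
  by (rule tendsto_sandwich[OF _ _ tendsto_const assms(3)])
    (use assms in \<open>auto intro!: always_eventually onorm_nonneg diff_bops\<close>)

lemma norm_lim_const: "norm_lim (\<lambda>_. A) A"
  by (simp add: norm_lim_def onorm_def)

lemma norm_lim_add:
  assumes FA: "\<And>n. F n \<in> bops M" "A \<in> bops M" "norm_lim F A"
    and GB: "\<And>n. G n \<in> bops M" "B \<in> bops M" "norm_lim G B"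
  shows "norm_lim (\<lambda>n x. F n x + G n x) (\<lambda>x. A x + B x)"
proof (rule norm_limI)
  show "(\<lambda>n. onorm (\<lambda>x. F n x - A x) + onorm (\<lambda>x. G n x - B x)) \<longlonglongrightarrow> 0"
    using tendsto_add[OF FA(3)[unfolded norm_lim_def] GB(3)[unfolded norm_lim_def]] by simp
  show "onorm (\<lambda>x. F n x + G n x - (A x + B x)) \<le> onorm (\<lambda>x. F n x - A x) + onorm (\<lambda>x. G n x - B x)" for n
    using onorm_add_le[OF diff_bops[OF FA(1)[of n] FA(2)] diff_bops[OF GB(1)[of n] GB(2)]]
    by (simp add: algebra_simps)
qed (use FA GB in \<open>auto intro: add_bops\<close>)

lemma norm_lim_scale:
  assumes FA: "\<And>n. F n \<in> bops M" "A \<in> bops M" "norm_lim F A"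
  shows "norm_lim (\<lambda>n x. c *\<^sub>C F n x) (\<lambda>x. c *\<^sub>C A x)"
proof (rule norm_limI)
  show "(\<lambda>n. cmod c * onorm (\<lambda>x. F n x - A x)) \<longlonglongrightarrow> 0"
    using tendsto_mult_left[OF FA(3)[unfolded norm_lim_def], of "cmod c"] by simp
  show "onorm (\<lambda>x. c *\<^sub>C F n x - c *\<^sub>C A x) \<le> cmod c * onorm (\<lambda>x. F n x - A x)" for n
    using onorm_scale_le[OF diff_bops[OF FA(1)[of n] FA(2)], of c] by (simp add: scaleC_diff_right)
qed (use FA in \<open>auto intro: scale_bops\<close>)

lemma norm_lim_diff:
  assumes FA: "\<And>n. F n \<in> bops M" "A \<in> bops M" "norm_lim F A"
    and GB: "\<And>n. G n \<in> bops M" "B \<in> bops M" "norm_lim G B"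
  shows "norm_lim (\<lambda>n x. F n x - G n x) (\<lambda>x. A x - B x)"
  using norm_lim_add[OF FA, of "\<lambda>n x. (- 1) *\<^sub>C G n x" "\<lambda>x. (- 1) *\<^sub>C B x"]
    norm_lim_scale[OF GB, of "- 1"] scale_bops[of "G _" "- 1"] scale_bops[of B "- 1"] GB
  by simp

lemma norm_lim_comp:
  assumes FA: "\<And>n. F n \<in> bops M" "A \<in> bops M" "norm_lim F A"
    and GB: "\<And>n. G n \<in> bops M" "B \<in> bops M" "norm_lim G B"
  shows "norm_lim (\<lambda>n. F n \<circ> G n) (A \<circ> B)"
proof (rule norm_limI)
  let ?e = "\<lambda>n. onorm (\<lambda>x. F n x - A x)" and ?f = "\<lambda>n. onorm (\<lambda>x. G n x - B x)"
  have "(\<lambda>n. ?e n * (?f n + onorm B) + onorm A * ?f n) \<longlonglongrightarrow> 0 * (0 + onorm B) + onorm A * 0"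
    by (intro tendsto_intros FA(3)[unfolded norm_lim_def] GB(3)[unfolded norm_lim_def])
  then show "(\<lambda>n. ?e n * (?f n + onorm B) + onorm A * ?f n) \<longlonglongrightarrow> 0" by simp
  fix n
  have B: "(\<lambda>x. F n x - A x) \<in> bops M" "(\<lambda>x. G n x - B x) \<in> bops M" using FA GB by auto
  have "onorm (G n) \<le> ?f n + onorm B"
    using onorm_add_le[OF B(2) GB(2)] by simp
  then have "?e n * onorm (G n) \<le> ?e n * (?f n + onorm B)"
    by (intro mult_left_mono onorm_nonneg B)
  moreover have "onorm (\<lambda>x. (F n \<circ> G n) x - (A \<circ> B) x)
      \<le> onorm ((\<lambda>x. F n x - A x) \<circ> G n) + onorm (A \<circ> (\<lambda>x. G n x - B x))"
  proof -
    have "(\<lambda>x. (F n \<circ> G n) x - (A \<circ> B) x)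
        = (\<lambda>x. ((\<lambda>x. F n x - A x) \<circ> G n) x + (A \<circ> (\<lambda>x. G n x - B x)) x)"
      by (rule ext) (simp add: bops_diff[OF FA(2) bops_mem[OF GB(1)] bops_mem[OF GB(2)]])
    then show ?thesis using onorm_add_le[OF comp_bops[OF B(1) GB(1)] comp_bops[OF FA(2) B(2)]] by simp
  qed
  ultimately show "onorm (\<lambda>x. (F n \<circ> G n) x - (A \<circ> B) x) \<le> ?e n * (?f n + onorm B) + onorm A * ?f n"
    using onorm_comp_le[OF B(1) GB(1)[of n]] onorm_comp_le[OF FA(2) B(2)] by linarith
qed (use FA GB in \<open>auto intro: comp_bops\<close>)

lemma norm_lim_adj:
  assumes FA: "\<And>n. F n \<in> bops M" "A \<in> bops M" "norm_lim F A"
  shows "norm_lim (\<lambda>n. adj M (F n)) (adj M A)"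
proof -
  have "onorm (\<lambda>x. adj M (F n) x - adj M A x) = onorm (\<lambda>x. F n x - A x)" for n
    using onorm_adj[OF diff_bops[OF FA(1)[of n] FA(2)]] by (simp add: adj_diff FA)
  then show ?thesis using FA(3) by (simp add: norm_lim_def)
qed

lemma norm_lim_apply:
  assumes FA: "\<And>n. F n \<in> bops M" "A \<in> bops M" "norm_lim F A"
  shows "(\<lambda>n. F n x) \<longlonglongrightarrow> A x"
proof -
  have "(\<lambda>n. onorm (\<lambda>x. F n x - A x) * norm x) \<longlonglongrightarrow> 0"
    using tendsto_mult_right[OF FA(3)[unfolded norm_lim_def], of "norm x"] by simp
  then have "(\<lambda>n. F n x - A x) \<longlonglongrightarrow> 0"
    by (rule Lim_null_comparison[rotated])
      (intro always_eventually allI norm_le_onorm[OF diff_bops[OF FA(1,2)]])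
  then show ?thesis by (simp add: LIM_zero_iff)
qed

lemma norm_closedI:
  assumes "\<And>F A. A \<in> bops M \<Longrightarrow> (\<And>n. F n \<in> \<A>) \<Longrightarrow> norm_lim F A \<Longrightarrow> A \<in> \<A>"
  shows "norm_closed M \<A>"
  using assms unfolding norm_closed_def norm_lim_def by blast

lemma norm_closedD: "norm_closed M \<A> \<Longrightarrow> A \<in> bops M \<Longrightarrow> (\<And>n. F n \<in> \<A>) \<Longrightarrow> norm_lim F A \<Longrightarrow> A \<in> \<A>"
  unfolding norm_closed_def norm_lim_def by blast

definition norm_closure :: "('a \<Rightarrow> 'a) set \<Rightarrow> ('a \<Rightarrow> 'a) set"
  where "norm_closure \<A> = {A \<in> bops M. \<exists>F. (\<forall>n. F n \<in> \<A>) \<and> norm_lim F A}"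

lemma norm_closure_subset: "\<A> \<subseteq> bops M \<Longrightarrow> \<A> \<subseteq> norm_closure \<A>"
proof
  fix A assume "\<A> \<subseteq> bops M" "A \<in> \<A>"
  then show "A \<in> norm_closure \<A>"
    unfolding norm_closure_def using norm_lim_const[of A] by (auto intro!: exI[of _ "\<lambda>_. A"])
qed

lemma norm_closureE:
  assumes "A \<in> norm_closure \<A>"
  obtains F where "\<And>n. F n \<in> \<A>" "norm_lim F A"
  using assms unfolding norm_closure_def by blast

lemma norm_closed_norm_closure:
  assumes "\<A> \<subseteq> bops M"
  shows "norm_closed M (norm_closure \<A>)"
proof (rule norm_closedI)
  fix F A assume A: "A \<in> bops M" and F: "\<And>n. F n \<in> norm_closure \<A>" and lim: "norm_lim F A"
  have FB: "F n \<in> bops M" for n using F by (auto simp: norm_closure_def)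
  have "\<exists>D\<in>\<A>. onorm (\<lambda>x. D x - F n x) < 1 / real (Suc n)" for n
  proof -
    obtain G where G: "\<And>k. G k \<in> \<A>" "norm_lim G (F n)" using norm_closureE[OF F] by blast
    have "\<forall>\<^sub>F k in sequentially. onorm (\<lambda>x. G k x - F n x) < 1 / real (Suc n)"
      using G(2) unfolding norm_lim_def by (rule order_tendstoD) simp
    then show ?thesis using G(1) by (auto simp: eventually_sequentially)
  qed
  then obtain D where D: "\<And>n. D n \<in> \<A>" "\<And>n. onorm (\<lambda>x. D n x - F n x) < 1 / real (Suc n)" by metis
  have DB: "D n \<in> bops M" for n using D(1) assms by blast
  have "norm_lim D A"
  proof (rule norm_limI[OF DB A])
    show "(\<lambda>n. 1 / real (Suc n) + onorm (\<lambda>x. F n x - A x)) \<longlonglongrightarrow> 0"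
      using tendsto_add[OF LIMSEQ_Suc[OF lim_const_over_n[of 1]] lim[unfolded norm_lim_def]] by simp
    show "onorm (\<lambda>x. D n x - A x) \<le> 1 / real (Suc n) + onorm (\<lambda>x. F n x - A x)" for n
      using onorm_add_le[OF diff_bops[OF DB[of n] FB[of n]] diff_bops[OF FB[of n] A]] D(2)[of n] by simp
  qed
  then show "A \<in> norm_closure \<A>" using A D(1) by (auto simp: norm_closure_def)
qed

lemma cstar_norm_closure:
  assumes star: "star_subalgebra M \<A>"
  shows "cstar_subalgebra M (norm_closure \<A>)"
  unfolding cstar_subalgebra_def
proof
  have sub: "\<A> \<subseteq> bops M" using star by (simp add: star_subalgebra_def)
  then show "norm_closed M (norm_closure \<A>)" by (rule norm_closed_norm_closure)
  show "star_subalgebra M (norm_closure \<A>)"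
    unfolding star_subalgebra_def
  proof (intro conjI ballI allI)
    show "norm_closure \<A> \<subseteq> bops M" by (auto simp: norm_closure_def)
    show "id_op M \<in> norm_closure \<A>"
      using norm_closure_subset[OF sub] star by (auto simp: star_subalgebra_def)
    fix A assume A: "A \<in> norm_closure \<A>"
    then have AB: "A \<in> bops M" by (simp add: norm_closure_def)
    obtain F where F: "\<And>n. F n \<in> \<A>" "norm_lim F A" using norm_closureE[OF A] by blast
    have FB: "\<And>n. F n \<in> bops M" using F sub by blast
    show "(\<lambda>x. c *\<^sub>C A x) \<in> norm_closure \<A>" for c
      using norm_lim_scale[OF FB AB F(2), of c] F(1) star scale_bops[OF AB]
      by (auto simp: norm_closure_def star_subalgebra_def intro!: exI[of _ "\<lambda>n x. c *\<^sub>C F n x"])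
    show "adj M A \<in> norm_closure \<A>"
      using norm_lim_adj[OF FB AB F(2)] F(1) star adj_bops[OF AB]
      by (auto simp: norm_closure_def star_subalgebra_def intro!: exI[of _ "\<lambda>n. adj M (F n)"])
    fix B assume B: "B \<in> norm_closure \<A>"
    then have BB: "B \<in> bops M" by (simp add: norm_closure_def)
    obtain G where G: "\<And>n. G n \<in> \<A>" "norm_lim G B" using norm_closureE[OF B] by blast
    have GB: "\<And>n. G n \<in> bops M" using G sub by blast
    show "(\<lambda>x. A x + B x) \<in> norm_closure \<A>"
      using norm_lim_add[OF FB AB F(2) GB BB G(2)] F(1) G(1) star add_bops[OF AB BB]
      by (auto simp: norm_closure_def star_subalgebra_def intro!: exI[of _ "\<lambda>n x. F n x + G n x"])
    show "A \<circ> B \<in> norm_closure \<A>"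
      using norm_lim_comp[OF FB AB F(2) GB BB G(2)] F(1) G(1) star comp_bops[OF AB BB]
      by (auto simp: norm_closure_def star_subalgebra_def intro!: exI[of _ "\<lambda>n. F n \<circ> G n"])
  qed
qed

lemma cstar_bops: "cstar_subalgebra M (bops M)"
  by (auto simp: cstar_subalgebra_def star_subalgebra_def norm_closed_def)

text \<open>The hull intersects a nonempty family, as the algebra of all bounded operators
  qualifies; this also keeps the intersection inside \<open>bops M\<close>.\<close>

lemma cstar_gen_cstar:
  assumes "G \<subseteq> bops M"
  shows "cstar_subalgebra M (cstar_gen M G)"
proof -
  have sub: "cstar_gen M G \<subseteq> bops M"
    unfolding cstar_gen_def using assms cstar_bops by (intro hull_minimal)
  have "star_subalgebra M (cstar_gen M G)"
    using sub by (auto simp: star_subalgebra_def cstar_gen_def hull_def cstar_subalgebra_def)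
  moreover have "norm_closed M (cstar_gen M G)"
    unfolding cstar_gen_def hull_def cstar_subalgebra_def norm_closed_def by blast
  ultimately show ?thesis by (simp add: cstar_subalgebra_def)
qed

lemma cstar_gen_subset: "G \<subseteq> cstar_gen M G"
  unfolding cstar_gen_def by (rule hull_subset)

lemma cstar_gen_minimal: "G \<subseteq> \<A> \<Longrightarrow> cstar_subalgebra M \<A> \<Longrightarrow> cstar_gen M G \<subseteq> \<A>"
  unfolding cstar_gen_def by (rule hull_minimal)

context
  fixes \<A> assumes cstar: "cstar_subalgebra M \<A>"
begin

lemma cstar_bopsD: "A \<in> \<A> \<Longrightarrow> A \<in> bops M"
  and cstar_id: "id_op M \<in> \<A>"
  and cstar_add: "A \<in> \<A> \<Longrightarrow> B \<in> \<A> \<Longrightarrow> (\<lambda>x. A x + B x) \<in> \<A>"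
  and cstar_comp: "A \<in> \<A> \<Longrightarrow> B \<in> \<A> \<Longrightarrow> A \<circ> B \<in> \<A>"
  and cstar_scale: "A \<in> \<A> \<Longrightarrow> (\<lambda>x. c *\<^sub>C A x) \<in> \<A>"
  and cstar_adj: "A \<in> \<A> \<Longrightarrow> adj M A \<in> \<A>"
  and cstar_closed: "norm_closed M \<A>"
  using cstar by (auto simp: cstar_subalgebra_def star_subalgebra_def)

lemma cstar_diff: "A \<in> \<A> \<Longrightarrow> B \<in> \<A> \<Longrightarrow> (\<lambda>x. A x - B x) \<in> \<A>"
  using cstar_add[of A "\<lambda>x. (- 1) *\<^sub>C B x"] cstar_scale[of B "- 1"] by simp

lemma cstar_zero: "(\<lambda>_. 0) \<in> \<A>"
  using cstar_diff[OF cstar_id cstar_id] by simp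

end

lemma cstar_commutant:
  assumes Y: "Y \<in> bops M"
  shows "cstar_subalgebra M {A \<in> bops M. A \<circ> Y = Y \<circ> A \<and> A \<circ> adj M Y = adj M Y \<circ> A}"
    (is "cstar_subalgebra M ?C")
  unfolding cstar_subalgebra_def
proof
  show "star_subalgebra M ?C"
    using von_neumann_algebra_commutant[OF Y] by (simp add: von_neumann_algebra_def)
  have lim: "A \<circ> T = T \<circ> A"
    if T: "T \<in> bops M" and A: "A \<in> bops M" and F: "\<And>n. F n \<in> bops M" "\<And>n. F n \<circ> T = T \<circ> F n" "norm_lim F A" for T A F
  proof (rule bops_eqI)
    fix x assume x: "x \<in> M"
    have "(\<lambda>n. F n (T x)) \<longlonglongrightarrow> A (T x)" by (rule norm_lim_apply[OF F(1) A F(3)])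
    moreover have "(\<lambda>n. T (F n x)) \<longlonglongrightarrow> T (A x)"
      by (rule bops_tendsto[OF T bops_mem[OF F(1)] norm_lim_apply[OF F(1) A F(3)]])
    moreover have "F n (T x) = T (F n x)" for n using F(2)[of n] by (metis comp_apply)
    ultimately show "(A \<circ> T) x = (T \<circ> A) x" using LIMSEQ_unique by simp
  qed (use T A in \<open>auto intro: comp_bops\<close>)
  show "norm_closed M ?C"
  proof (rule norm_closedI)
    fix F A assume A: "A \<in> bops M" and F: "\<And>n. F n \<in> ?C" "norm_lim F A"
    have "A \<circ> Y = Y \<circ> A" by (rule lim[OF Y A _ _ F(2)]) (use F(1) in auto)
    moreover have "A \<circ> adj M Y = adj M Y \<circ> A"
      by (rule lim[OF adj_bops[OF Y] A _ _ F(2)]) (use F(1) in auto)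
    ultimately show "A \<in> ?C" using A by simp
  qed
qed

end

subsection \<open>The symbol map\<close>

context minimal_extension
begin

lemma Phi_add: "k \<in> K \<Longrightarrow> X \<in> bops H \<Longrightarrow> X' \<in> bops H \<Longrightarrow> Phi m (\<lambda>x. X x + X' x) k = Phi m X k + Phi m X' k"
  by (simp add: Phi_apply V_add H.bops_mem Us_pow_linear)

lemma Phi_scale: "k \<in> K \<Longrightarrow> X \<in> bops H \<Longrightarrow> Phi m (\<lambda>x. c *\<^sub>C X x) k = c *\<^sub>C Phi m X k"
  by (simp add: Phi_apply V_scale H.bops_mem Us_pow_linear)

lemma Phi_diff: "k \<in> K \<Longrightarrow> X \<in> bops H \<Longrightarrow> X' \<in> bops H \<Longrightarrow> Phi m (\<lambda>x. X x - X' x) k = Phi m X k - Phi m X' k"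
  using Phi_add[of k X "\<lambda>x. (- 1) *\<^sub>C X' x" m] Phi_scale[of k X' m "- 1"] H.scale_bops[of X' "- 1"] by simp

text \<open>In the product the inner factors cancel by \<open>U^m U^{-m} = 1\<close> and
  \<open>V^* V = 1\<close>. This exact multiplicativity at every level is what strong limits
  inherit.\<close>

lemma Phi_comp: "k \<in> K \<Longrightarrow> X \<in> bops H \<Longrightarrow> X' \<in> bops H \<Longrightarrow> Phi m (X \<circ> X') k = Phi m X (Phi m X' k)"
  by (simp add: Phi_apply H.bops_mem)

lemma cinner_Phi_adj:
  assumes X: "X \<in> bops H" and k: "k \<in> K" "k' \<in> K"
  shows "cinner (Phi m X k) k' = cinner k (Phi m (adj H X) k')"
proof -
  have "cinner (Phi m X k) k' = cinner (W ((U ^^ m) k)) (adj H X (W ((U ^^ m) k')))"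
    using X k by (simp add: cinner_Phi H.cinner_adj_right)
  also have "\<dots> = cnj (cinner (Phi m (adj H X) k') k)"
    using X k by (subst cinner_commute) (simp add: cinner_Phi H.adj_bops)
  also have "\<dots> = cinner k (Phi m (adj H X) k')" by (simp add: cinner_commute[of k])
  finally show ?thesis .
qed

definition sconv :: "('a \<Rightarrow> 'a) \<Rightarrow> bool"
  where "sconv X \<longleftrightarrow> (\<forall>k\<in>K. convergent (\<lambda>m. Phi m X k))"

text \<open>Meaningful under \<open>sconv X\<close> only; otherwise \<open>lim\<close> may be an
  unspecified value.\<close>

definition symbol :: "('a \<Rightarrow> 'a) \<Rightarrow> 'b \<Rightarrow> 'b"
  where "symbol X = restrict_op K (\<lambda>k. lim (\<lambda>m. Phi m X k))"

lemma symbol_lim: "sconv X \<Longrightarrow> k \<in> K \<Longrightarrow> (\<lambda>m. Phi m X k) \<longlonglongrightarrow> symbol X k"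
  by (simp add: sconv_def symbol_def restrict_op_def convergent_LIMSEQ_iff)

lemma sconvI: "(\<And>k. k \<in> K \<Longrightarrow> (\<lambda>m. Phi m X k) \<longlonglongrightarrow> Y k) \<Longrightarrow> sconv X"
  unfolding sconv_def convergent_def by blast

lemma symbol_eqI:
  assumes "Y \<in> bops K" "\<And>k. k \<in> K \<Longrightarrow> (\<lambda>m. Phi m X k) \<longlonglongrightarrow> Y k"
  shows "symbol X = Y"
  using assms by (auto simp: symbol_def restrict_op_def K.bops_off limI)

text \<open>The operators \<open>Phi m X\<close> are bounded by \<open>onorm X\<close> uniformly in
  \<open>m\<close>, so convergence on a dense set extends to all of \<open>K\<close>.\<close>

lemma Phi_strong_limit_core:
  assumes X: "X \<in> bops H" and Y: "Y \<in> bops K"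
    and lim: "\<And>k. k \<in> core \<Longrightarrow> (\<lambda>m. Phi m X k) \<longlonglongrightarrow> Y k" and k: "k \<in> K"
  shows "(\<lambda>m. Phi m X k) \<longlonglongrightarrow> Y k"
proof (rule LIMSEQ_I)
  fix r :: real assume r: "0 < r"
  define C where "C = onorm X + onorm Y + 1"
  have C: "0 < C" using H.onorm_nonneg[OF X] K.onorm_nonneg[OF Y] by (simp add: C_def)
  obtain c where c: "c \<in> core" "norm (k - c) < r / (2 * C)"
    using core_approx[OF k, of "r / (2 * C)"] r C by auto
  have cK: "c \<in> K" using c core_K by auto
  obtain N where N: "\<And>m. N \<le> m \<Longrightarrow> norm (Phi m X c - Y c) < r / 2"
    using LIMSEQ_D[OF lim[OF c(1)], of "r / 2"] r by auto
  have "norm (Phi m X k - Y k) < r" if "N \<le> m" for m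
  proof -
    have "Phi m X k - Y k = (Phi m X (k - c) - Y (k - c)) + (Phi m X c - Y c)"
      by (simp add: K.bops_diff[OF Phi_bops[OF X]] K.bops_diff[OF Y] k cK)
    also have "norm \<dots> \<le> (norm (Phi m X (k - c)) + norm (Y (k - c))) + norm (Phi m X c - Y c)"
      by (intro norm_triangle_mono norm_triangle_ineq4 order_refl)
    also have "norm (Phi m X (k - c)) + norm (Y (k - c)) \<le> onorm X * norm (k - c) + onorm Y * norm (k - c)"
      by (intro add_mono norm_Phi[OF X] K.norm_le_onorm[OF Y] K.diff_mem k cK)
    also have "\<dots> \<le> C * norm (k - c)" by (simp add: C_def algebra_simps)
    also have "\<dots> \<le> C * (r / (2 * C))" using C c(2) by (intro mult_left_mono) auto
    also have "\<dots> = r / 2" using C by simp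
    finally show ?thesis using N[OF that] by simp
  qed
  then show "\<exists>N. \<forall>m\<ge>N. norm (Phi m X k - Y k) < r" by blast
qed

lemma symbol_bops:
  assumes X: "X \<in> bops H" and c: "sconv X"
  shows "symbol X \<in> bops K"
proof (rule K.bopsI[where B = "onorm X"])
  note PB = Phi_bops[OF X]
  show "symbol X (x + y) = symbol X x + symbol X y" if xy: "x \<in> K" "y \<in> K" for x y
    using LIMSEQ_unique[OF symbol_lim[OF c K.add_mem[OF xy]]]
      tendsto_add[OF symbol_lim[OF c xy(1)] symbol_lim[OF c xy(2)]]
    by (simp add: K.bops_add[OF PB] xy)
  show "symbol X (a *\<^sub>C x) = a *\<^sub>C symbol X x" if x: "x \<in> K" for a x
    using LIMSEQ_unique[OF symbol_lim[OF c K.scale_mem[OF x]]] tendsto_scaleC[OF symbol_lim[OF c x], of a]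
    by (simp add: K.bops_scale[OF PB] x)
  show "symbol X x \<in> K" if x: "x \<in> K" for x
    by (rule K.lim_mem[OF _ symbol_lim[OF c x]]) (rule K.bops_mem[OF PB])
  show "norm (symbol X x) \<le> onorm X * norm x" if x: "x \<in> K" for x
    by (rule LIMSEQ_le_const2[OF tendsto_norm[OF symbol_lim[OF c x]]]) (use norm_Phi[OF X x] in blast)
qed (simp add: symbol_def restrict_op_def)

lemma onorm_symbol_le:
  assumes X: "X \<in> bops H" and c: "sconv X"
  shows "onorm (symbol X) \<le> onorm X"
proof (rule K.onorm_leI[OF symbol_bops[OF X c] H.onorm_nonneg[OF X]])
  show "norm (symbol X x) \<le> onorm X * norm x" if x: "x \<in> K" for x
    by (rule LIMSEQ_le_const2[OF tendsto_norm[OF symbol_lim[OF c x]]]) (use norm_Phi[OF X x] in blast)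
qed

lemma
  assumes X: "X \<in> bops H" "sconv X" and Y: "Y \<in> bops H" "sconv Y"
  shows sconv_add: "sconv (\<lambda>x. X x + Y x)" and symbol_add: "symbol (\<lambda>x. X x + Y x) = (\<lambda>y. symbol X y + symbol Y y)"
    and sconv_comp: "sconv (X \<circ> Y)" and symbol_comp: "symbol (X \<circ> Y) = symbol X \<circ> symbol Y"
proof -
  note sX = symbol_bops[OF X] and sY = symbol_bops[OF Y]
  have add: "(\<lambda>m. Phi m (\<lambda>x. X x + Y x) k) \<longlonglongrightarrow> symbol X k + symbol Y k" if k: "k \<in> K" for k
    using tendsto_add[OF symbol_lim[OF X(2) k] symbol_lim[OF Y(2) k]] by (simp add: Phi_add k X Y)
  then show "sconv (\<lambda>x. X x + Y x)" by (rule sconvI)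
  show "symbol (\<lambda>x. X x + Y x) = (\<lambda>y. symbol X y + symbol Y y)"
    by (rule symbol_eqI[OF K.add_bops[OF sX sY] add])
  \<comment> \<open>Multiplication is not jointly continuous for strong limits in general; here the
    uniform bound on \<open>Phi m X\<close> controls the term with
    \<open>Phi m Y k - symbol Y k\<close>.\<close>
  have comp: "(\<lambda>m. Phi m (X \<circ> Y) k) \<longlonglongrightarrow> (symbol X \<circ> symbol Y) k" if k: "k \<in> K" for k
  proof -
    have sk: "symbol Y k \<in> K" by (rule K.bops_mem[OF sY])
    have "(\<lambda>m. norm (Phi m Y k - symbol Y k)) \<longlonglongrightarrow> 0"
      using symbol_lim[OF Y(2) k] by (simp add: LIM_zero_iff tendsto_norm_zero_iff)
    then have "(\<lambda>m. onorm X * norm (Phi m Y k - symbol Y k)) \<longlonglongrightarrow> 0"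
      using tendsto_mult_left[of _ 0 _ "onorm X"] by force
    then have "(\<lambda>m. Phi m X (Phi m Y k - symbol Y k)) \<longlonglongrightarrow> 0"
      by (rule Lim_null_comparison[rotated])
        (intro always_eventually allI norm_Phi X K.diff_mem sk K.bops_mem[OF Phi_bops[OF Y(1)]])
    from tendsto_add[OF this symbol_lim[OF X(2) sk]] show ?thesis
      by (simp add: Phi_comp k X Y K.bops_diff[OF Phi_bops[OF X(1)]] sk K.bops_mem[OF Phi_bops[OF Y(1)]])
  qed
  then show "sconv (X \<circ> Y)" by (rule sconvI)
  show "symbol (X \<circ> Y) = symbol X \<circ> symbol Y"
    by (rule symbol_eqI[OF K.comp_bops[OF sX sY] comp])
qed

lemma
  assumes X: "X \<in> bops H" "sconv X"
  shows sconv_scale: "sconv (\<lambda>x. c *\<^sub>C X x)" and symbol_scale: "symbol (\<lambda>x. c *\<^sub>C X x) = (\<lambda>y. c *\<^sub>C symbol X y)"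
proof -
  have lim: "(\<lambda>m. Phi m (\<lambda>x. c *\<^sub>C X x) k) \<longlonglongrightarrow> c *\<^sub>C symbol X k" if k: "k \<in> K" for k
    using tendsto_scaleC[OF symbol_lim[OF X(2) k], of c] by (simp add: Phi_scale k X)
  then show "sconv (\<lambda>x. c *\<^sub>C X x)" by (rule sconvI)
  show "symbol (\<lambda>x. c *\<^sub>C X x) = (\<lambda>y. c *\<^sub>C symbol X y)"
    by (rule symbol_eqI[OF K.scale_bops[OF symbol_bops[OF X]] lim])
qed

lemma
  assumes X: "X \<in> bops H" "sconv X" and Y: "Y \<in> bops H" "sconv Y"
  shows sconv_diff: "sconv (\<lambda>x. X x - Y x)" and symbol_diff: "symbol (\<lambda>x. X x - Y x) = (\<lambda>y. symbol X y - symbol Y y)"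
  using sconv_add[OF X H.scale_bops[OF Y(1), of "- 1"] sconv_scale[OF Y]]
    symbol_add[OF X H.scale_bops[OF Y(1), of "- 1"] sconv_scale[OF Y]] symbol_scale[OF Y, of "- 1"]
  by simp_all

text \<open>Taking adjoints does not preserve strong convergence, so convergence is assumed for
  \<open>X\<close> and its adjoint. The two limits are then compared through inner products.\<close>

lemma symbol_adj:
  assumes X: "X \<in> bops H" "sconv X" "sconv (adj H X)"
  shows "symbol (adj H X) = adj K (symbol X)"
proof (rule K.adj_eqI[symmetric])
  fix x y assume x: "x \<in> K" "y \<in> K"
  have "(\<lambda>m. cinner (Phi m X x) y) \<longlonglongrightarrow> cinner (symbol X x) y"
    by (intro tendsto_intros symbol_lim X x)
  moreover have "(\<lambda>m. cinner (Phi m X x) y) \<longlonglongrightarrow> cinner x (symbol (adj H X) y)"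
    unfolding cinner_Phi_adj[OF X(1) x] by (intro tendsto_intros symbol_lim X x)
  ultimately show "cinner (symbol X x) y = cinner x (symbol (adj H X) y)" by (rule LIMSEQ_unique)
qed (intro symbol_bops X H.adj_bops)+

text \<open>\<open>Phi m\<close> of the identity is the projection onto \<open>U^{-m} V H\<close>;
  these projections increase to the identity of \<open>K\<close>.\<close>

lemma Phi_id: "k \<in> K \<Longrightarrow> (\<lambda>m. Phi m (id_op H) k) \<longlonglongrightarrow> id_op K k"
proof (rule Phi_strong_limit_core[OF H.id_bops K.id_bops])
  fix k assume k: "k \<in> core"
  obtain n where n: "\<And>m. n \<le> m \<Longrightarrow> (U ^^ m) k \<in> V ` H" by (rule coreE[OF k]) blast
  show "(\<lambda>m. Phi m (id_op H) k) \<longlonglongrightarrow> id_op K k"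
  proof (rule tendsto_eventually, rule eventually_sequentiallyI)
    fix m assume "n \<le> m"
    then obtain h where h: "h \<in> H" "(U ^^ m) k = V h" using n by blast
    have "Phi m (id_op H) k = (Us ^^ m) ((U ^^ m) k)" using core_K[OF k] h by (simp add: Phi_apply)
    then show "Phi m (id_op H) k = id_op K k" using core_K[OF k] by simp
  qed
qed

section \<open>Compression to H as a right inverse of the symbol map\<close>

definition compr :: "('b \<Rightarrow> 'b) \<Rightarrow> 'a \<Rightarrow> 'a"
  where "compr Y = restrict_op H (\<lambda>h. W (Y (V h)))"

lemma compr_apply: "h \<in> H \<Longrightarrow> compr Y h = W (Y (V h))"
  by (simp add: compr_def restrict_op_def)

lemma norm_compr: "Y \<in> bops K \<Longrightarrow> h \<in> H \<Longrightarrow> norm (compr Y h) \<le> onorm Y * norm h"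
  using order_trans[OF norm_W K.norm_le_onorm[of Y "V h"]] by (simp add: compr_apply)

lemma compr_bops: "Y \<in> bops K \<Longrightarrow> compr Y \<in> bops H"
  by (rule H.bopsI[where B = "onorm Y"])
    (use norm_compr in \<open>auto simp: compr_def restrict_op_def K.bops_add K.bops_scale V_add V_scale W_add W_scale
      H.add_mem H.scale_mem\<close>)

lemma onorm_compr_le: "Y \<in> bops K \<Longrightarrow> onorm (compr Y) \<le> onorm Y"
  by (rule H.onorm_leI) (auto simp: compr_bops K.onorm_nonneg norm_compr)

lemma compr_add: "compr (\<lambda>x. Y x + Y' x) = (\<lambda>x. compr Y x + compr Y' x)"
  and compr_diff: "compr (\<lambda>x. Y x - Y' x) = (\<lambda>x. compr Y x - compr Y' x)"
  and compr_scale: "compr (\<lambda>x. c *\<^sub>C Y x) = (\<lambda>x. c *\<^sub>C compr Y x)"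
  by (auto simp: compr_def restrict_op_def W_add W_diff W_scale)

lemma compr_id: "compr (id_op K) = id_op H"
  by (auto simp: compr_def id_op_def restrict_op_def)

lemma compr_adj: "Y \<in> bops K \<Longrightarrow> compr (adj K Y) = adj H (compr Y)"
  by (rule H.adj_eqI[symmetric])
    (auto simp: compr_bops K.adj_bops compr_apply cinner_W_left cinner_W_right K.cinner_adj_right)

lemma compr_R: "i \<in> {1..d} \<Longrightarrow> compr (R i) = S i"
proof (rule H.bops_eqI)
  assume i: "i \<in> {1..d}"
  show "compr (R i) h = S i h" if "h \<in> H" for h
    using that S_mem[OF i] by (simp add: compr_apply V_S[OF i, symmetric])
qed (auto simp: compr_bops R_bops S_bops)

lemma norm_lim_compr:
  assumes "\<And>n. F n \<in> bops K" "A \<in> bops K" "K.norm_lim F A"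
  shows "H.norm_lim (\<lambda>n. compr (F n)) (compr A)"
proof (rule H.norm_limI[OF _ _ assms(3)[unfolded K.norm_lim_def]])
  show "onorm (\<lambda>x. compr (F n) x - compr A x) \<le> onorm (\<lambda>x. F n x - A x)" for n
    using onorm_compr_le[OF K.diff_bops[OF assms(1)[of n] assms(2)]] by (simp add: compr_diff)
qed (use assms compr_bops in auto)

text \<open>For \<open>k\<close> in \<open>core\<close> and large \<open>m\<close> the vector
  \<open>U^m k\<close> lies in the range of \<open>V\<close>, so \<open>V W\<close> leaves it
  unchanged, and \<open>Phi m (compr Y) k\<close> becomes \<open>Phi m\<close> of the identity at
  \<open>Y k\<close>.\<close>

lemma symbol_compr:
  assumes Y: "Y \<in> bops K" "Y \<circ> U = U \<circ> Y"
  shows "sconv (compr Y)" "symbol (compr Y) = Y"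
proof -
  have "(\<lambda>m. Phi m (compr Y) k) \<longlonglongrightarrow> Y k" if "k \<in> K" for k
  proof (rule Phi_strong_limit_core[OF compr_bops[OF Y(1)] Y(1) _ that])
    fix k assume k: "k \<in> core"
    obtain n where n: "\<And>m. n \<le> m \<Longrightarrow> (U ^^ m) k \<in> V ` H" by (rule coreE[OF k]) blast
    have kK: "k \<in> K" "Y k \<in> K" using core_K[OF k] K.bops_mem[OF Y(1)] by auto
    have "\<forall>\<^sub>F m in sequentially. Phi m (id_op H) (Y k) = Phi m (compr Y) k"
    proof (rule eventually_sequentiallyI)
      fix m assume "n \<le> m"
      then obtain h where h: "h \<in> H" "(U ^^ m) k = V h" using n by blast
      have "W ((U ^^ m) (Y k)) = compr Y h"
        by (simp add: compr_apply h commute_Us_pow(2)[OF Y kK(1), symmetric])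
      then show "Phi m (id_op H) (Y k) = Phi m (compr Y) k" using kK h by (simp add: Phi_apply H.bops_mem[OF compr_bops[OF Y(1)]])
    qed
    with Phi_id[OF kK(2)] kK show "(\<lambda>m. Phi m (compr Y) k) \<longlonglongrightarrow> Y k"
      by (simp add: filterlim_cong[OF refl refl])
  qed
  then show "sconv (compr Y)" "symbol (compr Y) = Y" using sconvI symbol_eqI[OF Y(1)] by blast+
qed

section \<open>The symbol map on the C*-algebra generated by S\<close>

definition CS where "CS = cstar_gen H (S ` {1..d})"
definition CR where "CR = cstar_gen K (R ` {1..d})"

lemma CS_cstar: "cstar_subalgebra H CS"
  unfolding CS_def using S_bops by (intro H.cstar_gen_cstar) auto

lemma CR_cstar: "cstar_subalgebra K CR"
  unfolding CR_def using R_bops by (intro K.cstar_gen_cstar) auto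

lemmas CS_bops = H.cstar_bopsD[OF CS_cstar] and CR_bops = K.cstar_bopsD[OF CR_cstar]

lemma S_CS: "i \<in> {1..d} \<Longrightarrow> S i \<in> CS"
  unfolding CS_def by (rule subsetD[OF H.cstar_gen_subset imageI])

lemma R_CR: "i \<in> {1..d} \<Longrightarrow> R i \<in> CR"
  unfolding CR_def by (rule subsetD[OF K.cstar_gen_subset imageI])

text \<open>\<open>Phi m\<close> does not increase norms, whatever \<open>m\<close> is, so strong
  convergence and the symbol both pass to norm limits.\<close>

lemma norm_lim_symbol:
  assumes F: "\<And>n. F n \<in> bops H" "\<And>n. sconv (F n)" "H.norm_lim F A" and A: "A \<in> bops H"
  shows "sconv A" "K.norm_lim (\<lambda>n. symbol (F n)) (symbol A)"
proof -
  show A': "sconv A" unfolding sconv_def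
  proof
    fix k assume k: "k \<in> K"
    show "convergent (\<lambda>m. Phi m A k)"
    proof (rule convergent_uniform_approx)
      fix e :: real assume e: "0 < e"
      have pos: "0 < norm k + 1" by (simp add: add_nonneg_pos)
      have "\<forall>\<^sub>F n in sequentially. onorm (\<lambda>x. F n x - A x) < e / (norm k + 1)"
        using F(3) unfolding H.norm_lim_def by (rule order_tendstoD) (use e pos in simp)
      then obtain n where n: "onorm (\<lambda>x. F n x - A x) < e / (norm k + 1)" by (auto simp: eventually_sequentially)
      have "norm (Phi m A k - Phi m (F n) k) \<le> e" for m
      proof -
        have "norm (Phi m A k - Phi m (F n) k) = norm (Phi m (\<lambda>x. F n x - A x) k)"
          by (simp add: Phi_diff k F A norm_minus_commute)
        also have "\<dots> \<le> onorm (\<lambda>x. F n x - A x) * norm k" by (intro norm_Phi H.diff_bops F A k)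
        also have "\<dots> \<le> (e / (norm k + 1)) * (norm k + 1)" using n e pos by (intro mult_mono) auto
        also have "\<dots> = e" using pos by simp
        finally show ?thesis .
      qed
      then show "\<exists>g. convergent g \<and> (\<forall>m. norm (Phi m A k - g m) \<le> e)"
        using F(2)[of n] k unfolding sconv_def by blast
    qed
  qed
  show "K.norm_lim (\<lambda>n. symbol (F n)) (symbol A)"
  proof (rule K.norm_limI[OF symbol_bops[OF F(1,2)] symbol_bops[OF A A'] F(3)[unfolded H.norm_lim_def]])
    show "onorm (\<lambda>x. symbol (F n) x - symbol A x) \<le> onorm (\<lambda>x. F n x - A x)" for n
      using onorm_symbol_le[OF H.diff_bops[OF F(1)[of n] A] sconv_diff[OF F(1)[of n] F(2)[of n] A A']]
      by (simp add: symbol_diff F A A')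
  qed
qed

lemma R_commutes_U: "i \<in> {1..d} \<Longrightarrow> R i \<circ> U = U \<circ> R i"
proof (rule K.bops_eqI)
  assume i: "i \<in> {1..d}"
  show "(R i \<circ> U) x = (U \<circ> R i) x" if "x \<in> K" for x
    using R_commute[OF i d_mem that] by simp
qed (auto intro!: K.comp_bops R_bops)

lemma adj_R_commutes_U: "i \<in> {1..d} \<Longrightarrow> adj K (R i) \<circ> U = U \<circ> adj K (R i)"
proof (rule K.bops_eqI)
  assume i: "i \<in> {1..d}"
  show "(adj K (R i) \<circ> U) x = (U \<circ> adj K (R i)) x" if "x \<in> K" for x
    using K.unitary_module_star_commute(2)[OF unitary i d_mem that] by simp
qed (auto intro!: K.comp_bops K.adj_bops R_bops)

text \<open>Strong convergence is demanded of the adjoint too: otherwise the set would not be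
  visibly stable under adjoints, nor would the symbol respect them.\<close>

definition symbol_alg :: "('a \<Rightarrow> 'a) set"
  where "symbol_alg = {X \<in> bops H. sconv X \<and> sconv (adj H X) \<and> symbol X \<in> CR}"

lemma symbol_alg_cstar: "cstar_subalgebra H symbol_alg"
  unfolding cstar_subalgebra_def star_subalgebra_def
proof (intro conjI ballI allI)
  show "symbol_alg \<subseteq> bops H" by (auto simp: symbol_alg_def)
  have id: "sconv (id_op H)" "symbol (id_op H) = id_op K"
    using sconvI[OF Phi_id] symbol_eqI[OF K.id_bops Phi_id] by blast+
  show "id_op H \<in> symbol_alg" using id K.cstar_id[OF CR_cstar] by (simp add: symbol_alg_def)
  fix X assume X: "X \<in> symbol_alg"
  then have X': "X \<in> bops H" "sconv X" "sconv (adj H X)" "symbol X \<in> CR" by (auto simp: symbol_alg_def)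
  show "(\<lambda>x. c *\<^sub>C X x) \<in> symbol_alg" for c
    using X' by (simp add: symbol_alg_def H.scale_bops sconv_scale symbol_scale H.adj_scale H.adj_bops
        K.cstar_scale[OF CR_cstar])
  show "adj H X \<in> symbol_alg"
    using X' by (simp add: symbol_alg_def H.adj_bops symbol_adj K.cstar_adj[OF CR_cstar])
  fix Y assume Y: "Y \<in> symbol_alg"
  then have Y': "Y \<in> bops H" "sconv Y" "sconv (adj H Y)" "symbol Y \<in> CR" by (auto simp: symbol_alg_def)
  show "(\<lambda>x. X x + Y x) \<in> symbol_alg"
    using X' Y' by (simp add: symbol_alg_def H.add_bops sconv_add symbol_add H.adj_add H.adj_bops
        K.cstar_add[OF CR_cstar])
  show "X \<circ> Y \<in> symbol_alg"
    using X' Y' by (simp add: symbol_alg_def H.comp_bops sconv_comp symbol_comp H.adj_comp H.adj_bops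
        K.cstar_comp[OF CR_cstar])
next
  show "norm_closed H symbol_alg"
  proof (rule H.norm_closedI)
    fix F A assume A: "A \<in> bops H" and F: "\<And>n. F n \<in> symbol_alg" and lim: "H.norm_lim F A"
    then have F': "\<And>n. F n \<in> bops H" "\<And>n. sconv (F n)" "\<And>n. sconv (adj H (F n))" "\<And>n. symbol (F n) \<in> CR"
      by (auto simp: symbol_alg_def)
    note A1 = norm_lim_symbol[OF F'(1,2) lim A]
    have A2: "sconv (adj H A)"
      by (rule norm_lim_symbol(1)[OF H.adj_bops[OF F'(1)] F'(3) H.norm_lim_adj[OF F'(1) A lim] H.adj_bops[OF A]])
    have "symbol A \<in> CR"
      by (rule K.norm_closedD[OF K.cstar_closed[OF CR_cstar] symbol_bops[OF A A1(1)] F'(4) A1(2)])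
    with A A1 A2 show "A \<in> symbol_alg" by (simp add: symbol_alg_def)
  qed
qed

lemma symbol_S: "i \<in> {1..d} \<Longrightarrow> symbol (S i) = R i"
  using symbol_compr[OF R_bops R_commutes_U] compr_R by metis

text \<open>\<open>S i\<close> and its adjoint are the compressions of \<open>R i\<close> and its
  adjoint, and both of these commute with \<open>U\<close>.\<close>

lemma CS_subset: "CS \<subseteq> symbol_alg"
  unfolding CS_def
proof (rule H.cstar_gen_minimal[OF _ symbol_alg_cstar], clarify)
  fix i assume i: "i \<in> {1..d}"
  have "sconv (S i)" using symbol_compr(1)[OF R_bops[OF i] R_commutes_U[OF i]] by (simp only: compr_R[OF i])
  moreover have "sconv (adj H (S i))"
    using symbol_compr(1)[OF K.adj_bops[OF R_bops[OF i]] adj_R_commutes_U[OF i]]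
    by (simp only: compr_adj[OF R_bops[OF i]] compr_R[OF i])
  ultimately show "S i \<in> symbol_alg"
    using S_bops[OF i] R_CR[OF i] by (simp add: symbol_alg_def symbol_S[OF i])
qed

lemma CSD: "X \<in> CS \<Longrightarrow> sconv X" "X \<in> CS \<Longrightarrow> sconv (adj H X)" "X \<in> CS \<Longrightarrow> symbol X \<in> CR"
  using CS_subset by (auto simp: symbol_alg_def)

lemma symbol_star_hom: "unital_star_hom H CS K CR symbol"
proof -
  have "symbol (id_op H) = id_op K" using symbol_eqI[OF K.id_bops Phi_id] by blast
  then show ?thesis
    unfolding unital_star_hom_def op_linear_on_def
    by (auto simp: CSD CS_bops symbol_add symbol_scale symbol_comp symbol_adj)
qed

end

subsection \<open>The cross section and the kernel of the symbol map\<close>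

context minimal_extension
begin

definition U_power :: "nat \<Rightarrow> 'b \<Rightarrow> 'b" where "U_power m = restrict_op K (U ^^ m)"
definition P_power :: "nat \<Rightarrow> 'a \<Rightarrow> 'a" where "P_power m = restrict_op H (P ^^ m)"

lemma U_power_bops: "U_power m \<in> bops K"
  by (rule K.bopsI[where B = 1]) (auto simp: U_power_def restrict_op_def U_pow_linear K.add_mem K.scale_mem)

lemma adj_U_power: "x \<in> K \<Longrightarrow> adj K (U_power m) x = (Us ^^ m) x"
proof (rule K.eqI_cinner)
  assume x: "x \<in> K"
  show "adj K (U_power m) x \<in> K" by (rule K.bops_mem[OF K.adj_bops[OF U_power_bops]])
  show "cinner (adj K (U_power m) x) z = cinner ((Us ^^ m) x) z" if "z \<in> K" for z
    using K.cinner_adj_left[OF U_power_bops x that] x that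
    by (simp add: cinner_Us_pow U_power_def restrict_op_def)
qed simp

lemma P_power_CS: "P_power m \<in> CS"
proof (induction m)
  case 0
  have "P_power 0 = id_op H" by (auto simp: P_power_def restrict_op_def id_op_def)
  then show ?case using H.cstar_id[OF CS_cstar] by simp
next
  case (Suc m)
  have "P_power (Suc m) = P \<circ> P_power m"
    by (auto simp: P_power_def restrict_op_def H.bops_zero[OF S_bops[OF d_mem]])
  then show ?case using H.cstar_comp[OF CS_cstar S_CS[OF d_mem] Suc] by (simp only:)
qed

lemma P_power_apply: "h \<in> H \<Longrightarrow> P_power m h = (P ^^ m) h"
  by (simp add: P_power_def restrict_op_def)

lemmas P_power_bops = CS_bops[OF P_power_CS]
  and adj_P_power_CS = H.cstar_adj[OF CS_cstar P_power_CS]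

lemmas adj_P_power_bops = CS_bops[OF adj_P_power_CS]

text \<open>The adjoint form of \<open>U^m V = V P^m\<close>.\<close>

lemma W_Us_pow: "k \<in> K \<Longrightarrow> W ((Us ^^ m) k) = adj H (P_power m) (W k)"
  by (rule H.eqI_cinner)
    (auto simp: H.bops_mem[OF adj_P_power_bops] H.cinner_adj_left[OF P_power_bops] cinner_W_left
      P_power_apply V_P_pow cinner_Us_pow)

lemma adj_P_power_commute:
  assumes "h \<in> H"
  shows "adj H (P_power m) (adj H (P_power n) h) = adj H (P_power n) (adj H (P_power m) h)"
proof -
  have c: "P_power n \<circ> P_power m = P_power m \<circ> P_power n"
  proof (rule H.bops_eqI)
    show "(P_power n \<circ> P_power m) x = (P_power m \<circ> P_power n) x" if "x \<in> H" for x
      using that by (simp add: P_power_apply) (metis add.commute comp_apply funpow_add)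
  qed (intro H.comp_bops P_power_bops)+
  show ?thesis
    using H.adj_comp[OF P_power_bops P_power_bops] c by (metis comp_apply)
qed

text \<open>
  The operators \<open>U\<^sup>-\<^sup>m f(R)\<close> are characterised by their action on \<open>V H\<close>, which avoids a
  functional calculus for polynomials.
\<close>

definition eventually_analytic :: "('b \<Rightarrow> 'b) \<Rightarrow> bool"
  where "eventually_analytic D \<longleftrightarrow> (\<exists>m. \<exists>B\<in>CS. \<forall>h\<in>H. (U ^^ m) (D (V h)) = V (B h))"

text \<open>A star-algebra of fractions that contains the generators \<open>R i\<close> and is norm
  dense in \<open>CR\<close>. The condition on the adjoint of \<open>D\<close> is what makes it
  closed under adjoints.\<close>

definition fraction_alg :: "('b \<Rightarrow> 'b) set"
  where "fraction_alg = {D \<in> bops K. (\<forall>i\<in>{1..d}. D \<circ> R i = R i \<circ> D) \<and>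
    eventually_analytic D \<and> eventually_analytic (adj K D)}"

text \<open>Addition over the common denominator \<open>U^{m+n}\<close>: each numerator is
  multiplied by the power of \<open>P\<close> that belongs to the other denominator.\<close>

lemma eventually_analytic_add:
  assumes D: "D \<in> bops K" "eventually_analytic D" and E: "E \<in> bops K" "eventually_analytic E"
  shows "eventually_analytic (\<lambda>x. D x + E x)"
proof -
  obtain m B where B: "B \<in> CS" "\<And>h. h \<in> H \<Longrightarrow> (U ^^ m) (D (V h)) = V (B h)"
    using D(2) unfolding eventually_analytic_def by blast
  obtain n C where C: "C \<in> CS" "\<And>h. h \<in> H \<Longrightarrow> (U ^^ n) (E (V h)) = V (C h)"
    using E(2) unfolding eventually_analytic_def by blast
  have mem: "\<And>x. D x \<in> K" "\<And>x. E x \<in> K" "\<And>h. B h \<in> H" "\<And>h. C h \<in> H"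
    using K.bops_mem[OF D(1)] K.bops_mem[OF E(1)] H.bops_mem[OF CS_bops[OF B(1)]]
      H.bops_mem[OF CS_bops[OF C(1)]] by auto
  have "(U ^^ (m + n)) (D (V h) + E (V h)) = V ((P_power n \<circ> B) h + (P_power m \<circ> C) h)" if h: "h \<in> H" for h
  proof -
    have "(U ^^ (m + n)) (D (V h)) = (U ^^ n) ((U ^^ m) (D (V h)))"
      by (simp add: funpow_add[of n m] add.commute[of m n])
    moreover have "(U ^^ (m + n)) (E (V h)) = (U ^^ m) ((U ^^ n) (E (V h)))"
      by (simp add: funpow_add)
    ultimately show ?thesis
      using h mem by (simp add: U_pow_linear B(2) C(2) P_power_apply V_add V_P_pow)
  qed
  moreover have "(\<lambda>h. (P_power n \<circ> B) h + (P_power m \<circ> C) h) \<in> CS"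
    by (intro H.cstar_add[OF CS_cstar] H.cstar_comp[OF CS_cstar] P_power_CS B C)
  ultimately show ?thesis unfolding eventually_analytic_def
    by (intro exI[of _ "m + n"] bexI[of _ "\<lambda>h. (P_power n \<circ> B) h + (P_power m \<circ> C) h"]) auto
qed

lemma eventually_analytic_scale:
  assumes D: "D \<in> bops K" "eventually_analytic D"
  shows "eventually_analytic (\<lambda>x. c *\<^sub>C D x)"
proof -
  obtain m B where B: "B \<in> CS" "\<And>h. h \<in> H \<Longrightarrow> (U ^^ m) (D (V h)) = V (B h)"
    using D(2) unfolding eventually_analytic_def by blast
  then show ?thesis unfolding eventually_analytic_def
    by (intro exI[of _ m] bexI[of _ "\<lambda>h. c *\<^sub>C B h"])
      (auto simp: U_pow_linear K.bops_mem[OF D(1)] V_scale H.bops_mem[OF CS_bops] H.cstar_scale[OF CS_cstar])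
qed

lemma eventually_analytic_comp:
  assumes D: "D \<in> bops K" "D \<circ> U = U \<circ> D" "eventually_analytic D" and E: "E \<in> bops K" "eventually_analytic E"
  shows "eventually_analytic (D \<circ> E)"
proof -
  obtain m B where B: "B \<in> CS" "\<And>h. h \<in> H \<Longrightarrow> (U ^^ m) (D (V h)) = V (B h)"
    using D(3) unfolding eventually_analytic_def by blast
  obtain n C where C: "C \<in> CS" "\<And>h. h \<in> H \<Longrightarrow> (U ^^ n) (E (V h)) = V (C h)"
    using E(2) unfolding eventually_analytic_def by blast
  have "(U ^^ (m + n)) (D (E (V h))) = V (B (C h))" if h: "h \<in> H" for h
  proof -
    have "(U ^^ (m + n)) (D (E (V h))) = (U ^^ m) ((U ^^ n) (D (E (V h))))" by (simp add: funpow_add)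
    also have "(U ^^ n) (D (E (V h))) = D ((U ^^ n) (E (V h)))"
      by (rule commute_Us_pow(2)[OF D(1,2) K.bops_mem[OF E(1)], symmetric])
    finally show ?thesis using h by (simp add: C(2) B(2) H.bops_mem[OF CS_bops[OF C(1)]])
  qed
  then show ?thesis unfolding eventually_analytic_def
    using H.cstar_comp[OF CS_cstar B(1) C(1)] by (intro exI[of _ "m + n"] bexI[of _ "B \<circ> C"]) auto
qed

lemma fractionD:
  assumes "D \<in> fraction_alg"
  shows "D \<in> bops K" "\<And>i. i \<in> {1..d} \<Longrightarrow> D \<circ> R i = R i \<circ> D" "eventually_analytic D"
    "eventually_analytic (adj K D)" "D \<circ> U = U \<circ> D"
    "\<And>i. i \<in> {1..d} \<Longrightarrow> adj K D \<circ> R i = R i \<circ> adj K D"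
proof -
  show D: "D \<in> bops K" and DR: "\<And>i. i \<in> {1..d} \<Longrightarrow> D \<circ> R i = R i \<circ> D" and "eventually_analytic D"
    "eventually_analytic (adj K D)"
    using assms by (auto simp: fraction_alg_def)
  show "D \<circ> U = U \<circ> D" by (rule DR[OF d_mem])
  fix i assume i: "i \<in> {1..d}"
  have "adj K (D \<circ> adj K (R i)) = adj K (adj K (R i) \<circ> D)"
    using commute_adj_R[OF D DR i] by simp
  then show "adj K D \<circ> R i = R i \<circ> adj K D"
    using D R_bops[OF i] by (simp add: K.adj_comp K.adj_bops)
qed

lemma fraction_alg_star: "star_subalgebra K fraction_alg"
  unfolding star_subalgebra_def
proof (intro conjI ballI allI)
  show "fraction_alg \<subseteq> bops K" by (auto simp: fraction_alg_def)
  have "eventually_analytic (id_op K)" unfolding eventually_analytic_def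
    by (intro exI[of _ 0] bexI[of _ "id_op H"] H.cstar_id[OF CS_cstar]) auto
  moreover have "id_op K \<circ> R i = R i \<circ> id_op K" if "i \<in> {1..d}" for i using R_bops[OF that] by simp
  ultimately show "id_op K \<in> fraction_alg" by (simp add: fraction_alg_def del: K.comp_id)
  fix D assume D: "D \<in> fraction_alg"
  note D' = fractionD[OF D]
  have DR: "D (R i x) = R i (D x)" if "i \<in> {1..d}" for i x using D'(2)[OF that] by (metis comp_apply)
  show "(\<lambda>x. c *\<^sub>C D x) \<in> fraction_alg" for c
    unfolding fraction_alg_def
  proof (intro CollectI conjI ballI)
    fix i assume i: "i \<in> {1..d}"
    show "(\<lambda>x. c *\<^sub>C D x) \<circ> R i = R i \<circ> (\<lambda>x. c *\<^sub>C D x)"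
      by (rule ext) (simp add: DR[OF i] K.bops_scale[OF R_bops[OF i] K.bops_mem[OF D'(1)]])
  qed (use D' in \<open>auto simp: K.adj_scale eventually_analytic_scale K.scale_bops K.adj_bops\<close>)
  show "adj K D \<in> fraction_alg"
    using D' by (simp add: fraction_alg_def K.adj_bops)
  fix E assume E: "E \<in> fraction_alg"
  note E' = fractionD[OF E]
  have ER: "E (R i x) = R i (E x)" if "i \<in> {1..d}" for i x using E'(2)[OF that] by (metis comp_apply)
  show "(\<lambda>x. D x + E x) \<in> fraction_alg"
    unfolding fraction_alg_def
  proof (intro CollectI conjI ballI)
    fix i assume i: "i \<in> {1..d}"
    show "(\<lambda>x. D x + E x) \<circ> R i = R i \<circ> (\<lambda>x. D x + E x)"
      by (rule ext)
        (simp add: DR[OF i] ER[OF i] K.bops_add[OF R_bops[OF i] K.bops_mem[OF D'(1)] K.bops_mem[OF E'(1)]])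
  qed (use D' E' in \<open>auto simp: K.adj_add eventually_analytic_add K.add_bops K.adj_bops\<close>)
  show "D \<circ> E \<in> fraction_alg"
    unfolding fraction_alg_def
  proof (intro CollectI conjI ballI)
    show "(D \<circ> E) \<circ> R i = R i \<circ> (D \<circ> E)" if i: "i \<in> {1..d}" for i
      by (rule ext) (simp add: DR[OF i] ER[OF i])
    show "eventually_analytic (D \<circ> E)"
      by (rule eventually_analytic_comp[OF D'(1,5,3) E'(1,3)])
    show "eventually_analytic (adj K (D \<circ> E))"
      unfolding K.adj_comp[OF D'(1) E'(1)]
      by (rule eventually_analytic_comp[OF K.adj_bops[OF E'(1)] E'(6)[OF d_mem] E'(4) K.adj_bops[OF D'(1)] D'(4)])
  qed (intro K.comp_bops D' E')
qed

text \<open>The adjoint of \<open>R i\<close> is a fraction with denominator \<open>U\<close>: its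
  numerator is \<open>S (d - i)\<close>, or the identity when \<open>i = d\<close>.\<close>

lemma R_fraction:
  assumes i: "i \<in> {1..d}"
  shows "R i \<in> fraction_alg"
proof -
  have "eventually_analytic (R i)" unfolding eventually_analytic_def
    by (intro exI[of _ 0] bexI[of _ "S i"] S_CS i) (simp add: V_S[OF i])
  moreover have "eventually_analytic (adj K (R i))"
  proof (cases "i = d")
    case True
    then show ?thesis unfolding eventually_analytic_def
      by (intro exI[of _ 1] bexI[of _ "id_op H"] H.cstar_id[OF CS_cstar]) simp
  next
    case False
    with i have i': "i \<in> {1..d - 1}" "d - i \<in> {1..d}" by auto
    have "U (adj K (R i) (V h)) = V (S (d - i) h)" if h: "h \<in> H" for h
      using h R_commute[OF d_mem i'(2), of "Us (V h)"] by (simp add: adj_R[OF i'(1)] V_S[OF i'(2)])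
    then show ?thesis unfolding eventually_analytic_def
      by (intro exI[of _ 1] bexI[of _ "S (d - i)"] S_CS i') simp
  qed
  moreover have "R i \<circ> R j = R j \<circ> R i" if j: "j \<in> {1..d}" for j
    by (rule K.bops_eqI) (use R_commute[OF i j] in \<open>auto intro: K.comp_bops R_bops[OF i] R_bops[OF j]\<close>)
  ultimately show ?thesis using R_bops[OF i] by (simp add: fraction_alg_def)
qed

lemma CR_approx: "Y \<in> CR \<Longrightarrow> Y \<in> K.norm_closure fraction_alg"
proof -
  have "R ` {1..d} \<subseteq> K.norm_closure fraction_alg"
    using K.norm_closure_subset[of fraction_alg] fraction_alg_star R_fraction by (auto simp: star_subalgebra_def)
  then have "CR \<subseteq> K.norm_closure fraction_alg"
    unfolding CR_def by (rule K.cstar_gen_minimal[OF _ K.cstar_norm_closure[OF fraction_alg_star]])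
  then show "Y \<in> CR \<Longrightarrow> Y \<in> K.norm_closure fraction_alg" by blast
qed

text \<open>Applied first with \<open>Y\<close> an entry of \<open>R\<close> and then with
  \<open>Y\<close> in \<open>CR\<close>, which makes \<open>CR\<close> commutative.\<close>

lemma CR_commutes:
  assumes Y: "Y \<in> bops K" "\<And>i. i \<in> {1..d} \<Longrightarrow> R i \<circ> Y = Y \<circ> R i" and A: "A \<in> CR"
  shows "A \<circ> Y = Y \<circ> A"
proof -
  let ?C = "{A \<in> bops K. A \<circ> Y = Y \<circ> A \<and> A \<circ> adj K Y = adj K Y \<circ> A}"
  have "R i \<circ> adj K Y = adj K Y \<circ> R i" if i: "i \<in> {1..d}" for i
  proof -
    have "adj K (Y \<circ> adj K (R i)) = adj K (adj K (R i) \<circ> Y)"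
      using commute_adj_R[OF Y(1) Y(2)[symmetric] i] by simp
    then show ?thesis using Y R_bops[OF i] by (simp add: K.adj_comp K.adj_bops)
  qed
  then have "R ` {1..d} \<subseteq> ?C" using Y R_bops by auto
  then have "CR \<subseteq> ?C" unfolding CR_def by (rule K.cstar_gen_minimal[OF _ K.cstar_commutant[OF Y(1)]])
  then show ?thesis using A by blast
qed

lemma CR_commutes_R: "Y \<in> CR \<Longrightarrow> i \<in> {1..d} \<Longrightarrow> Y \<circ> R i = R i \<circ> Y"
proof (rule CR_commutes)
  fix j assume i: "i \<in> {1..d}" and j: "j \<in> {1..d}"
  show "R j \<circ> R i = R i \<circ> R j" by (rule fractionD(2)[OF R_fraction[OF j] i])
qed (use R_bops in auto)

lemma CR_commute: "Y \<in> CR \<Longrightarrow> Z \<in> CR \<Longrightarrow> Y \<circ> Z = Z \<circ> Y"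
  by (rule CR_commutes) (auto simp: CR_bops CR_commutes_R)

lemma fraction_compr:
  assumes D: "D \<in> fraction_alg" and B: "\<And>h. h \<in> H \<Longrightarrow> (U ^^ m) (D (V h)) = V (B h)" and h: "h \<in> H"
  shows "D (V h) = (Us ^^ m) (V (B h))"
  using B[OF h] K.bops_mem[OF fractionD(1)[OF D]] by (metis Us_pow_U_pow)

text \<open>A fraction with denominator \<open>U^m\<close> and numerator \<open>B\<close> compresses
  to \<open>V^* U^{-m} V B = P^{*m} B\<close>.\<close>

lemma compr_fraction_CS:
  assumes D: "D \<in> fraction_alg"
  shows "compr D \<in> CS"
proof -
  obtain m B where B: "B \<in> CS" "\<And>h. h \<in> H \<Longrightarrow> (U ^^ m) (D (V h)) = V (B h)"
    using fractionD(3)[OF D] unfolding eventually_analytic_def by blast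
  have "compr D = adj H (P_power m) \<circ> B"
  proof (rule H.bops_eqI)
    show "compr D h = (adj H (P_power m) \<circ> B) h" if h: "h \<in> H" for h
      using h H.bops_mem[OF CS_bops[OF B(1)]]
      by (simp add: compr_apply fraction_compr[OF D B(2)] W_Us_pow)
  qed (intro compr_bops fractionD(1)[OF D] H.comp_bops adj_P_power_bops CS_bops[OF B(1)])+
  then show ?thesis using H.cstar_comp[OF CS_cstar adj_P_power_CS B(1)] by simp
qed

lemma compr_CS:
  assumes Y: "Y \<in> CR"
  shows "compr Y \<in> CS"
proof -
  obtain F where F: "\<And>n. F n \<in> fraction_alg" "K.norm_lim F Y"
    using K.norm_closureE[OF CR_approx[OF Y]] by blast
  show ?thesis
    by (rule H.norm_closedD[OF H.cstar_closed[OF CS_cstar] compr_bops[OF CR_bops[OF Y]]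
          compr_fraction_CS[OF F(1)] norm_lim_compr[OF fractionD(1)[OF F(1)] CR_bops[OF Y] F(2)]])
qed

lemma symbol_compr_CR: "Y \<in> CR \<Longrightarrow> symbol (compr Y) = Y"
  by (rule symbol_compr(2)) (auto simp: CR_bops CR_commutes_R)

lemma symbol_image: "symbol ` CS = CR"
proof
  show "symbol ` CS \<subseteq> CR" using CSD by blast
  show "CR \<subseteq> symbol ` CS"
  proof
    fix Y assume "Y \<in> CR"
    then show "Y \<in> symbol ` CS" using symbol_compr_CR compr_CS by (metis imageI)
  qed
qed

subsection \<open>The commutator ideal\<close>

text \<open>The commutator ideal is an intersection of closed ideals, so membership in it is proved
  for an arbitrary closed ideal \<open>J\<close> that contains the commutators.\<close>

context
  fixes J
  assumes J: "closed_ideal H CS J"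
    and gens: "\<And>X Y. X \<in> CS \<inter> toeplitz_ops d H S \<Longrightarrow> Y \<in> CS \<inter> toeplitz_ops d H S \<Longrightarrow>
      (\<lambda>x. X (Y x) - Y (X x)) \<in> J"
begin

private lemma J_closed: "norm_closed H J" and J_zero: "(\<lambda>_. 0) \<in> J"
  and J_add: "A \<in> J \<Longrightarrow> B \<in> J \<Longrightarrow> (\<lambda>x. A x + B x) \<in> J"
  and J_scale: "A \<in> J \<Longrightarrow> (\<lambda>x. c *\<^sub>C A x) \<in> J"
  and J_left: "A \<in> CS \<Longrightarrow> B \<in> J \<Longrightarrow> A \<circ> B \<in> J" and J_right: "A \<in> CS \<Longrightarrow> B \<in> J \<Longrightarrow> B \<circ> A \<in> J"
  and J_sub: "J \<subseteq> CS"
  using J by (auto simp: closed_ideal_def)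

text \<open>For fractions with denominators \<open>U^m\<close>, \<open>U^n\<close> and numerators
  \<open>B\<close>, \<open>C\<close> the defect equals
  \<open>P^{*m} (B P^{*n} - P^{*n} B) C\<close>. The bracket is a commutator of Toeplitz operators:
  \<open>B\<close> is the compression of \<open>U^m D\<close>, and \<open>P^{*n}\<close> is that of
  \<open>U^{-n}\<close>.\<close>

private lemma defect_fraction:
  assumes D: "D \<in> fraction_alg" and E: "E \<in> fraction_alg"
  shows "(\<lambda>x. (compr D \<circ> compr E) x - compr (D \<circ> E) x) \<in> J"
proof -
  note D' = fractionD[OF D] and E' = fractionD[OF E]
  obtain m B where B: "B \<in> CS" "\<And>h. h \<in> H \<Longrightarrow> (U ^^ m) (D (V h)) = V (B h)"
    using D'(3) unfolding eventually_analytic_def by blast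
  obtain n C where C: "C \<in> CS" "\<And>h. h \<in> H \<Longrightarrow> (U ^^ n) (E (V h)) = V (C h)"
    using E'(3) unfolding eventually_analytic_def by blast
  have mem: "\<And>h. B h \<in> H" "\<And>h. C h \<in> H" "\<And>h l. adj H (P_power l) h \<in> H"
    using H.bops_mem[OF CS_bops[OF B(1)]] H.bops_mem[OF CS_bops[OF C(1)]] H.bops_mem[OF adj_P_power_bops] by auto
  let ?Q = "adj H (P_power n)"
  have "B \<in> toeplitz_ops d H S"
  proof (rule compression_toeplitz[OF CS_bops[OF B(1)] K.comp_bops[OF U_power_bops D'(1)]])
    fix i assume i: "i \<in> {1..d}"
    have "D (R i x) = R i (D x)" for x using D'(2)[OF i] by (metis comp_apply)
    then show "(U_power m \<circ> D) \<circ> R i = R i \<circ> (U_power m \<circ> D)"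
      using R_U_pow[OF i] R_mem[OF i] K.bops_mem[OF D'(1)]
      by (auto simp: U_power_def restrict_op_def fun_eq_iff)
  next
    show "B h = W ((U_power m \<circ> D) (V h))" if "h \<in> H" for h
      using B(2)[OF that] mem K.bops_mem[OF D'(1)] by (simp add: U_power_def restrict_op_def)
  qed
  moreover have "?Q \<in> toeplitz_ops d H S"
  proof (rule compression_toeplitz[OF adj_P_power_bops K.adj_bops[OF U_power_bops]])
    show "adj K (U_power n) \<circ> R i = R i \<circ> adj K (U_power n)" if i: "i \<in> {1..d}" for i
    proof (rule K.bops_eqI)
      show "(adj K (U_power n) \<circ> R i) x = (R i \<circ> adj K (U_power n)) x" if "x \<in> K" for x
        using that by (simp add: adj_U_power R_mem[OF i] R_Us_pow[OF i])
    qed (intro K.comp_bops K.adj_bops U_power_bops R_bops i)+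
    show "?Q h = W (adj K (U_power n) (V h))" if "h \<in> H" for h
      using that by (simp add: adj_U_power W_Us_pow)
  qed
  ultimately have "(\<lambda>x. B (?Q x) - ?Q (B x)) \<in> J" using B(1) adj_P_power_CS by (intro gens) auto
  then have inJ: "adj H (P_power m) \<circ> ((\<lambda>x. B (?Q x) - ?Q (B x)) \<circ> C) \<in> J"
    by (intro J_left J_right adj_P_power_CS C)
  have "adj H (P_power m) \<circ> ((\<lambda>x. B (?Q x) - ?Q (B x)) \<circ> C)
      = (\<lambda>x. (compr D \<circ> compr E) x - compr (D \<circ> E) x)"
  proof (rule H.bops_eqI)
    fix h assume h: "h \<in> H"
    have cD: "compr D g = adj H (P_power m) (B g)" if "g \<in> H" for g
      using that mem by (simp add: compr_apply fraction_compr[OF D B(2)] W_Us_pow)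
    have cE: "compr E h = ?Q (C h)"
      using h mem by (simp add: compr_apply fraction_compr[OF E C(2)] W_Us_pow)
    have "compr (D \<circ> E) h = W (D ((Us ^^ n) (V (C h))))"
      using h by (simp add: compr_apply fraction_compr[OF E C(2)])
    also have "\<dots> = W ((Us ^^ n) (D (V (C h))))"
      using mem by (simp add: commute_Us_pow(1)[OF D'(1,5)])
    also have "\<dots> = ?Q (adj H (P_power m) (B (C h)))"
      using mem K.bops_mem[OF D'(1)] by (simp add: W_Us_pow compr_apply[symmetric] cD)
    finally show "(adj H (P_power m) \<circ> ((\<lambda>x. B (?Q x) - ?Q (B x)) \<circ> C)) h
        = (compr D \<circ> compr E) h - compr (D \<circ> E) h"
      using h mem by (simp add: cE cD H.bops_diff[OF adj_P_power_bops] adj_P_power_commute[of _ m n])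
  next
    show "adj H (P_power m) \<circ> ((\<lambda>x. B (?Q x) - ?Q (B x)) \<circ> C) \<in> bops H"
      using inJ J_sub CS_bops by blast
    show "(\<lambda>x. (compr D \<circ> compr E) x - compr (D \<circ> E) x) \<in> bops H"
      by (intro H.diff_bops H.comp_bops compr_bops K.comp_bops D' E')
  qed
  with inJ show ?thesis by (simp only:)
qed

private lemma defect_CR:
  assumes Y: "Y \<in> CR" and Z: "Z \<in> CR"
  shows "(\<lambda>x. (compr Y \<circ> compr Z) x - compr (Y \<circ> Z) x) \<in> J"
proof -
  obtain F where F: "\<And>n. F n \<in> fraction_alg" "K.norm_lim F Y"
    using K.norm_closureE[OF CR_approx[OF Y]] by blast
  obtain G where G: "\<And>n. G n \<in> fraction_alg" "K.norm_lim G Z"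
    using K.norm_closureE[OF CR_approx[OF Z]] by blast
  have B: "\<And>n. F n \<in> bops K" "\<And>n. G n \<in> bops K" "Y \<in> bops K" "Z \<in> bops K"
    using fractionD(1)[OF F(1)] fractionD(1)[OF G(1)] CR_bops Y Z by auto
  have l1: "H.norm_lim (\<lambda>n. compr (F n) \<circ> compr (G n)) (compr Y \<circ> compr Z)"
    by (intro H.norm_lim_comp compr_bops norm_lim_compr B F(2) G(2))
  have l2: "H.norm_lim (\<lambda>n. compr (F n \<circ> G n)) (compr (Y \<circ> Z))"
    by (intro norm_lim_compr K.norm_lim_comp K.comp_bops B F(2) G(2))
  have "H.norm_lim (\<lambda>n x. (compr (F n) \<circ> compr (G n)) x - compr (F n \<circ> G n) x)
      (\<lambda>x. (compr Y \<circ> compr Z) x - compr (Y \<circ> Z) x)"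
    by (rule H.norm_lim_diff[OF _ _ l1 _ _ l2]) (intro H.comp_bops compr_bops K.comp_bops B)+
  then show ?thesis
    by (rule H.norm_closedD[OF J_closed H.diff_bops[OF H.comp_bops[OF compr_bops compr_bops] compr_bops[OF K.comp_bops]]
          defect_fraction[OF F(1) G(1)], rotated -1]) (rule B)+
qed

text \<open>With r for compression and p for the symbol, \<open>X Y - r(p(X) p(Y))\<close> splits
  into \<open>(X - r p X) Y\<close>, \<open>r p X (Y - r p Y)\<close> and the multiplicativity
  defect of r at p(X), p(Y); all three lie in \<open>J\<close>.\<close>

private lemma section_defect_mult:
  assumes X: "X \<in> CS" "(\<lambda>x. X x - compr (symbol X) x) \<in> J" and Y: "Y \<in> CS" "(\<lambda>x. Y x - compr (symbol Y) x) \<in> J"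
  shows "(\<lambda>x. (X \<circ> Y) x - compr (symbol (X \<circ> Y)) x) \<in> J"
proof -
  have B: "X \<in> bops H" "Y \<in> bops H" "symbol X \<in> CR" "symbol Y \<in> CR"
    using X(1) Y(1) CS_bops CSD by auto
  have cB: "compr (symbol X) \<in> bops H" by (intro compr_bops CR_bops B)
  have m: "\<And>x. Y x \<in> H" "\<And>x. compr (symbol Y) x \<in> H"
    using H.bops_mem[OF B(2)] H.bops_mem[OF compr_bops[OF CR_bops[OF B(4)]]] by auto
  have "(\<lambda>x. ((\<lambda>x. X x - compr (symbol X) x) \<circ> Y) x + (compr (symbol X) \<circ> (\<lambda>x. Y x - compr (symbol Y) x)) x) \<in> J"
    by (intro J_add J_right J_left X Y compr_CS B)
  from J_add[OF this defect_CR[OF B(3,4)]] show ?thesis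
    using X(1) Y(1) CSD B by (simp add: symbol_comp H.bops_diff[OF cB] m cong: if_cong)
qed

text \<open>The operators with this property form a C*-algebra, and for the generators the
  difference is 0. In particular every operator with symbol 0 lies in \<open>J\<close>.\<close>

lemma CS_minus_section:
  assumes "X \<in> CS"
  shows "(\<lambda>x. X x - compr (symbol X) x) \<in> J"
proof -
  let ?g = "\<lambda>X. (\<lambda>x. X x - compr (symbol X) x)"
  \<comment> \<open>\<open>closed_ideal\<close> does not provide adjoints of members of
    \<open>J\<close>, so the condition on the adjoint of \<open>X\<close> is imposed
    outright.\<close>
  define G where "G = {X \<in> CS. ?g X \<in> J \<and> ?g (adj H X) \<in> J}"
  have "cstar_subalgebra H G"
    unfolding cstar_subalgebra_def star_subalgebra_def
  proof (intro conjI ballI allI)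
    show "G \<subseteq> bops H" using CS_bops by (auto simp: G_def)
    have "symbol (id_op H) = id_op K" using symbol_eqI[OF K.id_bops Phi_id] by blast
    then show "id_op H \<in> G" using J_zero H.cstar_id[OF CS_cstar] by (simp add: G_def compr_id)
    have adjC: "adj H X \<in> CS" if "X \<in> CS" for X using H.cstar_adj[OF CS_cstar that] .
    fix X assume "X \<in> G"
    then have X: "X \<in> CS" "?g X \<in> J" "?g (adj H X) \<in> J" by (auto simp: G_def)
    have scale: "?g (\<lambda>x. c *\<^sub>C Z x) \<in> J" if "Z \<in> CS" "?g Z \<in> J" for c Z
      using J_scale[OF that(2), of c] CSD[OF that(1)] CS_bops[OF that(1)]
      by (simp add: symbol_scale compr_scale scaleC_diff_right)
    have add: "?g (\<lambda>x. Z x + Z' x) \<in> J" if "Z \<in> CS" "?g Z \<in> J" "Z' \<in> CS" "?g Z' \<in> J" for Z Z'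
      using J_add[OF that(2,4)] CSD[OF that(1)] CSD[OF that(3)] CS_bops[OF that(1)] CS_bops[OF that(3)]
      by (simp add: symbol_add compr_add algebra_simps)
    show "(\<lambda>x. c *\<^sub>C X x) \<in> G" for c
      using X scale[of X c] scale[of "adj H X" "cnj c"] adjC[OF X(1)]
      by (simp add: G_def H.cstar_scale[OF CS_cstar] H.adj_scale CS_bops)
    show "adj H X \<in> G" using X adjC by (simp add: G_def CS_bops)
    fix Y assume "Y \<in> G"
    then have Y: "Y \<in> CS" "?g Y \<in> J" "?g (adj H Y) \<in> J" by (auto simp: G_def)
    show "(\<lambda>x. X x + Y x) \<in> G"
      using X Y add[of X Y] add[of "adj H X" "adj H Y"] adjC
      by (simp add: G_def H.cstar_add[OF CS_cstar] H.adj_add CS_bops)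
    have "?g (X \<circ> Y) \<in> J" by (rule section_defect_mult[OF X(1,2) Y(1,2)])
    moreover have "?g (adj H (X \<circ> Y)) \<in> J"
      unfolding H.adj_comp[OF CS_bops[OF X(1)] CS_bops[OF Y(1)]]
      by (rule section_defect_mult[OF adjC[OF Y(1)] Y(3) adjC[OF X(1)] X(3)])
    ultimately show "X \<circ> Y \<in> G" using H.cstar_comp[OF CS_cstar X(1) Y(1)] by (simp add: G_def)
  next
    show "norm_closed H G"
    proof (rule H.norm_closedI)
      fix F A assume A: "A \<in> bops H" and F: "\<And>n. F n \<in> G" and lim: "H.norm_lim F A"
      have F': "\<And>n. F n \<in> CS" "\<And>n. ?g (F n) \<in> J" "\<And>n. ?g (adj H (F n)) \<in> J" using F by (auto simp: G_def)
      have ACS: "A \<in> CS" by (rule H.norm_closedD[OF H.cstar_closed[OF CS_cstar] A F'(1) lim])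
      have gl: "?g Z \<in> J" if Z: "Z \<in> CS" and E: "\<And>n. E n \<in> CS" "\<And>n. ?g (E n) \<in> J" "H.norm_lim E Z" for Z E
      proof -
        have EB: "\<And>n. E n \<in> bops H" "Z \<in> bops H" "\<And>n. symbol (E n) \<in> bops K" "symbol Z \<in> bops K"
          using E(1) Z CS_bops CSD CR_bops by blast+
        have l: "K.norm_lim (\<lambda>n. symbol (E n)) (symbol Z)"
          by (rule norm_lim_symbol(2)[OF EB(1) CSD(1)[OF E(1)] E(3) EB(2)])
        have "H.norm_lim (\<lambda>n. ?g (E n)) (?g Z)"
          by (rule H.norm_lim_diff[OF EB(1,2) E(3) _ _ norm_lim_compr[OF EB(3,4) l]]) (intro compr_bops EB)+
        then show ?thesis
          by (rule H.norm_closedD[OF J_closed H.diff_bops[OF EB(2) compr_bops[OF EB(4)]] E(2)])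
      qed
      have "?g A \<in> J" by (rule gl[OF ACS F'(1,2) lim])
      moreover have "?g (adj H A) \<in> J"
        by (rule gl[OF H.cstar_adj[OF CS_cstar ACS] H.cstar_adj[OF CS_cstar F'(1)] F'(3)
              H.norm_lim_adj[OF CS_bops[OF F'(1)] A lim]])
      ultimately show "A \<in> G" using ACS by (simp add: G_def)
    qed
  qed
  moreover have "S ` {1..d} \<subseteq> G"
  proof clarify
    fix i assume i: "i \<in> {1..d}"
    have "?g (S i) = (\<lambda>_. 0)" by (simp add: symbol_S[OF i] compr_R[OF i])
    moreover have "?g (adj H (S i)) = (\<lambda>_. 0)"
      using S_CS[OF i]
      by (simp add: symbol_adj CS_bops CSD symbol_S[OF i] compr_adj[OF R_bops[OF i]] compr_R[OF i])
    ultimately show "S i \<in> G" using J_zero S_CS[OF i] by (simp add: G_def)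
  qed
  ultimately have "CS \<subseteq> G" unfolding CS_def by (intro H.cstar_gen_minimal)
  with assms show ?thesis by (auto simp: G_def)
qed

end

text \<open>Modulo any closed ideal containing the commutators, \<open>X\<close> agrees with the
  compression of its symbol, which gives one inclusion. For the other, the kernel is itself a closed
  ideal, and it contains the commutators because \<open>CR\<close> is commutative.\<close>

lemma kernel_eq_commutator_ideal: "{X \<in> CS. symbol X = (\<lambda>_. 0)} = commutator_ideal d H S"
proof
  let ?gens = "{(\<lambda>x. X (Y x) - Y (X x)) | X Y. X \<in> CS \<inter> toeplitz_ops d H S \<and> Y \<in> CS \<inter> toeplitz_ops d H S}"
  have ideal: "commutator_ideal d H S = closed_ideal H CS hull ?gens"
    by (simp only: commutator_ideal_def CS_def)
  show "{X \<in> CS. symbol X = (\<lambda>_. 0)} \<subseteq> commutator_ideal d H S"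
  proof
    fix X assume X: "X \<in> {X \<in> CS. symbol X = (\<lambda>_. 0)}"
    show "X \<in> commutator_ideal d H S" unfolding ideal hull_def
    proof clarify
      fix J assume J: "closed_ideal H CS J" "?gens \<subseteq> J"
      have "(\<lambda>x. X x - compr (symbol X) x) \<in> J"
        by (rule CS_minus_section[OF J(1)]) (use J(2) X in blast)+
      moreover have "compr (\<lambda>_. 0) = (\<lambda>_. 0)" using compr_scale[of 0 "\<lambda>_. 0"] by simp
      ultimately show "X \<in> J" using X by simp
    qed
  qed
  show "commutator_ideal d H S \<subseteq> {X \<in> CS. symbol X = (\<lambda>_. 0)}"
    unfolding ideal
  proof (rule hull_minimal)
    show "?gens \<subseteq> {X \<in> CS. symbol X = (\<lambda>_. 0)}"
    proof clarify
      fix X Y assume "X \<in> CS" "Y \<in> CS"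
      then have XY: "X \<circ> Y \<in> CS" "Y \<circ> X \<in> CS" "symbol X \<circ> symbol Y = symbol Y \<circ> symbol X"
        using H.cstar_comp[OF CS_cstar] CR_commute CSD by auto
      have "(\<lambda>x. (X \<circ> Y) x - (Y \<circ> X) x) \<in> CS" by (rule H.cstar_diff[OF CS_cstar XY(1,2)])
      moreover have "symbol (\<lambda>x. (X \<circ> Y) x - (Y \<circ> X) x) = (\<lambda>_. 0)"
        using symbol_diff[OF CS_bops[OF XY(1)] CSD(1)[OF XY(1)] CS_bops[OF XY(2)] CSD(1)[OF XY(2)]]
          XY(3) \<open>X \<in> CS\<close> \<open>Y \<in> CS\<close>
        by (simp add: symbol_comp CS_bops CSD)
      ultimately show "(\<lambda>x. X (Y x) - Y (X x)) \<in> CS \<and> symbol (\<lambda>x. X (Y x) - Y (X x)) = (\<lambda>_. 0)"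
        by simp
    qed
    show "closed_ideal H CS {X \<in> CS. symbol X = (\<lambda>_. 0)}"
      unfolding closed_ideal_def
    proof (intro conjI ballI allI)
      show "norm_closed H {X \<in> CS. symbol X = (\<lambda>_. 0)}"
      proof (rule H.norm_closedI)
        fix F A assume A: "A \<in> bops H" and F: "\<And>n. F n \<in> {X \<in> CS. symbol X = (\<lambda>_. 0)}" and lim: "H.norm_lim F A"
        have F': "\<And>n. F n \<in> CS" "\<And>n. symbol (F n) = (\<lambda>_. 0)" using F by auto
        have "A \<in> CS" by (rule H.norm_closedD[OF H.cstar_closed[OF CS_cstar] A F'(1) lim])
        moreover have "K.norm_lim (\<lambda>n. symbol (F n)) (symbol A)"
          by (rule norm_lim_symbol(2)[OF CS_bops[OF F'(1)] CSD(1)[OF F'(1)] lim A])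
        then have "symbol A x = 0" for x
          using K.norm_lim_apply[of "\<lambda>n. symbol (F n)" "symbol A" x] F'(2) CR_bops CSD(3) F'(1) \<open>A \<in> CS\<close>
          by (simp add: LIMSEQ_const_iff)
        ultimately show "A \<in> {X \<in> CS. symbol X = (\<lambda>_. 0)}" by auto
      qed
      show "(\<lambda>_. 0) \<in> {X \<in> CS. symbol X = (\<lambda>_. 0)}"
        using H.cstar_zero[OF CS_cstar] H.cstar_id[OF CS_cstar] symbol_scale[of "id_op H" 0] CSD(1)
        by simp
    qed (auto simp: symbol_add symbol_scale symbol_comp CS_bops CSD H.cstar_add[OF CS_cstar]
        H.cstar_scale[OF CS_cstar] H.cstar_comp[OF CS_cstar] K.bops_zero[OF CR_bops[OF CSD(3)]])
  qed
qed

end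

subsection \<open>Complete isometry\<close>

context closed_csubspace
begin

text \<open>A supremum of reals is usable only together with an upper bound; the crude one by the
  norms of all entries is enough.\<close>

lemma matrix_value_bdd:
  fixes n :: nat
  assumes A: "\<And>i j. i < n \<Longrightarrow> j < n \<Longrightarrow> A i j \<in> bops M"
  shows "bdd_above ((\<lambda>x. L2_set (\<lambda>i. norm (\<Sum>j<n. A i j (x j))) {..<n}) `
    {x. (\<forall>j<n. x j \<in> M) \<and> L2_set (\<lambda>j. norm (x j)) {..<n} \<le> 1})"
proof (rule bdd_aboveI2)
  fix x assume "x \<in> {x. (\<forall>j<n. x j \<in> M) \<and> L2_set (\<lambda>j. norm (x j)) {..<n} \<le> 1}"
  then have x: "L2_set (\<lambda>j. norm (x j)) {..<n} \<le> 1" by simp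
  have x1: "norm (x j) \<le> 1" if "j < n" for j
  proof -
    have "(\<lambda>j. norm (x j)) j \<le> L2_set (\<lambda>j. norm (x j)) {..<n}"
      by (rule member_le_L2_set) (use that in auto)
    with x show ?thesis by simp
  qed
  have "L2_set (\<lambda>i. norm (\<Sum>j<n. A i j (x j))) {..<n} \<le> (\<Sum>i<n. norm (\<Sum>j<n. A i j (x j)))"
    by (rule L2_set_le_sum) simp
  also have "\<dots> \<le> (\<Sum>i<n. \<Sum>j<n. onorm (A i j))"
  proof (intro sum_mono sum_norm_le)
    fix i j assume ij: "i \<in> {..<n}" "j \<in> {..<n}"
    then have "norm (A i j (x j)) \<le> onorm (A i j) * norm (x j)" by (intro norm_le_onorm A) auto
    also have "\<dots> \<le> onorm (A i j) * 1" using ij x1 by (intro mult_left_mono onorm_nonneg A) auto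
    finally show "norm (A i j (x j)) \<le> onorm (A i j)" by simp
  qed
  finally show "L2_set (\<lambda>i. norm (\<Sum>j<n. A i j (x j))) {..<n} \<le> (\<Sum>i<n. \<Sum>j<n. onorm (A i j))" .
qed

lemma le_matrix_onorm:
  assumes "\<And>i j. i < n \<Longrightarrow> j < n \<Longrightarrow> A i j \<in> bops M"
    and "\<And>j. j < n \<Longrightarrow> x j \<in> M" "L2_set (\<lambda>j. norm (x j)) {..<n} \<le> 1"
  shows "L2_set (\<lambda>i. norm (\<Sum>j<n. A i j (x j))) {..<n} \<le> matrix_onorm n M A"
  unfolding matrix_onorm_def
  by (rule cSUP_upper[OF _ matrix_value_bdd[of n A]]) (use assms in auto)

lemma matrix_onorm_leI:
  assumes "\<And>x. (\<And>j. j < n \<Longrightarrow> x j \<in> M) \<Longrightarrow> L2_set (\<lambda>j. norm (x j)) {..<n} \<le> 1 \<Longrightarrow>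
    L2_set (\<lambda>i. norm (\<Sum>j<n. A i j (x j))) {..<n} \<le> b"
  shows "matrix_onorm n M A \<le> b"
  unfolding matrix_onorm_def
proof (rule cSUP_least)
  show "{x. (\<forall>j<n. x j \<in> M) \<and> L2_set (\<lambda>j. norm (x j)) {..<n} \<le> 1} \<noteq> {}"
    by (auto simp: L2_set_def intro!: exI[of _ "\<lambda>_. 0"])
qed (use assms in auto)

end

context minimal_extension
begin

lemma W_sum: "W (sum f I) = (\<Sum>i\<in>I. W (f i))"
  using W_scale[of 0 0] by (induction I rule: infinite_finite_induct) (auto simp: W_add)

lemma V_sum: "(\<And>i. i \<in> I \<Longrightarrow> f i \<in> H) \<Longrightarrow> V (sum f I) = (\<Sum>i\<in>I. V (f i))"
  by (induction I rule: infinite_finite_induct) (auto simp: V_add H.sum_mem)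

lemma Us_pow_sum: "(\<And>i. i \<in> I \<Longrightarrow> f i \<in> K) \<Longrightarrow> (Us ^^ m) (sum f I) = (\<Sum>i\<in>I. (Us ^^ m) (f i))"
  using Us_pow_linear(2)[of 0 m 0]
  by (induction I rule: infinite_finite_induct) (auto simp: Us_pow_linear K.sum_mem)

text \<open>Compression does not increase matrix norms, because \<open>V\<close> is isometric and
  \<open>W\<close> contractive. Conversely the matrix is the strong limit of matrices
  \<open>U^{-m} V (compr A_ij) W U^m\<close>, whose norms are at most that of the compressed
  matrix.\<close>

lemma compr_completely_isometric: "completely_isometric K CR H compr"
  unfolding completely_isometric_def
proof (intro allI impI antisym)
  fix n and A :: "nat \<Rightarrow> nat \<Rightarrow> 'b \<Rightarrow> 'b"
  assume "\<forall>i<n. \<forall>j<n. A i j \<in> CR"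
  then have A: "A i j \<in> CR" if "i < n" "j < n" for i j using that by blast
  have AB: "A i j \<in> bops K" if "i < n" "j < n" for i j using A[OF that] CR_bops by blast
  have cB: "compr (A i j) \<in> bops H" if "i < n" "j < n" for i j using compr_bops[OF AB[OF that]] .
  show "matrix_onorm n H (\<lambda>i j. compr (A i j)) \<le> matrix_onorm n K A"
  proof (rule H.matrix_onorm_leI)
    fix x assume x: "\<And>j. j < n \<Longrightarrow> x j \<in> H" "L2_set (\<lambda>j. norm (x j)) {..<n} \<le> 1"
    have "norm (\<Sum>j<n. compr (A i j) (x j)) \<le> norm (\<Sum>j<n. A i j (V (x j)))" for i
    proof -
      have "(\<Sum>j<n. compr (A i j) (x j)) = W (\<Sum>j<n. A i j (V (x j)))"
        using x(1) by (simp add: W_sum compr_apply)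
      then show ?thesis by (simp add: norm_W)
    qed
    then have "L2_set (\<lambda>i. norm (\<Sum>j<n. compr (A i j) (x j))) {..<n}
        \<le> L2_set (\<lambda>i. norm (\<Sum>j<n. A i j (V (x j)))) {..<n}"
      by (intro L2_set_mono) auto
    also have "\<dots> \<le> matrix_onorm n K A"
    proof (rule K.le_matrix_onorm[of n A "\<lambda>j. V (x j)"])
      have "L2_set (\<lambda>j. norm (V (x j))) {..<n} = L2_set (\<lambda>j. norm (x j)) {..<n}"
        using x(1) by (intro L2_set_cong) auto
      then show "L2_set (\<lambda>j. norm (V (x j))) {..<n} \<le> 1" using x(2) by simp
    qed (use AB x in auto)
    finally show "L2_set (\<lambda>i. norm (\<Sum>j<n. compr (A i j) (x j))) {..<n} \<le> matrix_onorm n K A" .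
  qed
  show "matrix_onorm n K A \<le> matrix_onorm n H (\<lambda>i j. compr (A i j))"
  proof (rule K.matrix_onorm_leI)
    fix y assume y: "\<And>j. j < n \<Longrightarrow> y j \<in> K" "L2_set (\<lambda>j. norm (y j)) {..<n} \<le> 1"
    have lim: "(\<lambda>m. L2_set (\<lambda>i. norm (\<Sum>j<n. Phi m (compr (A i j)) (y j))) {..<n})
        \<longlonglongrightarrow> L2_set (\<lambda>i. norm (\<Sum>j<n. A i j (y j))) {..<n}"
      unfolding L2_set_def
    proof (intro tendsto_real_sqrt tendsto_sum tendsto_power tendsto_norm)
      fix i j assume ij: "i \<in> {..<n}" "j \<in> {..<n}"
      then have "(\<lambda>m. Phi m (compr (A i j)) (y j)) \<longlonglongrightarrow> symbol (compr (A i j)) (y j)"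
        using compr_CS[OF A] y(1) by (intro symbol_lim CSD) auto
      then show "(\<lambda>m. Phi m (compr (A i j)) (y j)) \<longlonglongrightarrow> A i j (y j)"
        using symbol_compr_CR[OF A] ij by simp
    qed
    have "L2_set (\<lambda>i. norm (\<Sum>j<n. Phi m (compr (A i j)) (y j))) {..<n}
        \<le> matrix_onorm n H (\<lambda>i j. compr (A i j))" for m
    proof -
      \<comment> \<open>The contraction \<open>V^* U^m\<close>, applied entrywise, maps the unit
        ball of the sum of \<open>n\<close> copies of \<open>K\<close> into that of \<open>n\<close>
        copies of \<open>H\<close>.\<close>
      define x where "x j = W ((U ^^ m) (y j))" for j
      have "norm (\<Sum>j<n. Phi m (compr (A i j)) (y j)) = norm (\<Sum>j<n. compr (A i j) (x j))" if i: "i < n" for i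
      proof -
        have mem: "compr (A i j) (x j) \<in> H" if "j < n" for j by (rule H.bops_mem[OF cB[OF i that]])
        have "(\<Sum>j<n. Phi m (compr (A i j)) (y j)) = (Us ^^ m) (V (\<Sum>j<n. compr (A i j) (x j)))"
        proof -
          have "V (\<Sum>j<n. compr (A i j) (x j)) = (\<Sum>j<n. V (compr (A i j) (x j)))"
            by (rule V_sum) (use mem in auto)
          moreover have "(Us ^^ m) (\<Sum>j<n. V (compr (A i j) (x j))) = (\<Sum>j<n. (Us ^^ m) (V (compr (A i j) (x j))))"
            by (rule Us_pow_sum) (use mem in auto)
          ultimately show ?thesis using y(1) by (simp add: Phi_apply x_def)
        qed
        moreover have "(\<Sum>j<n. compr (A i j) (x j)) \<in> H" by (rule H.sum_mem) (use mem in auto)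
        ultimately show ?thesis by simp
      qed
      then have "L2_set (\<lambda>i. norm (\<Sum>j<n. Phi m (compr (A i j)) (y j))) {..<n}
          = L2_set (\<lambda>i. norm (\<Sum>j<n. compr (A i j) (x j))) {..<n}"
        by (intro L2_set_cong) auto
      also have "\<dots> \<le> matrix_onorm n H (\<lambda>i j. compr (A i j))"
      proof (rule H.le_matrix_onorm[OF cB])
        have "L2_set (\<lambda>j. norm (x j)) {..<n} \<le> L2_set (\<lambda>j. norm (y j)) {..<n}"
          using norm_W y(1) by (intro L2_set_mono) (auto simp: x_def intro: order_trans[OF norm_W])
        then show "L2_set (\<lambda>j. norm (x j)) {..<n} \<le> 1" using y(2) by simp
      qed (auto simp: x_def)
      finally show ?thesis .
    qed
    then show "L2_set (\<lambda>i. norm (\<Sum>j<n. A i j (y j))) {..<n} \<le> matrix_onorm n H (\<lambda>i j. compr (A i j))"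
      by (intro LIMSEQ_le_const2[OF lim]) blast
  qed
qed

theorem symbol_exact_sequence:
  "\<exists>\<pi>\<^sub>0. unital_star_hom H (cstar_gen H (S ` {1..d})) K (cstar_gen K (R ` {1..d})) \<pi>\<^sub>0 \<and>
    (\<forall>i\<in>{1..d}. \<pi>\<^sub>0 (S i) = R i) \<and>
    {X \<in> cstar_gen H (S ` {1..d}). \<pi>\<^sub>0 X = (\<lambda>_. 0)} = commutator_ideal d H S \<and>
    \<pi>\<^sub>0 ` cstar_gen H (S ` {1..d}) = cstar_gen K (R ` {1..d}) \<and>
    (\<exists>\<rho>. ci_cross_section H (cstar_gen H (S ` {1..d})) K (cstar_gen K (R ` {1..d})) \<pi>\<^sub>0 \<rho>)"
proof (intro exI[of _ symbol] conjI ballI)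
  have "ci_cross_section H CS K CR symbol compr"
    unfolding ci_cross_section_def op_linear_on_def
    using compr_CS compr_completely_isometric symbol_compr_CR by (auto simp: compr_add compr_scale)
  then show "\<exists>\<rho>. ci_cross_section H (cstar_gen H (S ` {1..d})) K (cstar_gen K (R ` {1..d})) symbol \<rho>"
    unfolding CS_def CR_def by blast
qed (use symbol_star_hom symbol_S kernel_eq_commutator_ideal symbol_image in \<open>unfold CS_def CR_def, blast+\<close>)

end

text \<open>The inclusion of a submodule is an embedding. Boundedness of \<open>S\<close> is
  inherited by restriction from the ambient tuple.\<close>

lemma isometric_module_extension:
  assumes "2 \<le> d" "isometric_module d H S"
  obtains K R where "isometric_extension d H S K R (\<lambda>x. x)"
proof -
  obtain K R where um: "unitary_module d K R" and sub: "submodule d H S K R"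
    using assms(2) unfolding isometric_module_def by blast
  interpret K: closed_csubspace K
    using um by unfold_locales (simp add: unitary_module_def contractive_module_def hilbert_module_def)
  interpret H: closed_csubspace H
    using sub by unfold_locales (simp add: submodule_def)
  have HK: "x \<in> K" if "x \<in> H" for x using sub that by (auto simp: submodule_def)
  have RB: "R i \<in> bops K" if "i \<in> {1..d}" for i
    using um that by (auto simp: unitary_module_def normal_op_def)
  have S: "S i = restrict_op H (R i)" "R i ` H \<subseteq> H" if "i \<in> {1..d}" for i
    using sub that by (auto simp: submodule_def)
  have "isometric_extension d H S K R (\<lambda>x. x)"
  proof
    show "S i \<in> bops H" if i: "i \<in> {1..d}" for i
      by (rule H.bopsI[where B = "onorm (R i)"])
        (use S(2)[OF i] K.norm_le_onorm[OF RB[OF i]] in \<open>auto simp: S(1)[OF i] restrict_op_def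
          K.bops_add[OF RB[OF i]] K.bops_scale[OF RB[OF i]] HK H.add_mem H.scale_mem\<close>)
    show "isometric_embedding d H S K R (\<lambda>x. x)"
      using HK S(1) by (auto simp: isometric_embedding_def clinear_on_def restrict_op_def)
  qed (use assms(1) um H.hilbert_subspace in auto)
  then show thesis by (rule that)
qed

text \<open>The extension is constructed inside the unitary module that the hypothesis provides, so
  it lives in the type of \<open>H\<close>. All further claims concern an arbitrary minimal
  extension, possibly in another type, with its own embedding.\<close>

theorem theorem3:
  fixes d :: nat and H :: "'a::chilbert_space set" and S :: "nat \<Rightarrow> 'a \<Rightarrow> 'a"
  assumes "d \<ge> 2" and "isometric_module d H S"
  shows
    "(\<exists>(K :: 'a set) R V. minimal_unitary_extension d H S K R V) \<and>
     (\<forall>(K :: 'b::chilbert_space set) R V. minimal_unitary_extension d H S K R V \<longrightarrow>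
        K = closure (cspan {zpow_op K (R d) m (V h) | m h. h \<in> H}) \<and>
        (\<forall>X\<in>bops H.
          (\<forall>i\<in>{1..d}. X \<circ> S i = S i \<circ> X) \<longleftrightarrow>
          (\<exists>!Y. Y \<in> bops K \<and> (\<forall>i\<in>{1..d}. Y \<circ> R i = R i \<circ> Y) \<and>
             (\<forall>h\<in>H. Y (V h) = V (X h)) \<and> onorm Y = onorm X)) \<and>
        (\<forall>X\<in>bops H.
          X \<in> toeplitz_ops d H S \<longleftrightarrow>
          (\<exists>!Y. Y \<in> commutant K (von_neumann_gen K (R ` {1..d})) \<and> onorm X = onorm Y \<and>
             (\<forall>h\<in>H. V (X h) = orth_proj (V ` H) (Y (V h))))) \<and>
        (\<exists>\<pi>\<^sub>0.
          unital_star_hom H (cstar_gen H (S ` {1..d})) K (cstar_gen K (R ` {1..d})) \<pi>\<^sub>0 \<and>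
          (\<forall>i\<in>{1..d}. \<pi>\<^sub>0 (S i) = R i) \<and>
          {X \<in> cstar_gen H (S ` {1..d}). \<pi>\<^sub>0 X = (\<lambda>_. 0)} = commutator_ideal d H S \<and>
          \<pi>\<^sub>0 ` cstar_gen H (S ` {1..d}) = cstar_gen K (R ` {1..d}) \<and>
          (\<exists>\<rho>. ci_cross_section H (cstar_gen H (S ` {1..d})) K (cstar_gen K (R ` {1..d})) \<pi>\<^sub>0 \<rho>)))"
proof -
  obtain K0 R0 where ext: "isometric_extension d H S K0 R0 (\<lambda>x. x)"
    by (rule isometric_module_extension[OF assms])
  show ?thesis
  proof (intro conjI allI impI)
    show "\<exists>(K :: 'a set) R V. minimal_unitary_extension d H S K R V"
      using isometric_extension.minimal_extension_closure_core[OF ext] by blast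
  next
    fix K :: "'b set" and R V
    assume m: "minimal_unitary_extension d H S K R V"
    have e: "isometric_extension d H S K R V"
      using assms(1) isometric_extension.H_subspace[OF ext] isometric_extension.S_bops[OF ext] m
      by unfold_locales (auto simp: minimal_unitary_extension_def)
    interpret minimal_extension d H S K R V
      by (rule isometric_extension.minimal_extensionI[OF e m])
    show "K = closure (cspan {zpow_op K (R d) m (V h) | m h. h \<in> H})"
      by (rule K_eq_closure_cspan)
    show "\<forall>X\<in>bops H.
      (\<forall>i\<in>{1..d}. X \<circ> S i = S i \<circ> X) \<longleftrightarrow>
      (\<exists>!Y. Y \<in> bops K \<and> (\<forall>i\<in>{1..d}. Y \<circ> R i = R i \<circ> Y) \<and>
         (\<forall>h\<in>H. Y (V h) = V (X h)) \<and> onorm Y = onorm X)"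
      by (intro ballI commute_iff_unique_extension)
    show "\<forall>X\<in>bops H.
      X \<in> toeplitz_ops d H S \<longleftrightarrow>
      (\<exists>!Y. Y \<in> commutant K (von_neumann_gen K (R ` {1..d})) \<and> onorm X = onorm Y \<and>
         (\<forall>h\<in>H. V (X h) = orth_proj (V ` H) (Y (V h))))"
      by (intro ballI toeplitz_iff_unique_symbol)
    show "\<exists>\<pi>\<^sub>0.
      unital_star_hom H (cstar_gen H (S ` {1..d})) K (cstar_gen K (R ` {1..d})) \<pi>\<^sub>0 \<and>
      (\<forall>i\<in>{1..d}. \<pi>\<^sub>0 (S i) = R i) \<and>
      {X \<in> cstar_gen H (S ` {1..d}). \<pi>\<^sub>0 X = (\<lambda>_. 0)} = commutator_ideal d H S \<and>
      \<pi>\<^sub>0 ` cstar_gen H (S ` {1..d}) = cstar_gen K (R ` {1..d}) \<and>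
      (\<exists>\<rho>. ci_cross_section H (cstar_gen H (S ` {1..d})) K (cstar_gen K (R ` {1..d})) \<pi>\<^sub>0 \<rho>)"
      by (rule symbol_exact_sequence)
  qed
qed

end
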